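(* Let $(G_n,S_n)_{n\ge 0}$ be an evolving random graph model with selected vertices, with minimal initial degree $m\ge 0$ of the new vertices (model and notation as described in the context). Suppose that all of the following hold. (1) With probability $1$, $X[n,d]\sim c_d\, n$ as $n\to\infty$ for every $d\ge m$, where $(c_d)_{d\ge m}$ is a probability distribution with $c_d>0$ for all $d\ge m$. (2) $c_d\sim K d^{-\gamma}$ as $d\to\infty$ for some positive numbers $K$ and $\gamma$. (3) For every $n\ge 0$, if $w_1,w_2\in V_n$ and $\deg_n(w_1)=\deg_n(w_2)$, then $\mathbb P((w_1,v_{n+1})\in E_{n+1}\mid\mathcal F_n)=\mathbb P((w_2,v_{n+1})\in E_{n+1}\mid\mathcal F_n)$. (4) With probability $1$, $\sum_{i=1}^{n+1} I[i,d]=p_d\, n+o(n)$ as $n\to\infty$ for every $d\ge m$, where $(p_d)_{d\ge m}$ is an exponentially decreasing probability distribution. (5) For every $d\ge m$ there exists a random variable $Z_d\ge 0$ with exponentially decreasing distribution such that $\mathbb P(Y[i,d]\ge l\mid\mathcal F_i)\le\mathbb P(Z_d\ge l)$ for all $i\ge 1$, $l\ge 1$. (6) For every $d\ge m$, $k_d:=\sum_{j=m}^d (p_j-c_j)>0$. (7) $S_n\subseteq S_{n+1}$ for all $n\ge 0$. (8) $I^*(n+1)$ is $\mathcal F_n^+$-measurable for all $n\ge 0$. (9) There exist a sequence of positive random variables $(\zeta_n)$ and a constant $\alpha>0$ such that, with probability $1$, $(\zeta_n)$ is slowly varying as $n\to\infty$ and $|S_n|\sim\zeta_n n^{\alpha}$.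 (10) There is an exponentially decreasing probability distribution $(q_d)_{d\ge m}$ such that for every $d\ge m$, almost surely as $n\to\infty$, $\sum_{i=1}^n E(I^*[i,d]\mid\mathcal F_{i-1})=(q_d+o(1))\sum_{i=1}^n E(I^*(i)\mid\mathcal F_{i-1})$. Then, with probability $1$, the limits $$\lim_{n\to\infty}\frac{X^*[n,d]}{|S_n|}=x_d$$ exist for all $d\ge m$. The $x_d$ are constants satisfying the recursive equations $$x_m=\frac{\alpha q_m}{\alpha+\frac{p_m-c_m}{c_m}},\qquad x_d=\frac{x_{d-1}\cdot\frac{k_{d-1}}{c_{d-1}}+\alpha q_d}{\alpha+\frac{k_d}{c_d}}\quad(d\ge m+1).$$ The sequence $(x_d)_{d\ge m}$ is a probability distribution, that is, $\sum_{d\ge m}x_d=1$. Moreover, $x_d\sim L\, d^{-\gamma^*}$ as $d\to\infty$ for some $L>0$, with $$\gamma^*=\alpha(\gamma-1)+1.$$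
   Context: Model. $G_n=(V_n,E_n)$, $n\ge 0$, is a sequence of evolving simple random graphs, with $S_n\subseteq V_n$ the set of selected vertices. $G_0=(V_0,E_0)$ is a finite simple graph (initial configuration), $V_0=\{u_1,\dots,u_l\}$, and $S_0\subseteq V_0$ is arbitrarily chosen. At the $n$th step ($n\ge1$): one new vertex $v_n$ is added, so $V_n=V_0\cup\{v_1,\dots,v_n\}$; $v_n$ gets some random edges, so $E_{n-1}\subseteq E_n$ and every edge of $E_n\setminus E_{n-1}$ is incident to $v_n$; and $v_n$ may be added to the set of selected vertices by a random choice (no other vertex can become selected at step $n$). The integer $m\ge 0$ is the minimal initial degree: each new vertex $v_n$ gets at least $m$ edges at step $n$. $\sigma$-fields. $\mathcal F_n$ is the $\sigma$-field generated by the first $n$ steps; $\mathcal F_n^+$ is the $\sigma$-field generated by the first $n$ steps together with the choice of the edges of $v_{n+1}$ at step $n+1$. Notation. $\deg_n(v)$ is the degree of $v$ in $G_n$ (always in the whole graph). For $d\ge 0$: $X[n,d]=|\{v\in V_n:\deg_n(v)=d\}|$; $Y[n,d]=|\{v\in V_n:\deg_n(v)=d,\ (v,v_{n+1})\in E_{n+1}\}|$; $I[n,d]=1$ if $\deg_n(v_n)=d$ and $0$ otherwise; $X^*[n,d]=|\{v\in S_n:\deg_n(v)=d\}|$; $I^*[n,d]=1$ if $v_n\in S_n$ and $\deg_n(v_n)=d$, and $0$ otherwise; $I^*(n)=1$ if $v_n\in S_n$ and $0$ otherwise. Conventions. A discrete probability distribution $(a_n)$ (on nonnegative integers) is exponentially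 decreasing if $a_n\le Cq^n$ for all $n\ge1$ for some $C>0$, $0<q<1$. A sequence $(a_n)$ is slowly varying if $a_{[sn]}/a_n\to1$ as $n\to\infty$ for all $s>0$, where $[\cdot]$ is the integer part. For nonnegative sequences, $a_n\sim b_n$ means $b_n>0$ for all but finitely many $n$ and $a_n/b_n\to1$. *)

theory Defs
  imports "HOL-Probability.Probability" "HOL-Library.Landau_Symbols"
begin

datatype vertex = Init nat | New nat

type_synonym graph = "vertex set set"

definition verts :: "nat \<Rightarrow> nat \<Rightarrow> vertex set" where
  "verts l n = Init ` {1..l} \<union> New ` {1..n}"

definition simple_graph :: "vertex set \<Rightarrow> graph \<Rightarrow> bool" where
  "simple_graph V E \<longleftrightarrow> E \<subseteq> {{x, y} | x y. x \<in> V \<and> y \<in> V \<and> x \<noteq> y}"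

definition deg :: "graph \<Rightarrow> vertex \<Rightarrow> nat" where
  "deg E v = card {e \<in> E. v \<in> e}"

text \<open>The graph process is given by its random edge sets and random sets of selected vertices;
  the vertex set after \<open>n\<close> steps is the deterministic set \<open>verts l n\<close>. No vertex other than the
  newest one can become selected; that selected vertices stay selected is not part of the model.\<close>

locale selected_graph_process = prob_space M
  for M :: "'w measure" +
  fixes l m :: nat
    and E0 :: graph and S0 :: "vertex set"
    and E :: "nat \<Rightarrow> 'w \<Rightarrow> graph" and S :: "nat \<Rightarrow> 'w \<Rightarrow> vertex set"
  assumes E_measurable: "\<And>n. E n \<in> measurable M (count_space UNIV)"
    and S_measurable: "\<And>n. S n \<in> measurable M (count_space UNIV)"
    and E_0: "\<And>\<omega>. \<omega> \<in> space M \<Longrightarrow> E 0 \<omega> = E0"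
    and S_0: "\<And>\<omega>. \<omega> \<in> space M \<Longrightarrow> S 0 \<omega> = S0"
    and E_simple: "\<And>n \<omega>. \<omega> \<in> space M \<Longrightarrow> simple_graph (verts l n) (E n \<omega>)"
    and S_verts: "\<And>n \<omega>. \<omega> \<in> space M \<Longrightarrow> S n \<omega> \<subseteq> verts l n"
    and E_mono: "\<And>n \<omega>. \<omega> \<in> space M \<Longrightarrow> E n \<omega> \<subseteq> E (Suc n) \<omega>"
    and E_new: "\<And>n \<omega> e. \<omega> \<in> space M \<Longrightarrow> e \<in> E (Suc n) \<omega> - E n \<omega> \<Longrightarrow> New (Suc n) \<in> e"
    and S_new: "\<And>n \<omega>. \<omega> \<in> space M \<Longrightarrow> S (Suc n) \<omega> \<subseteq> insert (New (Suc n)) (S n \<omega>)"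
    and min_deg: "\<And>n \<omega>. \<omega> \<in> space M \<Longrightarrow> m \<le> deg (E (Suc n) \<omega>) (New (Suc n))"

definition F_sigma ::
    "'w measure \<Rightarrow> (nat \<Rightarrow> 'w \<Rightarrow> graph) \<Rightarrow> (nat \<Rightarrow> 'w \<Rightarrow> vertex set) \<Rightarrow> nat \<Rightarrow> 'w measure" where
  "F_sigma M E S n =
     sigma (space M) {(\<lambda>\<omega>. (E k \<omega>, S k \<omega>)) -` A \<inter> space M | k A. k \<le> n}"

definition Fplus_sigma ::
    "'w measure \<Rightarrow> (nat \<Rightarrow> 'w \<Rightarrow> graph) \<Rightarrow> (nat \<Rightarrow> 'w \<Rightarrow> vertex set) \<Rightarrow> nat \<Rightarrow> 'w measure" where
  "Fplus_sigma M E S n =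
     sigma (space M) (sets (F_sigma M E S n) \<union> {E (Suc n) -` A \<inter> space M | A. True})"

definition cond_P :: "'w measure \<Rightarrow> 'w measure \<Rightarrow> ('w \<Rightarrow> bool) \<Rightarrow> 'w \<Rightarrow> real" where
  "cond_P M F A = real_cond_exp M F (indicator {\<omega> \<in> space M. A \<omega>})"

definition X_count :: "nat \<Rightarrow> (nat \<Rightarrow> 'w \<Rightarrow> graph) \<Rightarrow> nat \<Rightarrow> nat \<Rightarrow> 'w \<Rightarrow> nat" where
  "X_count l E n d \<omega> = card {v \<in> verts l n. deg (E n \<omega>) v = d}"

definition Y_count :: "nat \<Rightarrow> (nat \<Rightarrow> 'w \<Rightarrow> graph) \<Rightarrow> nat \<Rightarrow> nat \<Rightarrow> 'w \<Rightarrow> nat" where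
  "Y_count l E n d \<omega> =
     card {v \<in> verts l n. deg (E n \<omega>) v = d \<and> {v, New (Suc n)} \<in> E (Suc n) \<omega>}"

definition I_new :: "(nat \<Rightarrow> 'w \<Rightarrow> graph) \<Rightarrow> nat \<Rightarrow> nat \<Rightarrow> 'w \<Rightarrow> real" where
  "I_new E n d \<omega> = of_bool (deg (E n \<omega>) (New n) = d)"

definition X_sel ::
    "(nat \<Rightarrow> 'w \<Rightarrow> graph) \<Rightarrow> (nat \<Rightarrow> 'w \<Rightarrow> vertex set) \<Rightarrow> nat \<Rightarrow> nat \<Rightarrow> 'w \<Rightarrow> nat" where
  "X_sel E S n d \<omega> = card {v \<in> S n \<omega>. deg (E n \<omega>) v = d}"

definition I_sel_deg ::
    "(nat \<Rightarrow> 'w \<Rightarrow> graph) \<Rightarrow> (nat \<Rightarrow> 'w \<Rightarrow> vertex set) \<Rightarrow> nat \<Rightarrow> nat \<Rightarrow> 'w \<Rightarrow> real" where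
  "I_sel_deg E S n d \<omega> = of_bool (New n \<in> S n \<omega> \<and> deg (E n \<omega>) (New n) = d)"

definition I_sel :: "(nat \<Rightarrow> 'w \<Rightarrow> vertex set) \<Rightarrow> nat \<Rightarrow> 'w \<Rightarrow> real" where
  "I_sel S n \<omega> = of_bool (New n \<in> S n \<omega>)"

text \<open>Distributions \<open>(a\<^sub>d)\<close> are indexed by \<open>d \<ge> m\<close>; the values of \<open>a\<close> below \<open>m\<close> play no role.\<close>

definition prob_dist_from :: "nat \<Rightarrow> (nat \<Rightarrow> real) \<Rightarrow> bool" where
  "prob_dist_from m a \<longleftrightarrow> (\<forall>d\<ge>m. 0 \<le> a d) \<and> (a has_sum 1) {m..}"

definition exp_decreasing_from :: "nat \<Rightarrow> (nat \<Rightarrow> real) \<Rightarrow> bool" where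
  "exp_decreasing_from m a \<longleftrightarrow>
     (\<exists>C q. 0 < C \<and> 0 < q \<and> q < 1 \<and> (\<forall>d. m \<le> d \<and> 1 \<le> d \<longrightarrow> a d \<le> C * q ^ d))"

definition slowly_varying :: "(nat \<Rightarrow> real) \<Rightarrow> bool" where
  "slowly_varying a \<longleftrightarrow> (\<forall>s::real. 0 < s \<longrightarrow> (\<lambda>n. a (nat \<lfloor>s * real n\<rfloor>) / a n) \<longlonglongrightarrow> 1)"

end

theory Submission
  imports Defs "HOL-Real_Asymp.Real_Asymp"
begin

text \<open>
  Write \<open>s n\<close> for the number of selected vertices, \<open>X\<close> and \<open>X*\<close> for the number of all and of
  selected vertices of degree \<open>d\<close>, and \<open>Y\<close>, \<open>Y*\<close> for how many of these receive an edge from the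
  next vertex. By (3) the conditional expectation of \<open>Y*\<close> is \<open>X* e\<close> with \<open>e = E(Y | F) / X\<close>.
  Counting vertices of degree at most \<open>d\<close> shows that \<open>Y\<close> has Cesaro mean \<open>k d\<close>, and hence
  \<open>i e i\<close> has Cesaro mean \<open>k d / c d\<close>. The same count for the selected vertices, with \<open>Y*\<close> replaced
  by its compensator, reads
  \<open>X*[n,d] + (\<Sum>i<n. X*[i,d] e i) = ((\<Sum>j=m..d. q j) - (\<Sum>j=m..<d. x j)) s n + o(s n)\<close>
  by induction on \<open>d\<close>. Since \<open>s\<close> is monotone and regularly varying with exponent \<open>\<alpha>\<close>, a Karamata
  theorem gives \<open>(\<Sum>i<n. s i e i) \<sim> k d / (\<alpha> c d) s n\<close>, so \<open>x d s n\<close> solves this discrete Volterra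
  equation up to \<open>o(s n)\<close>, and by monotonicity of \<open>s\<close> so does every other solution.

  All replacements of sums by their compensators \<open>H\<close> rest on one strong law: if the increments are
  essentially bounded by \<open>b n\<close>, then the martingale is \<open>o((b n)\<^sup>2 + H n)\<close>. By (5), \<open>b n = n powr \<delta>\<close>
  with a small \<open>\<delta>\<close> is admissible. The recursion for \<open>x\<close> is solved explicitly.
\<close>

section \<open>Regularly varying sequences\<close>

text \<open>The hypotheses give no limit for single conditional edge probabilities: the compensators
  \<open>y\<close> of \<open>Y\<close> are controlled only in Cesaro mean, and
  \<open>i * e i\<close> need not converge. This shapes the deterministic part. The Karamata theorem
  takes a mean as its hypothesis and gets from the monotonicity of \<open>s\<close> what pointwise
  convergence would give, and the Volterra equation is handled by an induction that needs only
  \<open>0 \<le> e i \<le> 1\<close>. The sizes of the compensators are not known in advance either,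
  which is why the strong law carries \<open>H\<close> itself in its denominator. For
  \<open>Y\<close> and for the selection indicators the size of the sum is known, and the law
  returns that of \<open>H\<close>. For \<open>Y*\<close> it is the other way round:
  \<open>H\<close> is at most the sum of \<open>s i * e i\<close>, whose size Karamata supplies, so
  the law can be used before anything is known about \<open>X*\<close> in degree \<open>d\<close>.
  In both cases \<open>(b n)\<^sup>2\<close> must be negligible against \<open>n\<close> or
  \<open>s n\<close>, which a choice with \<open>2 * \<delta>\<close> below 1 and \<alpha>
  guarantees. The explicit form of \<open>x\<close> comes from a summation factor \<open>P\<close>;
  total mass 1 and the exponent are then consequences of the growth of \<open>P\<close>.\<close>

lemma contraction_eventually_le:
  fixes x :: "nat \<Rightarrow> real" and f :: "nat \<Rightarrow> nat"
  assumes nonneg: "\<And>n. 0 \<le> x n"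
    and less: "\<forall>\<^sub>F n in sequentially. f n < n"
    and lim: "filterlim f at_top sequentially"
    and b: "0 \<le> b" "b < 1" and \<delta>: "0 \<le> \<delta>"
    and ev: "\<forall>\<^sub>F n in sequentially. x n \<le> \<delta> + b * x (f n)"
    and \<epsilon>: "0 < \<epsilon>"
  shows "\<forall>\<^sub>F n in sequentially. x n \<le> \<delta> / (1 - b) + \<epsilon>"
proof -
  obtain N where N: "\<And>n. n \<ge> N \<Longrightarrow> f n < n \<and> x n \<le> \<delta> + b * x (f n)"
    using eventually_conj[OF less ev] unfolding eventually_sequentially by auto
  define r where "r = \<delta> / (1 - b)"
  define B where "B = (\<Sum>i\<le>N. x i)"
  have r: "0 \<le> r" "\<delta> + b * r = r"
    using b \<delta> by (auto simp: r_def field_simps)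
  have B0: "0 \<le> B"
    unfolding B_def by (intro sum_nonneg nonneg)
  \<comment> \<open>A crude global bound first. As \<open>r\<close> is the fixed point of the affine
    recursion, one application multiplies the excess over \<open>r\<close> by \<open>b\<close>, so
    an excess of at most \<open>B\<close> persists.\<close>
  have bound: "x n \<le> r + B" for n
  proof (induction n rule: less_induct)
    case (less n)
    show ?case
    proof (cases "n \<le> N")
      case True
      then have "x n \<le> B"
        unfolding B_def by (intro member_le_sum) (auto simp: nonneg)
      then show ?thesis
        using r by linarith
    next
      case False
      then have "f n < n" "x n \<le> \<delta> + b * x (f n)"
        using N[of n] by auto
      moreover have "b * x (f n) \<le> b * (r + B)"
        using less[OF \<open>f n < n\<close>] b by (intro mult_left_mono) auto
      moreover have "b * B \<le> B"
        using b B0 mult_right_mono[of b 1 B] by simp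
      ultimately show ?thesis
        using r(2) by (simp add: algebra_simps)
    qed
  qed
  \<comment> \<open>Since \<open>f\<close> tends to infinity, an eventual bound may be used at
    \<open>f n\<close>, and each such round gains a factor \<open>b\<close> on the excess.\<close>
  have iter: "\<forall>\<^sub>F n in sequentially. x n \<le> r + b ^ j * B" for j
  proof (induction j)
    case 0
    then show ?case
      using bound by simp
  next
    case (Suc j)
    have "\<forall>\<^sub>F n in sequentially. x (f n) \<le> r + b ^ j * B"
      using Suc lim by (rule eventually_compose_filterlim)
    with ev show ?case
    proof eventually_elim
      case (elim n)
      have "b * x (f n) \<le> b * (r + b ^ j * B)"
        using elim b by (intro mult_left_mono) auto
      then show ?case
        using elim r(2) by (simp add: algebra_simps)
    qed
  qed
  have "(\<lambda>j. b ^ j * B) \<longlonglongrightarrow> 0"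
    using b by (intro tendsto_mult_left_zero LIMSEQ_realpow_zero) auto
  then have "\<forall>\<^sub>F j in sequentially. b ^ j * B < \<epsilon>"
    using \<epsilon> by (rule order_tendstoD)
  then obtain j where "b ^ j * B < \<epsilon>"
    by (meson eventually_happens sequentially_bot)
  then show ?thesis
    using iter[of j] by (auto simp: r_def elim!: eventually_mono)
qed

lemma nat_floor_mult_less:
  assumes "0 < \<theta>" "\<theta> < (1::real)"
  shows "\<forall>\<^sub>F n in sequentially. nat \<lfloor>\<theta> * real n\<rfloor> < n"
  using eventually_gt_at_top[of "0::nat"]
proof eventually_elim
  case (elim n)
  then have "\<theta> * real n < real n"
    using assms by simp
  then have "\<lfloor>\<theta> * real n\<rfloor> < int n"
    by (simp add: floor_less_iff)
  then show ?case
    using elim by linarith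
qed

lemma nat_floor_mult_at_top:
  assumes "0 < (\<theta>::real)"
  shows "filterlim (\<lambda>n. nat \<lfloor>\<theta> * real n\<rfloor>) at_top sequentially"
  using assms by real_asymp

lemma nat_floor_mult_ratio:
  assumes "0 < (\<theta>::real)"
  shows "(\<lambda>n. real (nat \<lfloor>\<theta> * real n\<rfloor>) / real n) \<longlonglongrightarrow> \<theta>"
proof -
  have "(\<lambda>n. real_of_int \<lfloor>\<theta> * real n\<rfloor> / real n) \<longlonglongrightarrow> \<theta>"
    using assms by real_asymp
  moreover have "real (nat \<lfloor>\<theta> * real n\<rfloor>) = real_of_int \<lfloor>\<theta> * real n\<rfloor>" for n
    using assms by simp
  ultimately show ?thesis
    by simp
qed

lemma slope_powr_at_left_1:
  fixes \<alpha> :: real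
  assumes "0 < \<alpha>"
  shows "((\<lambda>\<theta>. (1 - \<theta>) / (1 - \<theta> powr \<alpha>)) \<longlongrightarrow> 1 / \<alpha>) (at_left 1)"
  using assms by real_asymp (simp add: field_simps)

text \<open>A Karamata theorem. Cutting the sum at \<open>\<theta> n\<close> gives, up to errors that are \<open>o(1 - \<theta>)\<close> as
  \<open>\<theta> \<rightarrow> 1\<close>, the recursion \<open>R n = \<kappa> (1 - \<theta>) + \<theta> powr \<alpha> * R (\<theta> n)\<close> for the quotient \<open>R\<close>,
  a contraction with fixed point close to \<open>\<kappa> / \<alpha>\<close>.\<close>

lemma karamata_weighted_sum:
  fixes s e :: "nat \<Rightarrow> real"
  assumes s: "incseq s" "\<And>n. 0 \<le> s n" "\<forall>\<^sub>F n in sequentially. 0 < s n"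
    and ratio: "\<And>\<theta>. 0 < \<theta> \<Longrightarrow> \<theta> < 1 \<Longrightarrow> (\<lambda>n. s (nat \<lfloor>\<theta> * real n\<rfloor>) / s n) \<longlonglongrightarrow> \<theta> powr \<alpha>"
    and \<alpha>: "0 < \<alpha>"
    and e: "\<And>n. 0 \<le> e n"
    and mean: "(\<lambda>n. (\<Sum>i<n. real i * e i) / real n) \<longlonglongrightarrow> \<kappa>"
  shows "(\<lambda>n. (\<Sum>i<n. s i * e i) / s n) \<longlonglongrightarrow> \<kappa> / \<alpha>"
proof -
  define V where "V n = (\<Sum>i<n. s i * e i)" for n
  define T where "T n = (\<Sum>i<n. real i * e i)" for n
  define R where "R n = V n / s n" for n
  define \<rho> where "\<rho> = \<kappa> / \<alpha>"
  \<comment> \<open>The first two terms are the errors left by the upper and the lower estimate of a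
    block. The square is slack that absorbs the eventual inequalities; being of second order in
    \<open>1 - \<theta> powr \<alpha>\<close>, it still vanishes after the division by
    \<open>1 - \<theta> powr \<alpha>\<close>.\<close>
  define D where "D \<theta> = \<bar>\<kappa> * (1 - \<theta>) / \<theta> - (1 - \<theta> powr \<alpha>) * \<rho>\<bar>
     + \<bar>\<theta> powr \<alpha> * (\<kappa> * (1 - \<theta>)) - (1 - \<theta> powr \<alpha>) * \<rho>\<bar> + (1 - \<theta> powr \<alpha>)\<^sup>2" for \<theta>
  have step: "\<forall>\<^sub>F n in sequentially. \<bar>R n - \<rho>\<bar> \<le> 2 * D \<theta> / (1 - \<theta> powr \<alpha>) + \<epsilon>"
    if \<theta>: "0 < \<theta>" "\<theta> < 1" and \<epsilon>: "0 < \<epsilon>" for \<theta> \<epsilon>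
  proof -
    define f where "f n = nat \<lfloor>\<theta> * real n\<rfloor>" for n
    define r where "r n = s (f n) / s n" for n
    define \<beta> where "\<beta> = \<theta> powr \<alpha>"
    have \<beta>: "0 < \<beta>" "\<beta> < 1"
      using \<theta> \<alpha> by (auto simp: \<beta>_def powr01_less_one)
    have f_less: "\<forall>\<^sub>F n in sequentially. f n < n"
      and f_top: "filterlim f at_top sequentially"
      and f_ratio: "(\<lambda>n. real (f n) / real n) \<longlonglongrightarrow> \<theta>"
      unfolding f_def using \<theta>
      by (intro nat_floor_mult_less nat_floor_mult_at_top nat_floor_mult_ratio; simp)+
    have r_lim: "r \<longlonglongrightarrow> \<beta>"
      unfolding r_def f_def \<beta>_def using ratio[OF \<theta>] .
    have f_pos: "\<forall>\<^sub>F n in sequentially. 0 < f n"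
      using eventually_gt_at_top f_top by (rule eventually_compose_filterlim)
    have sf_pos: "\<forall>\<^sub>F n in sequentially. 0 < s (f n)"
      using s(3) f_top by (rule eventually_compose_filterlim)
    have mean': "(\<lambda>n. T n / real n) \<longlonglongrightarrow> \<kappa>"
      using mean by (simp add: T_def)
    have "(\<lambda>n. T (f n) / real (f n) * (real (f n) / real n)) \<longlonglongrightarrow> \<kappa> * \<theta>"
      by (intro tendsto_mult f_ratio filterlim_compose[OF mean' f_top])
    then have "(\<lambda>n. T (f n) / real n) \<longlonglongrightarrow> \<kappa> * \<theta>"
      by (rule Lim_transform_eventually) (use f_pos in eventually_elim, auto)
    then have "(\<lambda>n. T n / real n - T (f n) / real n) \<longlonglongrightarrow> \<kappa> - \<kappa> * \<theta>"
      by (intro tendsto_diff mean')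
    then have inc: "(\<lambda>n. (T n - T (f n)) / real n) \<longlonglongrightarrow> \<kappa> * (1 - \<theta>)"
      by (simp add: diff_divide_distrib algebra_simps)
    have "(\<lambda>n. (T n - T (f n)) / real n / (real (f n) / real n)) \<longlonglongrightarrow> \<kappa> * (1 - \<theta>) / \<theta>"
      using \<theta> by (intro tendsto_divide inc f_ratio) auto
    then have up: "(\<lambda>n. (T n - T (f n)) / real (f n)) \<longlonglongrightarrow> \<kappa> * (1 - \<theta>) / \<theta>"
      by (rule Lim_transform_eventually)
        (use f_pos f_less in eventually_elim, auto)
    have lo: "(\<lambda>n. r n * ((T n - T (f n)) / real n)) \<longlonglongrightarrow> \<beta> * (\<kappa> * (1 - \<theta>))"
      by (intro tendsto_mult r_lim inc)
    have "\<forall>\<^sub>F n in sequentially. (T n - T (f n)) / real (f n) - (1 - r n) * \<rho>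
        < \<kappa> * (1 - \<theta>) / \<theta> - (1 - \<beta>) * \<rho> + (1 - \<beta>)\<^sup>2"
      using \<beta> by (intro order_tendstoD(2)[OF tendsto_diff[OF up
          tendsto_mult[OF tendsto_diff[OF tendsto_const r_lim] tendsto_const]]]) auto
    moreover have "\<forall>\<^sub>F n in sequentially. r n * ((T n - T (f n)) / real n) - (1 - r n) * \<rho>
        > \<beta> * (\<kappa> * (1 - \<theta>)) - (1 - \<beta>) * \<rho> - (1 - \<beta>)\<^sup>2"
      using \<beta> by (intro order_tendstoD(1)[OF tendsto_diff[OF lo
          tendsto_mult[OF tendsto_diff[OF tendsto_const r_lim] tendsto_const]]]) auto
    moreover have "\<forall>\<^sub>F n in sequentially. r n < (1 + \<beta>) / 2"
      by (rule order_tendstoD(2)[OF r_lim]) (use \<beta> in simp)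
    \<comment> \<open>The quotient \<open>r n\<close> only tends to \<open>\<beta>\<close>, so the
      contraction constant is taken as the midpoint of \<open>\<beta>\<close> and 1. This causes the
      factor 2 in front of \<open>D \<theta>\<close>.\<close>
    ultimately have "\<forall>\<^sub>F n in sequentially. \<bar>R n - \<rho>\<bar> \<le> D \<theta> + (1 + \<beta>) / 2 * \<bar>R (f n) - \<rho>\<bar>"
      using f_pos f_less sf_pos s(3)
    proof eventually_elim
      case (elim n)
      have V: "V n - V (f n) = (\<Sum>i\<in>{f n..<n}. s i * e i)"
        and T: "T n - T (f n) = (\<Sum>i\<in>{f n..<n}. real i * e i)"
        unfolding V_def T_def lessThan_atLeast0
        using sum_diff_nat_ivl[of 0 "f n" n] elim(5) by auto
      \<comment> \<open>On the block from \<open>f n\<close> to \<open>n\<close>, monotonicity gives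
        \<open>s (f n) \<le> s i \<le> s n\<close>, while \<open>i\<close> lies between
        \<open>f n\<close> and \<open>n\<close>. Hence \<open>s i\<close> is bracketed by multiples
        of \<open>i\<close>, and only the block sums of \<open>i * e i\<close> enter.\<close>
      have "V n - V (f n) \<le> (\<Sum>i\<in>{f n..<n}. s n / real (f n) * (real i * e i))"
        unfolding V
      proof (rule sum_mono)
        fix i assume i: "i \<in> {f n..<n}"
        have "s i * real (f n) \<le> s n * real i"
          using i s incseqD[OF s(1), of i n] by (intro mult_mono) auto
        then have "s i \<le> s n / real (f n) * real i"
          using elim(4) by (simp add: field_simps)
        then show "s i * e i \<le> s n / real (f n) * (real i * e i)"
          using e[of i] mult_right_mono[of "s i" "s n / real (f n) * real i" "e i"] by (simp add: mult.assoc)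
      qed
      also have "\<dots> = s n / real (f n) * (T n - T (f n))"
        by (simp add: T sum_distrib_left)
      finally have u: "(V n - V (f n)) / s n \<le> (T n - T (f n)) / real (f n)"
        using elim by (simp add: field_simps)
      have "(\<Sum>i\<in>{f n..<n}. s (f n) / real n * (real i * e i)) \<le> V n - V (f n)"
        unfolding V
      proof (rule sum_mono)
        fix i assume i: "i \<in> {f n..<n}"
        have "s (f n) * real i \<le> s i * real n"
          using i s incseqD[OF s(1), of "f n" i] by (intro mult_mono) auto
        then have "s (f n) / real n * real i \<le> s i"
          using elim(4,5) by (simp add: field_simps)
        then show "s (f n) / real n * (real i * e i) \<le> s i * e i"
          using e[of i] mult_right_mono[of "s (f n) / real n * real i" "s i" "e i"] by (simp add: mult.assoc)
      qed
      moreover have "(\<Sum>i\<in>{f n..<n}. s (f n) / real n * (real i * e i))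
          = s (f n) / real n * (T n - T (f n))"
        by (simp add: T sum_distrib_left)
      ultimately have "s (f n) / real n * (T n - T (f n)) \<le> V n - V (f n)"
        by simp
      from divide_right_mono[OF this, of "s n"]
      have l: "r n * ((T n - T (f n)) / real n) \<le> (V n - V (f n)) / s n"
        using elim(7) by (simp add: r_def mult_ac)
      have "R n - \<rho> = ((V n - V (f n)) / s n - (1 - r n) * \<rho>) + r n * (R (f n) - \<rho>)"
        using elim by (simp add: R_def r_def field_simps)
      then have "\<bar>R n - \<rho>\<bar> \<le> \<bar>(V n - V (f n)) / s n - (1 - r n) * \<rho>\<bar> + \<bar>r n * (R (f n) - \<rho>)\<bar>"
        by simp
      moreover have "\<bar>(V n - V (f n)) / s n - (1 - r n) * \<rho>\<bar> \<le> D \<theta>"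
        using u l elim(1,2) unfolding D_def \<beta>_def[symmetric] by (smt (verit) zero_le_power2)
      moreover have "\<bar>r n * (R (f n) - \<rho>)\<bar> \<le> (1 + \<beta>) / 2 * \<bar>R (f n) - \<rho>\<bar>"
        using elim(3) s(2) unfolding abs_mult
        by (intro mult_right_mono) (auto simp: r_def abs_of_nonneg)
      ultimately show ?case
        by linarith
    qed
    then have "\<forall>\<^sub>F n in sequentially. \<bar>R n - \<rho>\<bar> \<le> D \<theta> / (1 - (1 + \<beta>) / 2) + \<epsilon>"
      by (intro contraction_eventually_le[OF _ f_less f_top])
        (use \<beta> \<epsilon> in \<open>auto simp: D_def\<close>)
    moreover have "D \<theta> / (1 - (1 + \<beta>) / 2) = 2 * D \<theta> / (1 - \<theta> powr \<alpha>)"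
      using \<beta> by (simp add: \<beta>_def field_simps)
    ultimately show ?thesis
      by simp
  qed
  \<comment> \<open>Here the value \<kappa> / \<alpha> arises: after division by
    \<open>1 - \<theta> powr \<alpha>\<close>, both block estimates tend to \<kappa> times the
    inverse slope 1 / \<alpha> as \<theta> tends to 1.\<close>
  have "((\<lambda>\<theta>. 2 * (\<bar>\<kappa> * ((1 - \<theta>) / (1 - \<theta> powr \<alpha>)) / \<theta> - \<rho>\<bar>
     + \<bar>\<theta> powr \<alpha> * (\<kappa> * ((1 - \<theta>) / (1 - \<theta> powr \<alpha>))) - \<rho>\<bar> + (1 - \<theta> powr \<alpha>))) \<longlongrightarrow>
     2 * (\<bar>\<kappa> * (1 / \<alpha>) / 1 - \<rho>\<bar> + \<bar>1 powr \<alpha> * (\<kappa> * (1 / \<alpha>)) - \<rho>\<bar> + (1 - 1 powr \<alpha>))) (at_left 1)"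
    by (intro tendsto_intros slope_powr_at_left_1 \<alpha>) auto
  then have lim0: "((\<lambda>\<theta>. 2 * (\<bar>\<kappa> * ((1 - \<theta>) / (1 - \<theta> powr \<alpha>)) / \<theta> - \<rho>\<bar>
     + \<bar>\<theta> powr \<alpha> * (\<kappa> * ((1 - \<theta>) / (1 - \<theta> powr \<alpha>))) - \<rho>\<bar> + (1 - \<theta> powr \<alpha>))) \<longlongrightarrow> 0) (at_left 1)"
    by (simp add: \<rho>_def)
  have D_eq: "2 * D \<theta> / (1 - \<theta> powr \<alpha>) = 2 * (\<bar>\<kappa> * ((1 - \<theta>) / (1 - \<theta> powr \<alpha>)) / \<theta> - \<rho>\<bar>
     + \<bar>\<theta> powr \<alpha> * (\<kappa> * ((1 - \<theta>) / (1 - \<theta> powr \<alpha>))) - \<rho>\<bar> + (1 - \<theta> powr \<alpha>))"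
    if "0 < \<theta>" "\<theta> < 1" for \<theta>
  proof -
    define g where "g = 1 - \<theta> powr \<alpha>"
    have "0 < g"
      using that \<alpha> by (auto simp: g_def powr01_less_one)
    have abs_div: "\<bar>a - g * \<rho>\<bar> / g = \<bar>a / g - \<rho>\<bar>" for a
    proof -
      have "a / g - \<rho> = (a - g * \<rho>) / g"
        using \<open>0 < g\<close> by (simp add: field_simps)
      then show ?thesis
        using \<open>0 < g\<close> by (simp add: abs_divide)
    qed
    have "D \<theta> / g = \<bar>\<kappa> * (1 - \<theta>) / \<theta> - g * \<rho>\<bar> / g + \<bar>\<theta> powr \<alpha> * (\<kappa> * (1 - \<theta>)) - g * \<rho>\<bar> / g + g\<^sup>2 / g"
      unfolding D_def g_def[symmetric] by (simp add: add_divide_distrib)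
    also have "\<dots> = \<bar>\<kappa> * ((1 - \<theta>) / g) / \<theta> - \<rho>\<bar> + \<bar>\<theta> powr \<alpha> * (\<kappa> * ((1 - \<theta>) / g)) - \<rho>\<bar> + g"
      unfolding abs_div using \<open>0 < g\<close> by (simp add: power2_eq_square mult.commute)
    finally show ?thesis
      unfolding g_def by simp
  qed
  have "R \<longlonglongrightarrow> \<rho>"
  proof (rule metric_LIMSEQ_I)
    fix \<epsilon> :: real assume "0 < \<epsilon>"
    have "\<forall>\<^sub>F \<theta> in at_left 1. \<theta> \<in> {0<..<1::real}"
      by (rule eventually_at_leftI[of 0]) auto
    moreover have "\<forall>\<^sub>F \<theta> in at_left 1. 2 * (\<bar>\<kappa> * ((1 - \<theta>) / (1 - \<theta> powr \<alpha>)) / \<theta> - \<rho>\<bar>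
     + \<bar>\<theta> powr \<alpha> * (\<kappa> * ((1 - \<theta>) / (1 - \<theta> powr \<alpha>))) - \<rho>\<bar> + (1 - \<theta> powr \<alpha>)) < \<epsilon> / 2"
      using \<open>0 < \<epsilon>\<close> by (intro order_tendstoD(2)[OF lim0] half_gt_zero)
    ultimately have "\<forall>\<^sub>F \<theta> in at_left 1. 0 < \<theta> \<and> \<theta> < 1 \<and> 2 * D \<theta> / (1 - \<theta> powr \<alpha>) < \<epsilon> / 2"
      by eventually_elim (use D_eq in auto)
    then obtain \<theta> where "0 < \<theta>" "\<theta> < 1" "2 * D \<theta> / (1 - \<theta> powr \<alpha>) < \<epsilon> / 2"
      using eventually_happens[of _ "at_left (1::real)"] by auto
    with step[of \<theta> "\<epsilon> / 4"] \<open>0 < \<epsilon>\<close>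
    have "\<forall>\<^sub>F n in sequentially. \<bar>R n - \<rho>\<bar> < \<epsilon>"
      by (auto elim: eventually_mono)
    then show "\<exists>no. \<forall>n\<ge>no. dist (R n) \<rho> < \<epsilon>"
      by (simp add: eventually_sequentially dist_real_def)
  qed
  then show ?thesis
    by (simp add: R_def[abs_def] V_def \<rho>_def)
qed

text \<open>Passing from \<open>n / 2\<close> to \<open>n\<close> multiplies the quotient
  asymptotically by \<open>(1 / 2) powr (\<alpha> - \<beta>)\<close>, which is below 1. So the
  contraction lemma applies with vanishing inhomogeneity, and no representation theorem for slowly
  varying sequences is needed.\<close>

lemma regularly_varying_dominates_powr:
  fixes s :: "nat \<Rightarrow> real"
  assumes s: "\<And>n. 0 \<le> s n" "\<forall>\<^sub>F n in sequentially. 0 < s n"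
    and ratio: "(\<lambda>n. s (nat \<lfloor>1 / 2 * real n\<rfloor>) / s n) \<longlonglongrightarrow> (1 / 2) powr \<alpha>"
    and \<beta>: "\<beta> < \<alpha>"
  shows "(\<lambda>n. real n powr \<beta> / s n) \<longlonglongrightarrow> 0"
proof -
  define f where "f n = nat \<lfloor>1 / 2 * real n\<rfloor>" for n
  define x where "x n = real n powr \<beta> / s n" for n
  have f_less: "\<forall>\<^sub>F n in sequentially. f n < n"
    and f_top: "filterlim f at_top sequentially"
    and f_ratio: "(\<lambda>n. real (f n) / real n) \<longlonglongrightarrow> 1 / 2"
    unfolding f_def
    by (intro nat_floor_mult_less nat_floor_mult_at_top nat_floor_mult_ratio; simp)+
  have f_pos: "\<forall>\<^sub>F n in sequentially. 0 < f n"
    using eventually_gt_at_top f_top by (rule eventually_compose_filterlim)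
  have sf_pos: "\<forall>\<^sub>F n in sequentially. 0 < s (f n)"
    using s(2) f_top by (rule eventually_compose_filterlim)
  define b where "b = ((1 / 2) powr (\<alpha> - \<beta>) + 1) / 2"
  have lt1: "(1 / 2 :: real) powr (\<alpha> - \<beta>) < 1"
    using \<beta> by (simp add: powr01_less_one)
  have "(\<lambda>n. s (f n) / s n * (real (f n) / real n) powr (- \<beta>)) \<longlonglongrightarrow> (1 / 2) powr \<alpha> * (1 / 2) powr (- \<beta>)"
    using ratio unfolding f_def[symmetric] by (intro tendsto_intros f_ratio) auto
  moreover have "(1 / 2 :: real) powr \<alpha> * (1 / 2) powr (- \<beta>) < b"
    using lt1 by (simp add: b_def powr_add[symmetric])
  ultimately have "\<forall>\<^sub>F n in sequentially. s (f n) / s n * (real (f n) / real n) powr (- \<beta>) < b"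
    by (rule order_tendstoD(2))
  then have ev: "\<forall>\<^sub>F n in sequentially. x n \<le> 0 + b * x (f n)"
    using f_pos f_less sf_pos s(2)
  proof eventually_elim
    case (elim n)
    have "x n = s (f n) / s n * (real (f n) / real n) powr (- \<beta>) * x (f n)"
      using elim by (simp add: x_def powr_divide powr_minus field_simps)
    also have "\<dots> \<le> b * x (f n)"
      using elim by (intro mult_right_mono) (auto simp: x_def)
    finally show ?case
      by simp
  qed
  have b: "0 \<le> b" "b < 1"
    using lt1 by (auto simp: b_def)
  have x0: "0 \<le> x n" for n
    using s by (simp add: x_def)
  have "x \<longlonglongrightarrow> 0"
  proof (rule metric_LIMSEQ_I)
    fix \<epsilon> :: real assume "0 < \<epsilon>"
    then have "\<forall>\<^sub>F n in sequentially. x n \<le> 0 / (1 - b) + \<epsilon> / 2"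
      by (intro contraction_eventually_le[OF x0 f_less f_top b _ ev]) auto
    then have "\<forall>\<^sub>F n in sequentially. x n < \<epsilon>"
      by eventually_elim (use \<open>0 < \<epsilon>\<close> in auto)
    then show "\<exists>no. \<forall>n\<ge>no. dist (x n) 0 < \<epsilon>"
      using x0 by (auto simp: eventually_sequentially dist_real_def)
  qed
  then show ?thesis
    by (simp add: x_def[abs_def])
qed

text \<open>The sums \<open>W n\<close> of \<open>w i * e i\<close> satisfy
  \<open>W (Suc n) = (1 - e n) * W n + e n * r n\<close>, a convex combination. Hence
  \<open>W\<close> cannot leave a band that contains \<open>r\<close>, and the band of width
  proportional to \<open>s n\<close> only grows. The initial value \<open>W N\<close> is harmless
  because \<open>s\<close> tends to infinity.\<close>

lemma volterra_smallo:
  fixes s w e r :: "nat \<Rightarrow> real"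
  assumes s: "incseq s" "filterlim s at_top sequentially"
    and e: "\<forall>\<^sub>F n in sequentially. 0 \<le> e n \<and> e n \<le> 1"
    and eq: "\<And>n. w n + (\<Sum>i<n. w i * e i) = r n"
    and r: "(\<lambda>n. r n / s n) \<longlonglongrightarrow> 0"
  shows "(\<lambda>n. w n / s n) \<longlonglongrightarrow> 0"
proof -
  define W where "W n = (\<Sum>i<n. w i * e i)" for n
  have s_pos: "\<forall>\<^sub>F n in sequentially. 0 < s n"
    using s(2) by (auto simp: filterlim_at_top_dense)
  have "(\<lambda>n. W n / s n) \<longlonglongrightarrow> 0"
  proof (rule metric_LIMSEQ_I)
    fix \<epsilon> :: real assume \<epsilon>: "0 < \<epsilon>"
    have "\<forall>\<^sub>F n in sequentially. \<bar>r n / s n\<bar> < \<epsilon> / 2"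
      using tendstoD[OF r, of "\<epsilon> / 2"] \<epsilon> by (simp add: dist_real_def)
    with s_pos have "\<forall>\<^sub>F n in sequentially. \<bar>r n\<bar> \<le> \<epsilon> / 2 * s n"
      by eventually_elim (auto simp: field_simps abs_divide)
    with e s_pos have "\<forall>\<^sub>F n in sequentially. \<bar>r n\<bar> \<le> \<epsilon> / 2 * s n \<and> 0 \<le> e n \<and> e n \<le> 1 \<and> 0 < s n"
      by eventually_elim auto
    then obtain N where N: "\<And>n. n \<ge> N \<Longrightarrow> \<bar>r n\<bar> \<le> \<epsilon> / 2 * s n \<and> 0 \<le> e n \<and> e n \<le> 1 \<and> 0 < s n"
      unfolding eventually_sequentially by auto
    have bound: "\<bar>W n\<bar> \<le> \<bar>W N\<bar> + \<epsilon> / 2 * s n" if "N \<le> n" for n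
      using that
    proof (induction n rule: dec_induct)
      case base
      then show ?case
        using N[of N] \<epsilon> by simp
    next
      case (step n)
      have "W (Suc n) = (1 - e n) * W n + e n * r n"
        unfolding eq[of n, symmetric] by (simp add: W_def algebra_simps)
      then have "\<bar>W (Suc n)\<bar> \<le> (1 - e n) * \<bar>W n\<bar> + e n * \<bar>r n\<bar>"
        using N[of n] step(1) abs_triangle_ineq[of "(1 - e n) * W n" "e n * r n"]
        by (simp add: abs_mult abs_of_nonneg)
      also have "\<dots> \<le> (1 - e n) * (\<bar>W N\<bar> + \<epsilon> / 2 * s n) + e n * (\<bar>W N\<bar> + \<epsilon> / 2 * s n)"
        using N[of n] step by (intro add_mono mult_left_mono) auto
      also have "\<dots> = \<bar>W N\<bar> + \<epsilon> / 2 * s n"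
        by (simp add: left_diff_distrib)
      also have "\<dots> \<le> \<bar>W N\<bar> + \<epsilon> / 2 * s (Suc n)"
        using incseq_SucD[OF s(1)] \<epsilon> by simp
      finally show ?case .
    qed
    have "((\<lambda>n. \<bar>W N\<bar> / s n) \<longlonglongrightarrow> 0)"
      by (rule real_tendsto_divide_at_top[OF tendsto_const s(2)])
    then have "\<forall>\<^sub>F n in sequentially. \<bar>W N\<bar> / s n < \<epsilon> / 2"
      using \<epsilon> by (intro order_tendstoD(2)) auto
    then have "\<forall>\<^sub>F n in sequentially. dist (W n / s n) 0 < \<epsilon>"
      using s_pos eventually_ge_at_top[of N]
    proof eventually_elim
      case (elim n)
      then have "\<bar>W n\<bar> < \<epsilon> / 2 * s n + \<epsilon> / 2 * s n"
        using bound[of n] by (auto simp: field_simps)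
      then show ?case
        using elim by (simp add: dist_real_def field_simps)
    qed
    then show "\<exists>no. \<forall>n\<ge>no. dist (W n / s n) 0 < \<epsilon>"
      by (simp add: eventually_sequentially)
  qed
  with r have "(\<lambda>n. r n / s n - W n / s n) \<longlonglongrightarrow> 0 - 0"
    by (rule tendsto_diff)
  moreover have "w n = r n - W n" for n
    using eq[of n] by (simp add: W_def)
  ultimately show ?thesis
    by (simp add: diff_divide_distrib)
qed

section \<open>Averaging lemmas of Toeplitz and Kronecker type\<close>

lemma weighted_cesaro:
  fixes t w a :: "nat \<Rightarrow> real"
  assumes t: "t \<longlonglongrightarrow> 0" and w: "\<And>i. 0 \<le> w i"
    and le: "\<forall>\<^sub>F n in sequentially. (\<Sum>i<n. w i) \<le> C * a n"
    and a: "filterlim a at_top sequentially"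
  shows "(\<lambda>n. (\<Sum>i<n. t i * w i) / a n) \<longlonglongrightarrow> 0"
proof (rule metric_LIMSEQ_I)
  fix \<epsilon> :: real assume \<epsilon>: "0 < \<epsilon>"
  define \<delta> where "\<delta> = \<epsilon> / (2 * (\<bar>C\<bar> + 1))"
  have \<delta>: "0 < \<delta>" "\<delta> * \<bar>C\<bar> \<le> \<epsilon> / 2"
    using \<epsilon> by (auto simp: \<delta>_def field_simps)
  obtain N where N: "\<And>i. i \<ge> N \<Longrightarrow> \<bar>t i\<bar> < \<delta>"
    using LIMSEQ_D[OF t \<delta>(1)] by auto
  define R where "R = (\<Sum>i<N. \<bar>t i\<bar> * w i)"
  have a_pos: "\<forall>\<^sub>F n in sequentially. 0 < a n"
    using a by (auto simp: filterlim_at_top_dense)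
  have "(\<lambda>n. R / a n) \<longlonglongrightarrow> 0"
    by (rule real_tendsto_divide_at_top[OF tendsto_const a])
  then have "\<forall>\<^sub>F n in sequentially. R / a n < \<epsilon> / 2"
    by (rule order_tendstoD(2)) (use \<epsilon> in simp)
  then have "\<forall>\<^sub>F n in sequentially. \<bar>(\<Sum>i<n. t i * w i) / a n\<bar> < \<epsilon>"
    using a_pos le eventually_ge_at_top[of N]
  proof eventually_elim
    case (elim n)
    have split: "{..<n} = {..<N} \<union> {N..<n}" "{..<N} \<inter> {N..<n} = {}"
      using elim by auto
    have "\<bar>\<Sum>i<n. t i * w i\<bar> \<le> (\<Sum>i<n. \<bar>t i\<bar> * w i)"
      by (rule order_trans[OF sum_abs]) (simp add: abs_mult w)
    also have "\<dots> = R + (\<Sum>i\<in>{N..<n}. \<bar>t i\<bar> * w i)"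
      unfolding R_def split(1) by (rule sum.union_disjoint) (use split in auto)
    also have "(\<Sum>i\<in>{N..<n}. \<bar>t i\<bar> * w i) \<le> (\<Sum>i\<in>{N..<n}. \<delta> * w i)"
      using N by (intro sum_mono mult_right_mono w) (auto intro: less_imp_le)
    also have "\<dots> \<le> (\<Sum>i<n. \<delta> * w i)"
      using w \<delta> by (intro sum_mono2) auto
    also have "\<dots> \<le> \<delta> * (C * a n)"
      unfolding sum_distrib_left[symmetric] using elim \<delta> by (intro mult_left_mono) auto
    also have "\<dots> \<le> \<delta> * (\<bar>C\<bar> * a n)"
      using elim \<delta> by (intro mult_left_mono mult_right_mono) auto
    also have "\<dots> \<le> \<epsilon> / 2 * a n"
      using mult_right_mono[OF \<delta>(2), of "a n"] elim by (simp add: mult.assoc)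
    finally have "\<bar>\<Sum>i<n. t i * w i\<bar> / a n \<le> R / a n + \<epsilon> / 2"
      using elim(2) by (simp add: field_simps)
    then have "\<bar>\<Sum>i<n. t i * w i\<bar> / a n < \<epsilon>"
      using elim(1) by linarith
    then show ?case
      using elim(2) by (simp add: abs_divide)
  qed
  then show "\<exists>no. \<forall>n\<ge>no. dist ((\<Sum>i<n. t i * w i) / a n) 0 < \<epsilon>"
    by (simp add: eventually_sequentially dist_real_def)
qed

lemma kronecker_lemma:
  fixes a x :: "nat \<Rightarrow> real"
  assumes a: "incseq a" "filterlim a at_top sequentially"
    and conv: "convergent (\<lambda>n. \<Sum>i<n. x i)"
  shows "(\<lambda>n. (\<Sum>i<n. a i * x i) / a n) \<longlonglongrightarrow> 0"
proof -
  obtain L where L: "(\<lambda>n. \<Sum>i<n. x i) \<longlonglongrightarrow> L"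
    using conv by (auto simp: convergent_def)
  define \<tau> where "\<tau> n = (\<Sum>i<n. x i) - L" for n
  have \<tau>: "\<tau> \<longlonglongrightarrow> 0"
    unfolding \<tau>_def[abs_def] using L by (simp add: LIM_zero_iff)
  \<comment> \<open>Measuring the partial sums from their limit makes the boundary term
    \<open>a n * \<tau> n\<close> negligible and turns the remaining sum into a weighted average of
    a null sequence.\<close>
  have abel: "(\<Sum>i<n. a i * x i) = a n * \<tau> n - a 0 * \<tau> 0 - (\<Sum>i<n. \<tau> (Suc i) * (a (Suc i) - a i))" for n
    by (induction n) (auto simp: \<tau>_def algebra_simps)
  have a_pos: "\<forall>\<^sub>F n in sequentially. 0 < a n"
    using a(2) by (auto simp: filterlim_at_top_dense)
  have "(\<lambda>n. (\<Sum>i<n. \<tau> (Suc i) * (a (Suc i) - a i)) / a n) \<longlonglongrightarrow> 0"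
  proof (rule weighted_cesaro[OF LIMSEQ_Suc[OF \<tau>] _ _ a(2)])
    show "0 \<le> a (Suc i) - a i" for i
      using incseq_SucD[OF a(1)] by simp
    have "\<forall>\<^sub>F n in sequentially. - a 0 < a n"
      using a(2) by (auto simp: filterlim_at_top_dense)
    then show "\<forall>\<^sub>F n in sequentially. (\<Sum>i<n. a (Suc i) - a i) \<le> 2 * a n"
      by eventually_elim (simp add: sum_lessThan_telescope)
  qed
  moreover have "(\<lambda>n. a 0 * \<tau> 0 / a n) \<longlonglongrightarrow> 0"
    by (rule real_tendsto_divide_at_top[OF tendsto_const a(2)])
  ultimately have "(\<lambda>n. \<tau> n - a 0 * \<tau> 0 / a n - (\<Sum>i<n. \<tau> (Suc i) * (a (Suc i) - a i)) / a n) \<longlonglongrightarrow> 0 - 0 - 0"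
    by (intro tendsto_diff \<tau>)
  then have "(\<lambda>n. \<tau> n - a 0 * \<tau> 0 / a n - (\<Sum>i<n. \<tau> (Suc i) * (a (Suc i) - a i)) / a n) \<longlonglongrightarrow> 0"
    by simp
  then show ?thesis
  proof (rule Lim_transform_eventually)
    show "\<forall>\<^sub>F n in sequentially. \<tau> n - a 0 * \<tau> 0 / a n - (\<Sum>i<n. \<tau> (Suc i) * (a (Suc i) - a i)) / a n
        = (\<Sum>i<n. a i * x i) / a n"
      using a_pos by eventually_elim (simp add: abel diff_divide_distrib)
  qed
qed

text \<open>The summands are dominated by the increments of \<open>- 2 / sqrt (1 + H n)\<close>.\<close>

lemma sum_self_normalized_le:
  fixes h b :: "nat \<Rightarrow> real"
  assumes h: "\<And>i. 0 \<le> h i" and b: "\<And>i. 1 \<le> b i"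
  shows "(\<Sum>i<n. b i * h i / ((b i)\<^sup>2 + (\<Sum>j<Suc i. h j))\<^sup>2) \<le> 2"
proof -
  define H where "H n = (\<Sum>j<n. h j)" for n
  have H: "0 \<le> H n" for n
    unfolding H_def by (intro sum_nonneg h)
  have step: "b i * h i / ((b i)\<^sup>2 + H (Suc i))\<^sup>2 \<le> 2 * (1 / sqrt (1 + H i) - 1 / sqrt (1 + H (Suc i)))" for i
  proof -
    define A where "A = (b i)\<^sup>2 + H (Suc i)"
    define u where "u = sqrt (1 + H i)"
    define v where "v = sqrt (1 + H (Suc i))"
    have uv: "0 < u" "u \<le> v" "0 < v"
      using H[of i] H[of "Suc i"] h[of i] by (auto simp: u_def v_def H_def add_pos_nonneg)
    have hi: "h i = v\<^sup>2 - u\<^sup>2"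
      using H[of i] H[of "Suc i"] by (simp add: u_def v_def H_def)
    have b2: "1 \<le> (b i)\<^sup>2"
      using b[of i] by simp
    \<comment> \<open>Of the four factors \<open>sqrt A\<close> in \<open>A\<^sup>2\<close>, one
      pays for \<open>b i\<close>, and the other three dominate \<open>v\<close> cubed, which leaves
      the increment of a function of \<open>H\<close> alone.\<close>
    have bA: "b i \<le> sqrt A"
      using H b by (intro real_le_rsqrt) (simp add: A_def)
    have vA: "v \<le> sqrt A"
      using b2 by (simp add: v_def A_def)
    have A: "0 < A"
      using b2 H[of "Suc i"] by (simp add: A_def)
    then have "A = sqrt A * sqrt A"
      by simp
    then have A2: "A\<^sup>2 = sqrt A * (sqrt A * sqrt A * sqrt A)"
      by (simp add: power2_eq_square)
    have v3: "v * v * v \<le> sqrt A * sqrt A * sqrt A"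
      using vA uv A by (intro mult_mono) auto
    have "b i * h i / A\<^sup>2 \<le> sqrt A * h i / A\<^sup>2"
      using bA h[of i] by (intro divide_right_mono mult_right_mono) auto
    also have "\<dots> = h i / (sqrt A * sqrt A * sqrt A)"
      unfolding A2 using A by simp
    also have "\<dots> \<le> h i / (v * v * v)"
      using v3 h[of i] uv A by (intro divide_left_mono) auto
    also have "\<dots> = (v - u) * (v + u) / (v * v * v)"
      unfolding hi by (simp add: power2_eq_square algebra_simps)
    also have "\<dots> \<le> (v - u) * (2 * v * v / u) / (v * v * v)"
    proof -
      have "(v + u) * u \<le> (2 * v) * v"
        using uv by (intro mult_mono) auto
      then have "v + u \<le> 2 * v * v / u"
        using uv by (simp add: pos_le_divide_eq)
      then show ?thesis
        using uv by (intro divide_right_mono mult_left_mono) auto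
    qed
    also have "\<dots> = 2 * (1 / u - 1 / v)"
      using uv by (simp add: field_simps)
    finally show ?thesis
      by (simp add: A_def u_def v_def)
  qed
  have "(\<Sum>i<n. b i * h i / ((b i)\<^sup>2 + H (Suc i))\<^sup>2)
      \<le> (\<Sum>i<n. 2 * (1 / sqrt (1 + H i) - 1 / sqrt (1 + H (Suc i))))"
    by (intro sum_mono step)
  also have "\<dots> = 2 * (1 / sqrt (1 + H 0) - 1 / sqrt (1 + H n))"
    by (induction n) (auto simp: algebra_simps)
  also have "\<dots> \<le> 2"
    using H[of n] by (simp add: H_def)
  finally show ?thesis
    by (simp add: H_def)
qed

lemma powr_shift_ratio: "(\<lambda>n. (real n + 1) powr a / real n powr a) \<longlonglongrightarrow> 1"
  by real_asymp

lemma tendsto_powr_shift_divide: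
  fixes s :: "nat \<Rightarrow> real"
  assumes "(\<lambda>n. real n powr a / s n) \<longlonglongrightarrow> 0"
  shows "(\<lambda>n. (real n + 1) powr a / s n) \<longlonglongrightarrow> 0"
proof -
  have "(\<lambda>n. (real n + 1) powr a / real n powr a * (real n powr a / s n)) \<longlonglongrightarrow> 1 * 0"
    by (intro tendsto_mult powr_shift_ratio assms)
  then have "(\<lambda>n. (real n + 1) powr a / real n powr a * (real n powr a / s n)) \<longlonglongrightarrow> 0"
    by simp
  then show ?thesis
  proof (rule Lim_transform_eventually)
    show "\<forall>\<^sub>F n in sequentially. (real n + 1) powr a / real n powr a * (real n powr a / s n) = (real n + 1) powr a / s n"
      using eventually_gt_at_top[of 0] by eventually_elim simp
  qed
qed

lemma regularly_varying_at_top: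
  fixes s :: "nat \<Rightarrow> real"
  assumes pos: "\<forall>\<^sub>F n in sequentially. 0 < s n" and lim: "(\<lambda>n. real n powr a / s n) \<longlonglongrightarrow> 0" and a: "0 < a"
  shows "filterlim s at_top sequentially"
proof (rule filterlim_at_top_mono)
  show "filterlim (\<lambda>n. real n powr a) at_top sequentially"
    using a by real_asymp
  have "\<forall>\<^sub>F n in sequentially. real n powr a / s n < 1"
    using lim by (rule order_tendstoD) simp
  with pos show "\<forall>\<^sub>F n in sequentially. real n powr a \<le> s n"
    by eventually_elim (simp add: divide_less_eq)
qed

section \<open>A strong law for sums of adapted random variables\<close>

lemma AE_summable_of_summable_integral:
  fixes f :: "nat \<Rightarrow> 'a \<Rightarrow> real"
  assumes int: "\<And>i. integrable M (f i)"
    and nonneg: "\<And>i. AE w in M. 0 \<le> f i w"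
    and sum: "summable (\<lambda>i. integral\<^sup>L M (f i))"
  shows "AE w in M. summable (\<lambda>i. f i w)"
proof -
  have [measurable]: "f i \<in> borel_measurable M" for i
    using int by auto
  have int0: "0 \<le> integral\<^sup>L M (f i)" for i
    using nonneg by (rule integral_nonneg_AE)
  have "(\<integral>\<^sup>+ w. (\<Sum>i. ennreal (f i w)) \<partial>M) = (\<Sum>i. \<integral>\<^sup>+ w. ennreal (f i w) \<partial>M)"
    by (rule nn_integral_suminf) measurable
  also have "\<dots> = (\<Sum>i. ennreal (integral\<^sup>L M (f i)))"
    using int nonneg by (simp add: nn_integral_eq_integral)
  also have "\<dots> \<noteq> \<infinity>"
    using suminf_ennreal2[OF int0 sum] by simp
  finally have "AE w in M. (\<Sum>i. ennreal (f i w)) \<noteq> \<infinity>"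
    by (intro nn_integral_PInf_AE) auto
  moreover have "AE w in M. \<forall>i. 0 \<le> f i w"
    using nonneg by (simp add: AE_all_countable)
  ultimately show ?thesis
  proof eventually_elim
    case (elim w)
    then show ?case
      by (intro summable_suminf_not_top) auto
  qed
qed

locale discrete_filtration = prob_space M for M :: "'w measure" +
  fixes F :: "nat \<Rightarrow> 'w measure"
  assumes subalg: "subalgebra M (F n)"
    and filtration_Suc: "sets (F n) \<subseteq> sets (F (Suc n))"
begin

lemma filtration_mono: "i \<le> j \<Longrightarrow> sets (F i) \<subseteq> sets (F j)"
  by (rule lift_Suc_mono_le[of "\<lambda>n. sets (F n)"]) (rule filtration_Suc)

lemma space_F [simp]: "space (F n) = space M"
  using subalg[of n] by (simp add: subalgebra_def)

lemma measurable_F_mono: "f \<in> borel_measurable (F i) \<Longrightarrow> i \<le> j \<Longrightarrow> f \<in> borel_measurable (F j)"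
  using filtration_mono[of i j] by (auto simp: measurable_def)

lemma measurable_F_imp_M: "f \<in> borel_measurable (F i) \<Longrightarrow> f \<in> borel_measurable M"
  by (rule measurable_from_subalg[OF subalg])

lemma sigma_finite_subalgebra_F: "sigma_finite_subalgebra M (F n)"
  by (rule finite_measure_subalgebra_is_sigma_finite)
    (simp add: finite_measure_subalgebra_def finite_measure_subalgebra_axioms_def subalg finite_measure_axioms)

text \<open>Boundedness makes the class closed under products and contained in the integrable
  functions, so that no integrability conditions have to be carried along. The bound may depend on
  \<open>n\<close>.\<close>

definition bounded_adapted :: "nat \<Rightarrow> ('w \<Rightarrow> real) \<Rightarrow> bool" where
  "bounded_adapted n f \<longleftrightarrow> f \<in> borel_measurable (F n) \<and> (\<exists>B. \<forall>w\<in>space M. \<bar>f w\<bar> \<le> B)"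

lemma bounded_adaptedI:
  "f \<in> borel_measurable (F n) \<Longrightarrow> (\<And>w. w \<in> space M \<Longrightarrow> \<bar>f w\<bar> \<le> B) \<Longrightarrow> bounded_adapted n f"
  by (auto simp: bounded_adapted_def)

lemma bounded_adapted_measurable: "bounded_adapted n f \<Longrightarrow> f \<in> borel_measurable (F n)"
  by (simp add: bounded_adapted_def)

lemma bounded_adapted_mono: "bounded_adapted i f \<Longrightarrow> i \<le> j \<Longrightarrow> bounded_adapted j f"
  using measurable_F_mono by (auto simp: bounded_adapted_def)

lemma bounded_adapted_cong:
  assumes f: "bounded_adapted n f" and eq: "\<And>w. w \<in> space M \<Longrightarrow> f w = g w"
  shows "bounded_adapted n g"
proof -
  have "g \<in> borel_measurable (F n)"
    using bounded_adapted_measurable[OF f]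
    by (rule measurable_cong[THEN iffD1, rotated]) (simp add: eq)
  then show ?thesis
    using f eq unfolding bounded_adapted_def by auto
qed

lemma bounded_adapted_const: "bounded_adapted n (\<lambda>_. c)"
  by (rule bounded_adaptedI[of _ _ "\<bar>c\<bar>"]) auto

lemma bounded_adapted_add:
  assumes "bounded_adapted n f" "bounded_adapted n g"
  shows "bounded_adapted n (\<lambda>w. f w + g w)"
proof -
  obtain B C where "\<And>w. w \<in> space M \<Longrightarrow> \<bar>f w\<bar> \<le> B" "\<And>w. w \<in> space M \<Longrightarrow> \<bar>g w\<bar> \<le> C"
    using assms by (auto simp: bounded_adapted_def)
  then have "\<And>w. w \<in> space M \<Longrightarrow> \<bar>f w + g w\<bar> \<le> B + C"
    by (meson abs_triangle_ineq add_mono order_trans)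
  then show ?thesis
    using assms by (intro bounded_adaptedI) (auto simp: bounded_adapted_def)
qed

lemma bounded_adapted_mult:
  assumes "bounded_adapted n f" "bounded_adapted n g"
  shows "bounded_adapted n (\<lambda>w. f w * g w)"
proof -
  obtain B C where "\<And>w. w \<in> space M \<Longrightarrow> \<bar>f w\<bar> \<le> B" "\<And>w. w \<in> space M \<Longrightarrow> \<bar>g w\<bar> \<le> C"
    using assms by (auto simp: bounded_adapted_def)
  then have "\<And>w. w \<in> space M \<Longrightarrow> \<bar>f w * g w\<bar> \<le> \<bar>B\<bar> * \<bar>C\<bar>"
    unfolding abs_mult by (intro mult_mono) (force intro: order_trans abs_ge_self)+
  then show ?thesis
    using assms by (intro bounded_adaptedI) (auto simp: bounded_adapted_def)
qed

lemma bounded_adapted_diff: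
  assumes "bounded_adapted n f" "bounded_adapted n g"
  shows "bounded_adapted n (\<lambda>w. f w - g w)"
  using bounded_adapted_add[OF assms(1) bounded_adapted_mult[OF bounded_adapted_const[of n "-1"] assms(2)]]
  by simp

lemma bounded_adapted_sum:
  "(\<And>i. i \<in> I \<Longrightarrow> bounded_adapted n (f i)) \<Longrightarrow> bounded_adapted n (\<lambda>w. \<Sum>i\<in>I. f i w)"
  by (induction I rule: infinite_finite_induct) (auto intro: bounded_adapted_add bounded_adapted_const)

lemma bounded_adapted_integrable:
  assumes "bounded_adapted n f"
  shows "integrable M f"
proof -
  obtain B where "\<And>w. w \<in> space M \<Longrightarrow> \<bar>f w\<bar> \<le> B"
    using assms by (auto simp: bounded_adapted_def)
  then show ?thesis
    using assms measurable_F_imp_M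
    by (intro integrable_const_bound[where B = B] AE_I2) (auto simp: bounded_adapted_def)
qed

lemmas bounded_adapted_intros = bounded_adapted_const bounded_adapted_add bounded_adapted_diff
  bounded_adapted_mult bounded_adapted_sum

text \<open>The condition that the conditional expectation of \<open>D i\<close> given
  \<open>F i\<close> vanishes is stated in tested form, as orthogonality to every bounded
  \<open>F i\<close>-measurable function. This avoids versions of conditional expectations.\<close>

definition bounded_mds :: "(nat \<Rightarrow> 'w \<Rightarrow> real) \<Rightarrow> bool" where
  "bounded_mds D \<longleftrightarrow> (\<forall>i. bounded_adapted (Suc i) (D i)) \<and>
     (\<forall>i f. bounded_adapted i f \<longrightarrow> expectation (\<lambda>w. f w * D i w) = 0)"

lemma bounded_mds_adapted: "bounded_mds D \<Longrightarrow> i < n \<Longrightarrow> bounded_adapted n (D i)"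
  unfolding bounded_mds_def using bounded_adapted_mono by (meson Suc_leI)

lemma bounded_mds_sum_adapted: "bounded_mds D \<Longrightarrow> k \<le> n \<Longrightarrow> bounded_adapted n (\<lambda>w. \<Sum>i<k. D i w)"
  by (rule bounded_adapted_sum) (auto intro: bounded_mds_adapted)

lemma bounded_mds_scale:
  assumes D: "bounded_mds D" and g: "\<And>i. bounded_adapted i (g i)"
  shows "bounded_mds (\<lambda>i w. g i w * D i w)"
  unfolding bounded_mds_def
proof (intro conjI allI impI)
  show "bounded_adapted (Suc i) (\<lambda>w. g i w * D i w)" for i
    by (intro bounded_adapted_mult bounded_mds_adapted[OF D] bounded_adapted_mono[OF g]) auto
next
  fix i f assume "bounded_adapted i f"
  then have "bounded_adapted i (\<lambda>w. f w * g i w)"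
    by (intro bounded_adapted_mult g)
  then show "expectation (\<lambda>w. f w * (g i w * D i w)) = 0"
    using D unfolding bounded_mds_def by (simp flip: mult.assoc)
qed

lemma bounded_mds_second_moment:
  assumes D: "bounded_mds D"
  shows "expectation (\<lambda>w. (\<Sum>i<n. D i w)\<^sup>2) = (\<Sum>i<n. expectation (\<lambda>w. (D i w)\<^sup>2))"
proof (induction n)
  case (Suc n)
  let ?S = "\<lambda>w. \<Sum>i<n. D i w"
  have S: "bounded_adapted n ?S" "bounded_adapted (Suc n) ?S"
    by (intro bounded_mds_sum_adapted[OF D]; simp)+
  have Dn: "bounded_adapted (Suc n) (D n)"
    by (intro bounded_mds_adapted[OF D]) simp
  have int: "integrable M (\<lambda>w. ?S w * ?S w)" "integrable M (\<lambda>w. ?S w * D n w)"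
      "integrable M (\<lambda>w. D n w * D n w)"
    by (rule bounded_adapted_integrable[OF bounded_adapted_mult]; fact S Dn)+
  have "expectation (\<lambda>w. (\<Sum>i<Suc n. D i w)\<^sup>2)
      = expectation (\<lambda>w. ?S w * ?S w + 2 * (?S w * D n w) + D n w * D n w)"
    by (intro Bochner_Integration.integral_cong) (auto simp: power2_eq_square algebra_simps)
  also have "\<dots> = expectation (\<lambda>w. ?S w * ?S w) + 2 * expectation (\<lambda>w. ?S w * D n w)
      + expectation (\<lambda>w. D n w * D n w)"
    using int by simp
  also have "expectation (\<lambda>w. ?S w * D n w) = 0"
    using D S(1) unfolding bounded_mds_def by blast
  finally show ?case
    using Suc by (simp add: power2_eq_square)
qed simp

text \<open>Doob's inequality: the sum stopped when it first reaches \<open>\<epsilon>\<close> is again a martingale, and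
  exceeds \<open>\<epsilon>\<close> at the final time iff the original sum does so at some time.\<close>

lemma bounded_mds_maximal:
  assumes D: "bounded_mds D" and \<epsilon>: "0 < \<epsilon>"
  shows "prob {w\<in>space M. \<exists>k\<le>n. \<epsilon> \<le> \<bar>\<Sum>i<k. D i w\<bar>}
    \<le> (\<Sum>i<n. expectation (\<lambda>w. (D i w)\<^sup>2)) / \<epsilon>\<^sup>2"
proof -
  define g :: "nat \<Rightarrow> 'w \<Rightarrow> real" where "g i w = of_bool (\<forall>k\<le>i. \<bar>\<Sum>j<k. D j w\<bar> < \<epsilon>)" for i w
  define T where "T w = (\<Sum>i<n. g i w * D i w)" for w
  have g_adapted: "bounded_adapted i (g i)" for i
  proof (rule bounded_adaptedI[of _ _ 1])
    have "(\<lambda>w. \<Sum>j<k. D j w) \<in> borel_measurable (F i)" if "k \<le> i" for k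
      using bounded_mds_sum_adapted[OF D that] by (rule bounded_adapted_measurable)
    then have "{w\<in>space (F i). \<forall>k\<in>{..i}. \<bar>\<Sum>j<k. D j w\<bar> < \<epsilon>} \<in> sets (F i)"
      by (intro sets.sets_Collect_finite_All borel_measurable_less borel_measurable_abs) auto
    then have "indicator {w\<in>space (F i). \<forall>k\<in>{..i}. \<bar>\<Sum>j<k. D j w\<bar> < \<epsilon>} \<in> borel_measurable (F i)"
      by simp
    then show "g i \<in> borel_measurable (F i)"
      by (rule measurable_cong[THEN iffD1, rotated]) (auto simp: g_def indicator_def)
  qed (auto simp: g_def)
  then have mds: "bounded_mds (\<lambda>i w. g i w * D i w)"
    by (rule bounded_mds_scale[OF D])
  have T: "bounded_adapted n T"
    unfolding T_def[abs_def] by (rule bounded_mds_sum_adapted[OF mds order_refl])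
  have sub: "{w\<in>space M. \<exists>k\<le>n. \<epsilon> \<le> \<bar>\<Sum>i<k. D i w\<bar>} \<subseteq> {w\<in>space M. \<epsilon> \<le> \<bar>T w\<bar>}"
  proof safe
    fix w k assume "k \<le> n" "\<epsilon> \<le> \<bar>\<Sum>i<k. D i w\<bar>"
    define k0 where "k0 = (LEAST k. \<epsilon> \<le> \<bar>\<Sum>i<k. D i w\<bar>)"
    have k0: "\<epsilon> \<le> \<bar>\<Sum>i<k0. D i w\<bar>"
      unfolding k0_def using \<open>\<epsilon> \<le> \<bar>\<Sum>i<k. D i w\<bar>\<close> by (rule LeastI)
    have "k0 \<le> k"
      unfolding k0_def using \<open>\<epsilon> \<le> \<bar>\<Sum>i<k. D i w\<bar>\<close> by (rule Least_le)
    have less: "\<bar>\<Sum>i<j. D i w\<bar> < \<epsilon>" if "j < k0" for j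
      using not_less_Least[of j "\<lambda>k. \<epsilon> \<le> \<bar>\<Sum>i<k. D i w\<bar>"] that by (auto simp: k0_def)
    have "T w = (\<Sum>i<n. if i < k0 then D i w else 0)"
      unfolding T_def
    proof (rule sum.cong)
      fix i
      have "g i w = of_bool (i < k0)"
      proof (cases "i < k0")
        case True
        then have "\<forall>k\<le>i. \<bar>\<Sum>j<k. D j w\<bar> < \<epsilon>"
          using less by auto
        then show ?thesis
          using True by (simp add: g_def)
      next
        case False
        then have "\<not> (\<forall>k\<le>i. \<bar>\<Sum>j<k. D j w\<bar> < \<epsilon>)"
          using k0 by (intro notI) (drule spec[of _ k0], simp)
        then show ?thesis
          using False unfolding g_def by (simp only: of_bool_def if_False)
      qed
      then show "g i w * D i w = (if i < k0 then D i w else 0)"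
        by simp
    qed simp
    also have "\<dots> = (\<Sum>i<k0. D i w)"
      using \<open>k0 \<le> k\<close> \<open>k \<le> n\<close> by (intro sum.mono_neutral_cong_right) auto
    finally show "\<epsilon> \<le> \<bar>T w\<bar>"
      using k0 by simp
  qed
  have [measurable]: "T \<in> borel_measurable M"
    using T by (intro measurable_F_imp_M bounded_adapted_measurable)
  have "prob {w\<in>space M. \<exists>k\<le>n. \<epsilon> \<le> \<bar>\<Sum>i<k. D i w\<bar>} \<le> prob {w\<in>space M. \<epsilon> \<le> \<bar>T w\<bar>}"
    using sub by (intro finite_measure_mono) measurable
  also have "\<dots> \<le> expectation (\<lambda>w. (T w)\<^sup>2) / \<epsilon>\<^sup>2"
    using bounded_adapted_integrable[OF bounded_adapted_mult[OF T T]] \<epsilon>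
    by (intro second_moment_method) (auto simp: power2_eq_square)
  also have "expectation (\<lambda>w. (T w)\<^sup>2) = (\<Sum>i<n. expectation (\<lambda>w. (g i w * D i w)\<^sup>2))"
    unfolding T_def by (rule bounded_mds_second_moment[OF mds])
  also have "\<dots> \<le> (\<Sum>i<n. expectation (\<lambda>w. (D i w)\<^sup>2))"
  proof (intro sum_mono integral_mono)
    fix i
    have Di: "bounded_adapted (Suc i) (D i)" "bounded_adapted (Suc i) (\<lambda>w. g i w * D i w)"
      by (intro bounded_mds_adapted[OF D] bounded_mds_adapted[OF mds]; simp)+
    show "integrable M (\<lambda>w. (g i w * D i w)\<^sup>2)" "integrable M (\<lambda>w. (D i w)\<^sup>2)"
      unfolding power2_eq_square
      by (rule bounded_adapted_integrable[OF bounded_adapted_mult]; fact Di)+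
    show "(g i w * D i w)\<^sup>2 \<le> (D i w)\<^sup>2" for w
      by (simp add: g_def)
  qed
  finally show ?thesis
    using \<epsilon> by (simp add: divide_right_mono)
qed

text \<open>Setting the first \<open>n\<close> differences to 0 leaves a martingale difference
  sequence, so the maximal inequality bounds the probability of any oscillation of size
  \<open>\<epsilon>\<close> after time \<open>n\<close> by a tail of a convergent series.
  Oscillations that recur after every \<open>n\<close> thus have probability 0, and the partial sums
  are almost surely Cauchy.\<close>

theorem bounded_mds_AE_convergent:
  assumes D: "bounded_mds D"
    and sum: "summable (\<lambda>i. expectation (\<lambda>w. (D i w)\<^sup>2))"
  shows "AE w in M. convergent (\<lambda>n. \<Sum>i<n. D i w)"
proof -
  define v where "v i = expectation (\<lambda>w. (D i w)\<^sup>2)" for i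
  have v: "summable v" "\<And>i. 0 \<le> v i"
    using sum by (auto simp: v_def[abs_def])
  define A where "A n K \<epsilon> = {w\<in>space M. \<exists>k\<le>K. \<epsilon> \<le> \<bar>\<Sum>i\<in>{n..<k}. D i w\<bar>}" for n K \<epsilon>
  have [measurable]: "D i \<in> borel_measurable M" for i
    using bounded_mds_adapted[OF D lessI] by (intro measurable_F_imp_M bounded_adapted_measurable)
  have A_sets: "A n K \<epsilon> \<in> sets M" for n K \<epsilon>
    unfolding A_def by measurable
  have prob_A: "prob (A n K \<epsilon>) \<le> (\<Sum>i. v (i + n)) / \<epsilon>\<^sup>2" if "0 < \<epsilon>" for n K \<epsilon>
  proof -
    define D' where "D' i w = of_bool (n \<le> i) * D i w" for i w
    have D': "bounded_mds D'"
      unfolding D'_def by (intro bounded_mds_scale D bounded_adapted_const)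
    have S: "(\<Sum>i<k. D' i w) = (\<Sum>i\<in>{n..<k}. D i w)" for k w
      unfolding D'_def by (intro sum.mono_neutral_cong_right) auto
    have "prob (A n K \<epsilon>) \<le> (\<Sum>i<K. expectation (\<lambda>w. (D' i w)\<^sup>2)) / \<epsilon>\<^sup>2"
      using bounded_mds_maximal[OF D' that, of K] unfolding S A_def .
    also have "(\<Sum>i<K. expectation (\<lambda>w. (D' i w)\<^sup>2)) = (\<Sum>i\<in>{n..<K}. v i)"
      unfolding D'_def v_def by (intro sum.mono_neutral_cong_right) auto
    also have "\<dots> = (\<Sum>i\<in>{0..<K - n}. v (i + n))"
    proof (cases "n \<le> K")
      case True
      then show ?thesis
        using sum.shift_bounds_nat_ivl[of v 0 n "K - n"] by simp
    qed simp
    also have "\<dots> \<le> (\<Sum>i. v (i + n))"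
      using v by (intro sum_le_suminf summable_ignore_initial_segment) auto
    finally show ?thesis
      using that by (simp add: divide_right_mono)
  qed
  have tail: "(\<lambda>n. \<Sum>i. v (i + n)) \<longlonglongrightarrow> 0"
    using v(1) by (rule suminf_exist_split2)
  have "AE w in M. \<exists>n. \<forall>k. \<bar>\<Sum>i\<in>{n..<k}. D i w\<bar> < \<epsilon>" if \<epsilon>: "0 < \<epsilon>" for \<epsilon>
  proof -
    define B where "B = (\<Inter>n. \<Union>K. A n K \<epsilon>)"
    have B_sets: "B \<in> sets M"
      unfolding B_def using A_sets by (intro sets.countable_INT' sets.countable_UN) auto
    have "prob B \<le> (\<Sum>i. v (i + n)) / \<epsilon>\<^sup>2" for n
    proof -
      have "(\<lambda>K. prob (A n K \<epsilon>)) \<longlonglongrightarrow> prob (\<Union>K. A n K \<epsilon>)"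
        using A_sets by (intro finite_Lim_measure_incseq)
          (auto simp: A_def incseq_def intro: order_trans)
      then have "prob (\<Union>K. A n K \<epsilon>) \<le> (\<Sum>i. v (i + n)) / \<epsilon>\<^sup>2"
        by (rule LIMSEQ_le_const2) (use prob_A[OF \<epsilon>] in blast)
      moreover have "prob B \<le> prob (\<Union>K. A n K \<epsilon>)"
        using A_sets by (intro finite_measure_mono) (auto simp: B_def)
      ultimately show ?thesis
        by simp
    qed
    moreover have "(\<lambda>n. (\<Sum>i. v (i + n)) / \<epsilon>\<^sup>2) \<longlonglongrightarrow> 0"
      using tendsto_divide[OF tail tendsto_const, of "\<epsilon>\<^sup>2"] \<epsilon> by simp
    ultimately have "prob B \<le> 0"
      by (intro LIMSEQ_le_const) auto
    then have "prob B = 0"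
      using measure_nonneg[of M B] by linarith
    then have "AE w in M. w \<notin> B"
      using B_sets by (simp add: prob_eq_0)
    with AE_space show ?thesis
    proof eventually_elim
      case (elim w)
      then obtain n where "w \<notin> A n k \<epsilon>" for k
        by (auto simp: B_def)
      then have "\<bar>\<Sum>i\<in>{n..<k}. D i w\<bar> < \<epsilon>" for k
        using elim unfolding A_def by (metis (mono_tags, lifting) mem_Collect_eq not_le order_refl)
      then show ?case
        by blast
    qed
  qed
  then have "AE w in M. \<forall>j. \<exists>n. \<forall>k. \<bar>\<Sum>i\<in>{n..<k}. D i w\<bar> < 1 / real (Suc j)"
    by (simp add: AE_all_countable)
  then show ?thesis
  proof eventually_elim
    case (elim w)
    have "Cauchy (\<lambda>n. \<Sum>i<n. D i w)"
    proof (rule metric_CauchyI)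
      fix e :: real assume "0 < e"
      then obtain j where j: "1 / real (Suc j) < e / 2"
        using nat_approx_posE[of "e / 2"] by auto
      obtain n where n: "\<And>k. \<bar>\<Sum>i\<in>{n..<k}. D i w\<bar> < 1 / real (Suc j)"
        using elim by blast
      have diff: "(\<Sum>i<a. D i w) - (\<Sum>i<n. D i w) = (\<Sum>i\<in>{n..<a}. D i w)" if "n \<le> a" for a
        using sum_diff_nat_ivl[of 0 n a "\<lambda>i. D i w"] that by (simp add: lessThan_atLeast0)
      have "dist (\<Sum>i<a. D i w) (\<Sum>i<b. D i w) < e" if "n \<le> a" "n \<le> b" for a b
        using n[of a] n[of b] diff[OF that(1)] diff[OF that(2)] j unfolding dist_real_def by linarith
      then show "\<exists>M. \<forall>m\<ge>M. \<forall>n\<ge>M. dist (\<Sum>i<m. D i w) (\<Sum>i<n. D i w) < e"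
        by blast
    qed
    then show ?case
      by (simp add: Cauchy_convergent_iff)
  qed
qed

text \<open>Normalising the increments by \<open>a i\<close>, which is \<open>F i\<close>-measurable and dominates both the square of
  the bound on the increments and the compensator, gives a martingale bounded in \<open>L\<^sup>2\<close>
  without any localisation; Kronecker's lemma then undoes the normalisation.\<close>

lemma slln_bounded:
  fixes W h :: "nat \<Rightarrow> 'w \<Rightarrow> real" and b :: "nat \<Rightarrow> real"
  assumes W: "\<And>i. W i \<in> borel_measurable (F (Suc i))" "\<And>i w. w \<in> space M \<Longrightarrow> 0 \<le> W i w \<and> W i w \<le> b i"
    and h: "\<And>i. h i \<in> borel_measurable (F i)" "\<And>i w. w \<in> space M \<Longrightarrow> 0 \<le> h i w \<and> h i w \<le> b i"
    and cond: "\<And>i f. bounded_adapted i f \<Longrightarrow> expectation (\<lambda>w. f w * h i w) = expectation (\<lambda>w. f w * W i w)"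
    and b: "incseq b" "\<And>i. 1 \<le> b i" "filterlim b at_top sequentially"
  shows "AE w in M. (\<lambda>n. (\<Sum>i<n. W i w - h i w) / ((b n)\<^sup>2 + (\<Sum>i<n. h i w))) \<longlonglongrightarrow> 0"
proof -
  define a where "a i w = (b i)\<^sup>2 + (\<Sum>j<Suc i. h j w)" for i w
  define D where "D i w = 1 / a i w * (W i w - h i w)" for i w
  have Wa: "bounded_adapted (Suc i) (W i)" for i
    using W by (intro bounded_adaptedI[of _ _ "b i"]) auto
  have ha: "bounded_adapted i (h i)" for i
    using h by (intro bounded_adaptedI[of _ _ "b i"]) auto
  have h_mono: "bounded_adapted j (h i)" if "i \<le> j" for i j
    using ha that by (rule bounded_adapted_mono)
  have a1: "1 \<le> a i w" if "w \<in> space M" for i w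
  proof -
    have "0 \<le> (\<Sum>j<Suc i. h j w)"
      using h(2) that by (intro sum_nonneg) auto
    moreover have "1 \<le> (b i)\<^sup>2"
      using b(2)[of i] by simp
    ultimately show ?thesis
      by (simp add: a_def)
  qed
  have aa: "bounded_adapted i (a i)" for i
    unfolding a_def[abs_def] by (intro bounded_adapted_intros h_mono) auto
  have inv_a: "bounded_adapted i (\<lambda>w. 1 / a i w)" for i
  proof (rule bounded_adaptedI[of _ _ 1])
    show "(\<lambda>w. 1 / a i w) \<in> borel_measurable (F i)"
      using bounded_adapted_measurable[OF aa] by measurable
    show "\<bar>1 / a i w\<bar> \<le> 1" if "w \<in> space M" for w
      using a1[OF that, of i] by simp
  qed
  have "bounded_mds (\<lambda>i w. W i w - h i w)"
    unfolding bounded_mds_def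
  proof (intro conjI allI impI)
    show "bounded_adapted (Suc i) (\<lambda>w. W i w - h i w)" for i
      by (intro bounded_adapted_diff Wa h_mono) simp
  next
    fix i f assume f: "bounded_adapted i f"
    have fS: "bounded_adapted (Suc i) f"
      using f by (rule bounded_adapted_mono) simp
    have "integrable M (\<lambda>w. f w * W i w)" "integrable M (\<lambda>w. f w * h i w)"
      by (rule bounded_adapted_integrable[OF bounded_adapted_mult[OF fS Wa]]
          bounded_adapted_integrable[OF bounded_adapted_mult[OF f ha]])+
    then show "expectation (\<lambda>w. f w * (W i w - h i w)) = 0"
      using cond[OF f] by (simp add: right_diff_distrib)
  qed
  then have D: "bounded_mds D"
    unfolding D_def[abs_def] by (rule bounded_mds_scale) (rule inv_a)
  define r where "r i w = b i * h i w / (a i w)\<^sup>2" for i w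
  have r_eq: "r i w = b i * h i w * (1 / a i w) * (1 / a i w)" for i w
    by (simp add: r_def power2_eq_square)
  have r_int: "integrable M (r i)" for i
    unfolding r_eq[abs_def] by (intro bounded_adapted_integrable[of i] bounded_adapted_intros ha inv_a)
  \<comment> \<open>Since \<open>0 \<le> W i \<le> b i\<close>, the square of \<open>W i\<close> is
    at most \<open>b i * W i\<close>. This makes the second moment affine in \<open>W i\<close> with
    \<open>F i\<close>-measurable coefficients \<open>f1\<close> and \<open>f2\<close>, so
    \<open>cond\<close> can replace \<open>W i\<close> by \<open>h i\<close>.\<close>
  have D2_le: "expectation (\<lambda>w. (D i w)\<^sup>2) \<le> expectation (r i)" for i
  proof -
    define f1 where "f1 w = (b i - 2 * h i w) * (1 / a i w) * (1 / a i w)" for w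
    define f2 where "f2 w = h i w * h i w * (1 / a i w) * (1 / a i w)" for w
    have f: "bounded_adapted i f1" "bounded_adapted i f2"
      unfolding f1_def f2_def by (intro bounded_adapted_intros ha inv_a)+
    have f1W: "bounded_adapted (Suc i) (\<lambda>w. f1 w * W i w)"
      by (intro bounded_adapted_mult Wa bounded_adapted_mono[OF f(1)]) simp
    have Di: "bounded_adapted (Suc i) (D i)"
      by (intro bounded_mds_adapted[OF D]) simp
    have int: "integrable M (\<lambda>w. f1 w * W i w)" "integrable M (\<lambda>w. f1 w * h i w)" "integrable M f2"
      by (rule bounded_adapted_integrable[OF f1W] bounded_adapted_integrable[OF f(2)]
        bounded_adapted_integrable[OF bounded_adapted_mult[OF f(1) ha]])+
    have "expectation (\<lambda>w. (D i w)\<^sup>2) \<le> expectation (\<lambda>w. f1 w * W i w + f2 w)"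
    proof (rule integral_mono)
      show "integrable M (\<lambda>w. (D i w)\<^sup>2)"
        unfolding power2_eq_square by (rule bounded_adapted_integrable[OF bounded_adapted_mult[OF Di Di]])
      show "integrable M (\<lambda>w. f1 w * W i w + f2 w)"
        using int by simp
      fix w assume w: "w \<in> space M"
      have "W i w * W i w \<le> b i * W i w"
        using W(2)[OF w, of i] by (intro mult_right_mono) auto
      then have "(W i w - h i w)\<^sup>2 \<le> (b i - 2 * h i w) * W i w + h i w * h i w"
        by (simp add: power2_eq_square algebra_simps)
      then have "(1 / a i w * (1 / a i w)) * (W i w - h i w)\<^sup>2
          \<le> (1 / a i w * (1 / a i w)) * ((b i - 2 * h i w) * W i w + h i w * h i w)"
        using a1[OF w, of i] by (intro mult_left_mono) auto
      then show "(D i w)\<^sup>2 \<le> f1 w * W i w + f2 w"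
        unfolding D_def f1_def f2_def by (simp add: power2_eq_square algebra_simps)
    qed
    also have "\<dots> = expectation (\<lambda>w. f1 w * h i w + f2 w)"
      using int cond[OF f(1)] by simp
    also have "\<dots> \<le> expectation (r i)"
    proof (rule integral_mono)
      show "integrable M (\<lambda>w. f1 w * h i w + f2 w)"
        using int by simp
      fix w assume w: "w \<in> space M"
      have "(1 / a i w * (1 / a i w)) * ((b i - 2 * h i w) * h i w + h i w * h i w)
          \<le> (1 / a i w * (1 / a i w)) * (b i * h i w)"
        using a1[OF w, of i] by (intro mult_left_mono) (auto simp: algebra_simps)
      then show "f1 w * h i w + f2 w \<le> r i w"
        unfolding r_eq f1_def f2_def by (simp add: algebra_simps)
    qed (rule r_int)
    finally show ?thesis .
  qed
  have "(\<Sum>i<n. expectation (\<lambda>w. (D i w)\<^sup>2)) \<le> 2" for n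
  proof -
    have "(\<Sum>i<n. expectation (\<lambda>w. (D i w)\<^sup>2)) \<le> (\<Sum>i<n. expectation (r i))"
      by (intro sum_mono D2_le)
    also have "\<dots> = expectation (\<lambda>w. \<Sum>i<n. r i w)"
      using r_int by simp
    also have "\<dots> \<le> expectation (\<lambda>w. 2)"
    proof (rule integral_mono)
      fix w assume w: "w \<in> space M"
      show "(\<Sum>i<n. r i w) \<le> 2"
        unfolding r_def a_def using h(2)[OF w] b(2) by (intro sum_self_normalized_le) auto
    qed (use r_int in auto)
    finally show ?thesis
      by (simp add: prob_space)
  qed
  then have "summable (\<lambda>i. expectation (\<lambda>w. (D i w)\<^sup>2))"
    by (intro summableI_nonneg_bounded[where x = 2]) auto
  with D have "AE w in M. convergent (\<lambda>n. \<Sum>i<n. D i w)"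
    by (rule bounded_mds_AE_convergent)
  with AE_space show ?thesis
  proof eventually_elim
    case (elim w)
    define H where "H n = (\<Sum>i<n. h i w)" for n
    have H: "0 \<le> H n" "H n \<le> H (Suc n)" for n
      using h(2)[OF elim(1)] by (auto simp: H_def intro: sum_nonneg)
    have b_sq: "(b i)\<^sup>2 \<le> (b j)\<^sup>2" if "i \<le> j" for i j
      using incseqD[OF b(1) that] b(2)[of i] by (intro power_mono) auto
    have b_le: "b i \<le> (b i)\<^sup>2" for i
      using b(2)[of i] mult_right_mono[of 1 "b i" "b i"] by (simp add: power2_eq_square)
    have a_eq: "a n w = (b n)\<^sup>2 + H (Suc n)" for n
      by (simp add: a_def H_def)
    have inc: "incseq (\<lambda>n. a n w)"
      unfolding a_eq by (intro incseq_SucI add_mono b_sq H) simp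
    have top: "filterlim (\<lambda>n. a n w) at_top sequentially"
      by (rule filterlim_at_top_mono[OF b(3)])
        (use b_le H in \<open>auto simp: a_eq intro!: always_eventually add_increasing2\<close>)
    have "(\<lambda>n. (\<Sum>i<n. a i w * D i w) / a n w) \<longlonglongrightarrow> 0"
      using inc top elim(2) by (rule kronecker_lemma)
    moreover have "(\<lambda>n. D n w) \<longlonglongrightarrow> 0"
      using elim(2) by (intro summable_LIMSEQ_zero) (simp add: summable_iff_convergent)
    ultimately have "(\<lambda>n. (\<Sum>i<n. a i w * D i w) / a n w + D n w) \<longlonglongrightarrow> 0 + 0"
      by (rule tendsto_add)
    then have lim: "(\<lambda>n. \<bar>(\<Sum>i<n. a i w * D i w) / a n w + D n w\<bar>) \<longlonglongrightarrow> 0"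
      by (intro tendsto_rabs_zero) simp
    have aD: "a i w * D i w = W i w - h i w" for i
      using a1[OF elim(1), of i] by (simp add: D_def)
    \<comment> \<open>The normaliser \<open>a n w\<close> already contains \<open>h n\<close>, while
      the Kronecker sum stops before \<open>n\<close>. The missing term is \<open>D n w\<close>, a
      null sequence as the terms of a convergent series; the claim is proved at \<open>Suc n\<close>
      and shifted back.\<close>
    have "(\<lambda>n. (\<Sum>i<Suc n. W i w - h i w) / ((b (Suc n))\<^sup>2 + H (Suc n))) \<longlonglongrightarrow> 0"
    proof (rule Lim_null_comparison[OF always_eventually lim], rule allI)
      fix n
      have a_pos: "0 < a n w"
        using a1[OF elim(1), of n] by simp
      have "norm ((\<Sum>i<Suc n. W i w - h i w) / ((b (Suc n))\<^sup>2 + H (Suc n)))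
          = \<bar>\<Sum>i<Suc n. W i w - h i w\<bar> / ((b (Suc n))\<^sup>2 + H (Suc n))"
        using H(1)[of "Suc n"] by (simp add: abs_divide abs_of_nonneg)
      also have "\<dots> \<le> \<bar>\<Sum>i<Suc n. W i w - h i w\<bar> / a n w"
        using a_pos b_sq[of n "Suc n"] by (intro divide_left_mono mult_pos_pos) (auto simp: a_eq)
      also have "\<dots> = \<bar>(\<Sum>i<n. a i w * D i w) / a n w + D n w\<bar>"
      proof -
        have "D n w = (W n w - h n w) / a n w"
          by (simp add: D_def)
        then have "(\<Sum>i<Suc n. W i w - h i w) / a n w = (\<Sum>i<n. a i w * D i w) / a n w + D n w"
          unfolding aD by (simp add: add_divide_distrib)
        then show ?thesis
          using a_pos by (metis abs_divide abs_of_pos)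
      qed
      finally show "norm ((\<Sum>i<Suc n. W i w - h i w) / ((b (Suc n))\<^sup>2 + H (Suc n)))
          \<le> \<bar>(\<Sum>i<n. a i w * D i w) / a n w + D n w\<bar>" .
    qed
    then show ?case
      unfolding H_def by (rule LIMSEQ_imp_Suc)
  qed
qed

text \<open>Truncation at \<open>b i\<close>. The excesses have summable expectations, so the sum of
  the excesses and the sum of their conditional expectations are both almost surely finite, and a
  finite amount disappears against \<open>(b n)\<^sup>2\<close>.\<close>

theorem slln_conditional:
  fixes V :: "nat \<Rightarrow> 'w \<Rightarrow> real" and b :: "nat \<Rightarrow> real"
  assumes V: "\<And>i. bounded_adapted (Suc i) (V i)" "\<And>i w. w \<in> space M \<Longrightarrow> 0 \<le> V i w"
    and tails: "summable (\<lambda>i. expectation (\<lambda>w. max 0 (V i w - b i)))"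
    and b: "incseq b" "\<And>i. 1 \<le> b i" "filterlim b at_top sequentially"
  shows "AE w in M. (\<lambda>n. (\<Sum>i<n. V i w - real_cond_exp M (F i) (V i) w)
    / ((b n)\<^sup>2 + (\<Sum>i<n. real_cond_exp M (F i) (V i) w))) \<longlonglongrightarrow> 0"
proof -
  interpret C: sigma_finite_subalgebra M "F i" for i
    by (rule sigma_finite_subalgebra_F)
  define W where "W i w = min (V i w) (b i)" for i w
  define T where "T i w = max 0 (V i w - b i)" for i w
  \<comment> \<open>Clamping gives a version of the conditional expectation whose bounds hold at
    every point, as the bounded case requires.\<close>
  define h where "h i w = max 0 (min (b i) (real_cond_exp M (F i) (W i) w))" for i w
  have b0: "0 \<le> b i" for i
    using b(2)[of i] by simp
  have V_meas [measurable]: "V i \<in> borel_measurable (F (Suc i))" for i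
    using V(1) by (rule bounded_adapted_measurable)
  have VM [measurable]: "V i \<in> borel_measurable M" for i
    using V_meas by (rule measurable_F_imp_M)
  have V_int: "integrable M (V i)" for i
    using V(1) by (rule bounded_adapted_integrable)
  have W_meas: "W i \<in> borel_measurable (F (Suc i))" for i
    unfolding W_def[abs_def] by measurable
  have W_bound: "0 \<le> W i w \<and> W i w \<le> b i" if "w \<in> space M" for i w
    using V(2)[OF that] b0 by (simp add: W_def)
  have W_ad: "bounded_adapted (Suc i) (W i)" for i
    using W_meas W_bound by (intro bounded_adaptedI[of _ _ "b i"]) auto
  have W_int: "integrable M (W i)" for i
    using W_ad by (rule bounded_adapted_integrable)
  have T_eq: "T i = (\<lambda>w. V i w - W i w)" for i
    by (auto simp: T_def W_def fun_eq_iff)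
  have T_int: "integrable M (T i)" for i
    unfolding T_eq using V_int W_int by simp
  have T0: "0 \<le> T i w" for i w
    by (simp add: T_def)
  have hW: "AE w in M. h i w = real_cond_exp M (F i) (W i) w" for i
  proof -
    have "AE w in M. 0 \<le> real_cond_exp M (F i) (W i) w"
      using W_bound W_int by (intro C.real_cond_exp_ge_c) auto
    moreover have "AE w in M. real_cond_exp M (F i) (W i) w \<le> b i"
      using W_bound W_int by (intro C.real_cond_exp_le_c) auto
    ultimately show ?thesis
      by eventually_elim (simp add: h_def)
  qed
  have h_meas: "h i \<in> borel_measurable (F i)" for i
    unfolding h_def[abs_def] by measurable
  have cond: "expectation (\<lambda>w. f w * h i w) = expectation (\<lambda>w. f w * W i w)" if f: "bounded_adapted i f" for i f
  proof -
    have [measurable]: "f \<in> borel_measurable (F i)" "W i \<in> borel_measurable M"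
      using f W_meas by (auto intro: bounded_adapted_measurable measurable_F_imp_M)
    have [measurable]: "f \<in> borel_measurable M" "h i \<in> borel_measurable M"
      by (rule measurable_F_imp_M[OF bounded_adapted_measurable[OF f]] measurable_F_imp_M[OF h_meas])+
    have fW: "bounded_adapted (Suc i) (\<lambda>w. f w * W i w)"
      by (intro bounded_adapted_mult W_ad bounded_adapted_mono[OF f]) simp
    have "expectation (\<lambda>w. f w * h i w) = expectation (\<lambda>w. f w * real_cond_exp M (F i) (W i) w)"
      using hW[of i] by (intro integral_cong_AE) auto
    also have "\<dots> = expectation (\<lambda>w. f w * W i w)"
      using bounded_adapted_integrable[OF fW] by (intro C.real_cond_exp_intg) auto
    finally show ?thesis .
  qed
  have main: "AE w in M. (\<lambda>n. (\<Sum>i<n. W i w - h i w) / ((b n)\<^sup>2 + (\<Sum>i<n. h i w))) \<longlonglongrightarrow> 0"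
    by (rule slln_bounded[OF W_meas W_bound h_meas _ cond b]) (use b0 in \<open>auto simp: h_def\<close>)
  have ET_sum: "summable (\<lambda>i. expectation (T i))"
    using tails by (simp add: T_def[abs_def])
  have sumT: "AE w in M. summable (\<lambda>i. T i w)"
    using T0 by (intro AE_summable_of_summable_integral T_int ET_sum) simp
  have ET: "expectation (real_cond_exp M (F i) (T i)) = expectation (T i)" for i
    using T_int by (rule C.real_cond_exp_int)
  have rT0: "AE w in M. 0 \<le> real_cond_exp M (F i) (T i) w" for i
    using T0 T_int by (intro C.real_cond_exp_ge_c) auto
  have sumrT: "AE w in M. summable (\<lambda>i. real_cond_exp M (F i) (T i) w)"
    using ET_sum by (intro AE_summable_of_summable_integral C.real_cond_exp_int T_int rT0) (simp add: ET)
  have split: "AE w in M. \<forall>i. real_cond_exp M (F i) (V i) w = h i w + real_cond_exp M (F i) (T i) w"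
  proof (subst AE_all_countable, rule allI)
    fix i
    have V_eq: "V i = (\<lambda>w. W i w + T i w)"
      by (simp add: T_eq)
    have "AE w in M. real_cond_exp M (F i) (\<lambda>w. W i w + T i w) w
        = real_cond_exp M (F i) (W i) w + real_cond_exp M (F i) (T i) w"
      using W_int T_int by (rule C.real_cond_exp_add)
    with hW[of i] show "AE w in M. real_cond_exp M (F i) (V i) w = h i w + real_cond_exp M (F i) (T i) w"
      unfolding V_eq[symmetric] by eventually_elim simp
  qed
  have "AE w in M. \<forall>i. 0 \<le> real_cond_exp M (F i) (T i) w"
    using rT0 by (simp add: AE_all_countable)
  with main sumT sumrT split AE_space show ?thesis
  proof eventually_elim
    case (elim w)
    define g where "g i = real_cond_exp M (F i) (V i) w" for i
    define \<rho> where "\<rho> i = real_cond_exp M (F i) (T i) w" for i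
    have g: "g i = h i w + \<rho> i" and \<rho>0: "0 \<le> \<rho> i" for i
      using elim by (auto simp: g_def \<rho>_def)
    have h0: "0 \<le> h i w" for i
      by (simp add: h_def)
    define C where "C = (\<Sum>i. T i w) + (\<Sum>i. \<rho> i)"
    have bsq: "filterlim (\<lambda>n. (b n)\<^sup>2) at_top sequentially"
      by (intro filterlim_pow_at_top b) simp
    have "(\<lambda>n. C / (b n)\<^sup>2) \<longlonglongrightarrow> 0"
      by (rule real_tendsto_divide_at_top[OF tendsto_const bsq])
    from tendsto_add[OF tendsto_rabs_zero[OF elim(1)] this]
    have lim: "(\<lambda>n. \<bar>(\<Sum>i<n. W i w - h i w) / ((b n)\<^sup>2 + (\<Sum>i<n. h i w))\<bar> + C / (b n)\<^sup>2) \<longlonglongrightarrow> 0"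
      by simp
    show "(\<lambda>n. (\<Sum>i<n. V i w - real_cond_exp M (F i) (V i) w)
      / ((b n)\<^sup>2 + (\<Sum>i<n. real_cond_exp M (F i) (V i) w))) \<longlonglongrightarrow> 0"
      unfolding g_def[symmetric]
    proof (rule Lim_null_comparison[OF always_eventually lim], rule allI)
      fix n
      have pos: "0 < (b n)\<^sup>2"
        using b(2)[of n] by simp
      have Hh: "0 \<le> (\<Sum>i<n. h i w)"
        by (intro sum_nonneg h0)
      have Hg: "(\<Sum>i<n. h i w) \<le> (\<Sum>i<n. g i)"
        unfolding g by (intro sum_mono) (simp add: \<rho>0)
      have "(\<Sum>i<n. T i w) \<le> (\<Sum>i. T i w)" "(\<Sum>i<n. \<rho> i) \<le> (\<Sum>i. \<rho> i)"
        using elim T0 \<rho>0 by (auto intro!: sum_le_suminf simp: \<rho>_def)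
      moreover have "0 \<le> (\<Sum>i<n. T i w)" "0 \<le> (\<Sum>i<n. \<rho> i)"
        by (intro sum_nonneg T0 \<rho>0)+
      ultimately have "\<bar>(\<Sum>i<n. T i w) - (\<Sum>i<n. \<rho> i)\<bar> \<le> C"
        unfolding C_def by linarith
      moreover have "(\<Sum>i<n. V i w - g i) = (\<Sum>i<n. W i w - h i w) + ((\<Sum>i<n. T i w) - (\<Sum>i<n. \<rho> i))"
        unfolding g T_eq by (simp add: sum_subtractf sum.distrib)
      ultimately have num: "\<bar>\<Sum>i<n. V i w - g i\<bar> \<le> \<bar>\<Sum>i<n. W i w - h i w\<bar> + C"
        by linarith
      have C0: "0 \<le> C"
        using \<open>\<bar>(\<Sum>i<n. T i w) - (\<Sum>i<n. \<rho> i)\<bar> \<le> C\<close> by linarith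
      have "norm ((\<Sum>i<n. V i w - g i) / ((b n)\<^sup>2 + (\<Sum>i<n. g i)))
          = \<bar>\<Sum>i<n. V i w - g i\<bar> / ((b n)\<^sup>2 + (\<Sum>i<n. g i))"
        using Hh Hg by (simp add: abs_divide abs_of_nonneg)
      also have "\<dots> \<le> (\<bar>\<Sum>i<n. W i w - h i w\<bar> + C) / ((b n)\<^sup>2 + (\<Sum>i<n. h i w))"
        by (intro frac_le) (use num pos Hh Hg C0 in linarith)+
      also have "\<dots> = \<bar>\<Sum>i<n. W i w - h i w\<bar> / ((b n)\<^sup>2 + (\<Sum>i<n. h i w)) + C / ((b n)\<^sup>2 + (\<Sum>i<n. h i w))"
        by (rule add_divide_distrib)
      also have "C / ((b n)\<^sup>2 + (\<Sum>i<n. h i w)) \<le> C / (b n)\<^sup>2"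
        using pos Hh C0 by (intro divide_left_mono) (auto intro!: mult_pos_pos add_pos_nonneg)
      finally show "norm ((\<Sum>i<n. V i w - g i) / ((b n)\<^sup>2 + (\<Sum>i<n. g i)))
          \<le> \<bar>(\<Sum>i<n. W i w - h i w) / ((b n)\<^sup>2 + (\<Sum>i<n. h i w))\<bar> + C / (b n)\<^sup>2"
        using Hh by (simp add: abs_divide abs_of_nonneg)
    qed
  qed
qed

end

section \<open>The recursion for the limiting distribution\<close>

lemma prob_dist_from_iff:
  "prob_dist_from m a \<longleftrightarrow> (\<forall>d\<ge>m. 0 \<le> a d) \<and> (\<lambda>d. \<Sum>j=m..d. a j) \<longlonglongrightarrow> 1"
proof -
  have "(a has_sum 1) {m..} \<longleftrightarrow> (\<lambda>d. \<Sum>j=m..d. a j) \<longlonglongrightarrow> 1" if nonneg: "\<forall>d\<ge>m. 0 \<le> a d"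
  proof -
    have "{m..} = (\<lambda>i. i + m) ` UNIV"
      by (auto simp: image_iff) (metis le_add_diff_inverse2)
    then have "(a has_sum 1) {m..} \<longleftrightarrow> ((\<lambda>i. a (i + m)) has_sum 1) UNIV"
      using has_sum_reindex[of "\<lambda>i. i + m" UNIV a 1] by (simp add: o_def)
    also have "\<dots> \<longleftrightarrow> (\<lambda>i. a (i + m)) sums 1"
    proof
      assume "(\<lambda>i. a (i + m)) sums 1"
      moreover from this have "summable (\<lambda>i. norm (a (i + m)))"
        using nonneg by (simp add: sums_iff)
      ultimately show "((\<lambda>i. a (i + m)) has_sum 1) UNIV"
        by (rule norm_summable_imp_has_sum[rotated])
    qed (rule has_sum_imp_sums)
    also have "\<dots> \<longleftrightarrow> (\<lambda>n. \<Sum>j=m..n + m. a j) \<longlonglongrightarrow> 1"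
      using sum.shift_bounds_cl_nat_ivl[of a 0 m] by (simp add: sums_def_le atMost_atLeast0)
    also have "\<dots> \<longleftrightarrow> (\<lambda>d. \<Sum>j=m..d. a j) \<longlonglongrightarrow> 1"
      by (rule iffI[OF LIMSEQ_offset LIMSEQ_ignore_initial_segment])
    finally show ?thesis .
  qed
  then show ?thesis
    by (auto simp: prob_dist_from_def)
qed

text \<open>The shift to \<open>Suc d\<close> matches the differences \<open>k d - k (Suc d)\<close>
  and keeps the index at least 1, where the exponential bound begins.\<close>

lemma exp_decreasing_from_powr:
  assumes a: "\<forall>d\<ge>m. 0 \<le> a d" and ea: "exp_decreasing_from m a"
  shows "(\<lambda>d. a (Suc d) * real d powr t) \<longlonglongrightarrow> 0"
proof -
  obtain C r where C: "0 < C" and r: "0 < r" "r < 1" and le: "\<And>d. m \<le> d \<Longrightarrow> 1 \<le> d \<Longrightarrow> a d \<le> C * r ^ d"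
    using ea unfolding exp_decreasing_from_def by blast
  have lim: "(\<lambda>d. C * r ^ Suc d * real d powr t) \<longlonglongrightarrow> 0"
    using r by real_asymp
  show ?thesis
  proof (rule tendsto_sandwich[OF _ _ tendsto_const lim])
    show "\<forall>\<^sub>F d in sequentially. 0 \<le> a (Suc d) * real d powr t"
      using eventually_ge_at_top[of m] by eventually_elim (use a in auto)
    show "\<forall>\<^sub>F d in sequentially. a (Suc d) * real d powr t \<le> C * r ^ Suc d * real d powr t"
      using eventually_ge_at_top[of m] by eventually_elim (intro mult_right_mono le; simp)
  qed
qed

text \<open>The version for two null sequences: the inequality between differences is summed from
  \<open>n\<close> to infinity, where both limits are 0. It serves for \<open>k\<close>, which is
  accessible through its differences.\<close>

lemma stolz_cesaro_zero:
  fixes A B :: "nat \<Rightarrow> real"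
  assumes A: "A \<longlonglongrightarrow> 0" and B: "B \<longlonglongrightarrow> 0"
    and dec: "\<forall>\<^sub>F n in sequentially. B (Suc n) < B n"
    and lim: "(\<lambda>n. (A n - A (Suc n)) / (B n - B (Suc n))) \<longlonglongrightarrow> L"
  shows "(\<lambda>n. A n / B n) \<longlonglongrightarrow> L"
proof (rule metric_LIMSEQ_I)
  fix \<epsilon> :: real assume \<epsilon>: "0 < \<epsilon>"
  have "\<forall>\<^sub>F n in sequentially. \<bar>(A n - A (Suc n)) / (B n - B (Suc n)) - L\<bar> < \<epsilon> / 2"
    using tendstoD[OF lim, of "\<epsilon> / 2"] \<epsilon> by (simp add: dist_real_def)
  with dec have "\<forall>\<^sub>F n in sequentially. B (Suc n) < B n \<and>
      \<bar>(A n - A (Suc n)) - L * (B n - B (Suc n))\<bar> \<le> \<epsilon> / 2 * (B n - B (Suc n))"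
  proof eventually_elim
    case (elim n)
    define b where "b = B n - B (Suc n)"
    have "0 < b"
      using elim by (simp add: b_def)
    have "(A n - A (Suc n)) - L * b = b * ((A n - A (Suc n)) / b - L)"
      using \<open>0 < b\<close> by (simp add: field_simps)
    then have "\<bar>(A n - A (Suc n)) - L * b\<bar> = b * \<bar>(A n - A (Suc n)) / b - L\<bar>"
      using \<open>0 < b\<close> by (simp add: abs_mult)
    also have "\<dots> \<le> b * (\<epsilon> / 2)"
      using elim \<open>0 < b\<close> by (intro mult_left_mono) (auto simp: b_def)
    finally show ?case
      using elim by (simp add: b_def mult.commute)
  qed
  then obtain N where N: "\<And>n. n \<ge> N \<Longrightarrow> B (Suc n) < B n \<and>
      \<bar>(A n - A (Suc n)) - L * (B n - B (Suc n))\<bar> \<le> \<epsilon> / 2 * (B n - B (Suc n))"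
    unfolding eventually_sequentially by auto
  have "\<bar>A n / B n - L\<bar> < \<epsilon>" if n: "n \<ge> N" for n
  proof -
    have step: "\<bar>(A n - A (n + j)) - L * (B n - B (n + j))\<bar> \<le> \<epsilon> / 2 * (B n - B (n + j))" for j
    proof (induction j)
      case (Suc j)
      have "(A n - A (n + Suc j)) - L * (B n - B (n + Suc j)) = ((A n - A (n + j)) - L * (B n - B (n + j)))
          + ((A (n + j) - A (Suc (n + j))) - L * (B (n + j) - B (Suc (n + j))))"
        by (simp add: algebra_simps)
      also have "\<bar>\<dots>\<bar> \<le> \<epsilon> / 2 * (B n - B (n + j)) + \<epsilon> / 2 * (B (n + j) - B (Suc (n + j)))"
        using Suc N[of "n + j"] n by linarith
      finally show ?case
        by (simp add: algebra_simps)
    qed simp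
    have "\<bar>(A n - 0) - L * (B n - 0)\<bar> \<le> \<epsilon> / 2 * (B n - 0)"
    proof (rule LIMSEQ_le)
      have "(\<lambda>j. A (n + j)) \<longlonglongrightarrow> 0" "(\<lambda>j. B (n + j)) \<longlonglongrightarrow> 0"
        using A B LIMSEQ_ignore_initial_segment[of _ 0 n] by (simp_all add: add.commute)
      then show "(\<lambda>j. \<bar>(A n - A (n + j)) - L * (B n - B (n + j))\<bar>) \<longlonglongrightarrow> \<bar>(A n - 0) - L * (B n - 0)\<bar>"
        "(\<lambda>j. \<epsilon> / 2 * (B n - B (n + j))) \<longlonglongrightarrow> \<epsilon> / 2 * (B n - 0)"
        by (auto intro!: tendsto_eq_intros)
    qed (use step in blast)
    moreover have "0 < B n"
    proof -
      have "decseq (\<lambda>j. B (Suc n + j))"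
        using N n by (intro decseq_SucI) (simp add: less_imp_le)
      moreover have "(\<lambda>j. B (Suc n + j)) \<longlonglongrightarrow> 0"
        using LIMSEQ_ignore_initial_segment[OF B, of "Suc n"] by (simp add: add.commute)
      ultimately have "0 \<le> B (Suc n + 0)"
        by (rule decseq_ge)
      then show ?thesis
        using N[of n] n by simp
    qed
    ultimately have "\<bar>A n / B n - L\<bar> \<le> \<epsilon> / 2"
      by (simp add: abs_le_iff field_simps)
    then show ?thesis
      using \<epsilon> by simp
  qed
  then show "\<exists>no. \<forall>n\<ge>no. dist (A n / B n) L < \<epsilon>"
    by (auto simp: dist_real_def)
qed

locale degree_recursion =
  fixes m :: nat and c p q k :: "nat \<Rightarrow> real" and K \<gamma> \<alpha> :: real
  assumes c_pos: "\<And>d. m \<le> d \<Longrightarrow> 0 < c d"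
    and c_dist: "prob_dist_from m c"
    and K_pos: "0 < K"
    and c_asymp: "asymp_equiv c sequentially (\<lambda>d. K * real d powr (- \<gamma>))"
    and p_dist: "prob_dist_from m p" and p_exp: "exp_decreasing_from m p"
    and k_def: "\<And>d. m \<le> d \<Longrightarrow> k d = (\<Sum>j=m..d. p j - c j)"
    and k_pos: "\<And>d. m \<le> d \<Longrightarrow> 0 < k d"
    and \<alpha>_pos: "0 < \<alpha>"
    and q_dist: "prob_dist_from m q" and q_exp: "exp_decreasing_from m q"
begin

text \<open>The summation factor of the recursion. With the flow \<open>x d * (k d / c d)\<close> as
  unknown, the recursion says that \<open>1 + \<alpha> * c d / k d\<close> times the flow at
  \<open>d\<close> is the flow at \<open>d - 1\<close> plus \<open>\<alpha> * q d\<close>.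
  Multiplied by \<open>P d\<close> it telescopes, and \<open>P (Suc d)\<close> times the flow equals
  \<open>\<alpha> * W d\<close>.\<close>

definition P :: "nat \<Rightarrow> real" where
  "P d = (\<Prod>i\<in>{m..<d}. 1 + \<alpha> * c i / k i)"

definition W :: "nat \<Rightarrow> real" where
  "W d = (\<Sum>j=m..d. P j * q j)"

definition x :: "nat \<Rightarrow> real" where
  "x d = \<alpha> * W d / (P (Suc d) * (k d / c d))"

lemma P_pos: "0 < P d"
  unfolding P_def using c_pos k_pos \<alpha>_pos by (intro prod_pos) (auto intro!: add_pos_pos)

lemma P_Suc: "m \<le> d \<Longrightarrow> P (Suc d) = P d * (1 + \<alpha> * c d / k d)"
  by (simp add: P_def)

lemma q_nonneg: "m \<le> d \<Longrightarrow> 0 \<le> q d" and p_nonneg: "m \<le> d \<Longrightarrow> 0 \<le> p d"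
  using q_dist p_dist by (auto simp: prob_dist_from_def)

lemma W_nonneg: "0 \<le> W d"
  unfolding W_def using q_nonneg P_pos by (auto intro!: sum_nonneg simp: less_imp_le)

lemma x_nonneg: "m \<le> d \<Longrightarrow> 0 \<le> x d"
  unfolding x_def using W_nonneg[of d] P_pos[of "Suc d"] c_pos[of d] k_pos[of d] \<alpha>_pos
  by (intro divide_nonneg_nonneg mult_nonneg_nonneg) auto

lemma x_flow: "m \<le> d \<Longrightarrow> x d * (\<alpha> + k d / c d) = \<alpha> * W d / P d"
  using P_Suc[of d] P_pos[of d] c_pos[of d] k_pos[of d] \<alpha>_pos
  unfolding x_def
  by (simp add: divide_simps add_nonneg_eq_0_iff)

lemma x_start: "x m = \<alpha> * q m / (\<alpha> + (p m - c m) / c m)"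
proof -
  have "0 < \<alpha> + k m / c m"
    using c_pos[of m] k_pos[of m] \<alpha>_pos by (intro add_pos_pos) auto
  moreover have "x m * (\<alpha> + k m / c m) = \<alpha> * q m"
    using x_flow[of m] by (simp add: W_def P_def)
  ultimately show ?thesis
    using k_def[of m] by (simp add: field_simps)
qed

lemma x_step:
  assumes "Suc m \<le> d"
  shows "x d = (x (d - 1) * (k (d - 1) / c (d - 1)) + \<alpha> * q d) / (\<alpha> + k d / c d)"
proof -
  obtain j where d: "d = Suc j" "m \<le> j"
    using assms by (cases d) auto
  have "0 < \<alpha> + k d / c d"
    using c_pos[of d] k_pos[of d] \<alpha>_pos d by (intro add_pos_pos) auto
  have "x d * (\<alpha> + k d / c d) = \<alpha> * W d / P d"
    using x_flow[of d] d by simp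
  also have "\<dots> = \<alpha> * W j / P d + \<alpha> * q d"
    using d P_pos[of d] by (simp add: W_def field_simps)
  also have "\<alpha> * W j / P d = x j * (k j / c j)"
    using c_pos[of j] k_pos[of j] d by (simp add: x_def)
  finally show ?thesis
    using \<open>0 < \<alpha> + k d / c d\<close> d by (simp add: field_simps)
qed

text \<open>The recursion summed over the degrees up to \<open>d\<close>, where the flows between
  neighbouring degrees cancel. It is needed twice: to annihilate the right-hand side of the Volterra
  equation, and, once the flow is known to vanish, to obtain total mass 1.\<close>

lemma x_balance:
  assumes "m \<le> d"
  shows "x d * (k d / c d) + \<alpha> * (\<Sum>j=m..d. x j) = \<alpha> * (\<Sum>j=m..d. q j)"
  using assms
proof (induction d rule: dec_induct)
  case base
  then show ?case
    using x_flow[of m] by (simp add: W_def P_def algebra_simps)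
next
  case (step d)
  have "0 < \<alpha> + k (Suc d) / c (Suc d)"
    using c_pos[of "Suc d"] k_pos[of "Suc d"] \<alpha>_pos step by (intro add_pos_pos) auto
  then have "x (Suc d) * (\<alpha> + k (Suc d) / c (Suc d)) = x d * (k d / c d) + \<alpha> * q (Suc d)"
    using x_step[of "Suc d"] step by simp
  then show ?case
    using step by (simp add: algebra_simps)
qed

section \<open>Power-law asymptotics of the coefficients and of the summation factor\<close>

lemma c_lim: "(\<lambda>d. c d / real d powr (- \<gamma>)) \<longlonglongrightarrow> K"
proof -
  have "\<forall>\<^sub>F d in sequentially. c d \<noteq> 0 \<or> K * real d powr (- \<gamma>) \<noteq> 0"
    using eventually_gt_at_top[of 0] by eventually_elim (use K_pos in auto)
  then have "(\<lambda>d. c d / (K * real d powr (- \<gamma>))) \<longlonglongrightarrow> 1"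
    by (rule asymp_equivD_strong[OF c_asymp])
  then have "(\<lambda>d. K * (c d / (K * real d powr (- \<gamma>)))) \<longlonglongrightarrow> K * 1"
    by (intro tendsto_mult tendsto_const)
  then show ?thesis
    using K_pos by simp
qed

text \<open>Forced by the summability of \<open>c\<close>, whose terms are eventually at least a
  positive multiple of \<open>d powr (- \<gamma>)\<close>.\<close>

lemma \<gamma>_gt_1: "1 < \<gamma>"
proof -
  have "(\<lambda>d. \<Sum>j=m..d. c j) \<longlonglongrightarrow> 1"
    using c_dist by (simp add: prob_dist_from_iff)
  then have "(\<lambda>n. \<Sum>j=m..n + m. c j) \<longlonglongrightarrow> 1"
    by (rule LIMSEQ_ignore_initial_segment)
  then have "(\<lambda>i. c (i + m)) sums 1"
    using sum.shift_bounds_cl_nat_ivl[of c 0 m] by (simp add: sums_def_le atMost_atLeast0)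
  then have "summable c"
    using sums_summable summable_iff_shift by blast
  have "\<forall>\<^sub>F d in sequentially. K / 2 < c d / real d powr (- \<gamma>)"
    by (rule order_tendstoD(1)[OF c_lim]) (use K_pos in simp)
  then have "\<forall>\<^sub>F d in sequentially. norm (real d powr (- \<gamma>)) \<le> 2 / K * c d"
    using eventually_gt_at_top[of 0]
    by eventually_elim (use K_pos in \<open>simp add: field_simps powr_minus\<close>)
  then have "summable (\<lambda>d. real d powr (- \<gamma>))"
    by (rule summable_comparison_test_ev) (intro summable_mult \<open>summable c\<close>)
  then show ?thesis
    by (simp add: summable_real_powr_iff)
qed

lemma p_powr: "(\<lambda>d. p (Suc d) * real d powr t) \<longlonglongrightarrow> 0"
  and q_powr: "(\<lambda>d. q (Suc d) * real d powr t) \<longlonglongrightarrow> 0"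
  by (intro exp_decreasing_from_powr[of m]; use p_nonneg p_exp q_nonneg q_exp in blast)+

lemma k_tendsto_0: "k \<longlonglongrightarrow> 0"
proof -
  have "(\<lambda>d. (\<Sum>j=m..d. p j) - (\<Sum>j=m..d. c j)) \<longlonglongrightarrow> 1 - 1"
    using p_dist c_dist by (intro tendsto_diff) (auto simp: prob_dist_from_iff)
  then have "(\<lambda>d. \<Sum>j=m..d. p j - c j) \<longlonglongrightarrow> 0"
    by (simp add: sum_subtractf)
  then show ?thesis
  proof (rule Lim_transform_eventually)
    show "\<forall>\<^sub>F d in sequentially. (\<Sum>j=m..d. p j - c j) = k d"
      using eventually_ge_at_top[of m] by eventually_elim (simp add: k_def)
  qed
qed

lemma k_Suc: "m \<le> d \<Longrightarrow> k d - k (Suc d) = c (Suc d) - p (Suc d)"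
  by (simp add: k_def)

text \<open>As \<open>k\<close> tends to 0 and its decrements are \<open>c - p\<close> with
  \<open>p\<close> exponentially small, \<open>k d\<close> behaves like the tail of \<open>c\<close>
  after \<open>d\<close>.\<close>

lemma k_lim: "(\<lambda>d. k d / real d powr (1 - \<gamma>)) \<longlonglongrightarrow> K / (\<gamma> - 1)"
proof (rule stolz_cesaro_zero[OF k_tendsto_0])
  show "(\<lambda>d. real d powr (1 - \<gamma>)) \<longlonglongrightarrow> 0"
    using \<gamma>_gt_1 by (intro tendsto_neg_powr filterlim_real_sequentially) simp
  show dec: "\<forall>\<^sub>F n in sequentially. real (Suc n) powr (1 - \<gamma>) < real n powr (1 - \<gamma>)"
    using eventually_gt_at_top[of 0]
    by eventually_elim (use \<gamma>_gt_1 in \<open>auto intro!: powr_less_mono2_neg\<close>)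
  let ?B = "\<lambda>d. real d powr (1 - \<gamma>) - real (Suc d) powr (1 - \<gamma>)"
  have "(\<lambda>d. c (Suc d) / real (Suc d) powr (- \<gamma>)) \<longlonglongrightarrow> K"
    using c_lim by (rule LIMSEQ_Suc)
  moreover have "(\<lambda>d. real (Suc d) powr (- \<gamma>) / ?B d) \<longlonglongrightarrow> 1 / (\<gamma> - 1)"
    using \<gamma>_gt_1 by real_asymp (simp add: field_simps)
  moreover have "(\<lambda>d. p (Suc d) * real d powr \<gamma>) \<longlonglongrightarrow> 0"
    by (rule p_powr)
  moreover have "(\<lambda>d. real d powr (- \<gamma>) / ?B d) \<longlonglongrightarrow> 1 / (\<gamma> - 1)"
    using \<gamma>_gt_1 by real_asymp (simp add: field_simps)
  ultimately have "(\<lambda>d. c (Suc d) / real (Suc d) powr (- \<gamma>) * (real (Suc d) powr (- \<gamma>) / ?B d)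
      - p (Suc d) * real d powr \<gamma> * (real d powr (- \<gamma>) / ?B d)) \<longlonglongrightarrow>
      K * (1 / (\<gamma> - 1)) - 0 * (1 / (\<gamma> - 1))"
    by (intro tendsto_diff tendsto_mult)
  then have "(\<lambda>d. c (Suc d) / real (Suc d) powr (- \<gamma>) * (real (Suc d) powr (- \<gamma>) / ?B d)
      - p (Suc d) * real d powr \<gamma> * (real d powr (- \<gamma>) / ?B d)) \<longlonglongrightarrow> K / (\<gamma> - 1)"
    by simp
  then show "(\<lambda>d. (k d - k (Suc d)) / ?B d) \<longlonglongrightarrow> K / (\<gamma> - 1)"
  proof (rule Lim_transform_eventually)
    show "\<forall>\<^sub>F d in sequentially. c (Suc d) / real (Suc d) powr (- \<gamma>) * (real (Suc d) powr (- \<gamma>) / ?B d)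
      - p (Suc d) * real d powr \<gamma> * (real d powr (- \<gamma>) / ?B d) = (k d - k (Suc d)) / ?B d"
      using eventually_gt_at_top[of 0] eventually_ge_at_top[of m]
    proof eventually_elim
      case (elim d)
      have "real d powr \<gamma> * real d powr (- \<gamma>) = 1"
        using elim by (simp add: powr_add[symmetric])
      then show ?case
        using elim k_Suc[of d]
        by (simp add: diff_divide_distrib mult.assoc[symmetric])
    qed
  qed
qed

lemma kappa_lim: "(\<lambda>d. k d / c d / real d) \<longlonglongrightarrow> 1 / (\<gamma> - 1)"
proof -
  have "(\<lambda>d. k d / real d powr (1 - \<gamma>) / (c d / real d powr (- \<gamma>))) \<longlonglongrightarrow> K / (\<gamma> - 1) / K"
    by (intro tendsto_divide k_lim c_lim) (use K_pos in auto)
  then have "(\<lambda>d. k d / real d powr (1 - \<gamma>) / (c d / real d powr (- \<gamma>))) \<longlonglongrightarrow> 1 / (\<gamma> - 1)"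
    using K_pos by simp
  then show ?thesis
  proof (rule Lim_transform_eventually)
    show "\<forall>\<^sub>F d in sequentially. k d / real d powr (1 - \<gamma>) / (c d / real d powr (- \<gamma>)) = k d / c d / real d"
      using eventually_gt_at_top[of 0]
    proof eventually_elim
      case (elim d)
      have "real d powr (1 - \<gamma>) = real d * real d powr (- \<gamma>)"
        using elim powr_add[of "real d" 1 "- \<gamma>"] by simp
      then show ?case
        using elim by simp
    qed
  qed
qed

definition logP :: "nat \<Rightarrow> real" where
  "logP d = ln (P (Suc d)) + \<alpha> * ln (k d)"

lemma logP_step:
  assumes "m \<le> d"
  shows "logP (Suc d) - logP d = ln (1 + \<alpha> * (c (Suc d) / k (Suc d)))
    - \<alpha> * ln (1 + (c (Suc d) / k (Suc d) - p (Suc d) / k (Suc d)))"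
proof -
  have pos: "0 < k d" "0 < k (Suc d)" "0 < c (Suc d)"
    using k_pos c_pos assms by auto
  have "ln (P (Suc (Suc d))) = ln (P (Suc d)) + ln (1 + \<alpha> * (c (Suc d) / k (Suc d)))"
    using P_Suc[of "Suc d"] P_pos[of "Suc d"] assms pos \<alpha>_pos
    by (subst ln_mult_pos[symmetric]) (auto intro!: add_pos_pos)
  moreover have "1 + (c (Suc d) / k (Suc d) - p (Suc d) / k (Suc d)) = k d / k (Suc d)"
    using k_Suc[OF assms] pos by (simp add: field_simps)
  ultimately show ?thesis
    using pos by (simp add: logP_def ln_div algebra_simps)
qed

text \<open>Since \<open>c d = k (d - 1) - k d + p d\<close>, the increments \<open>c d / k d\<close> agree with those of \<open>- ln k\<close> up to
  a summable error. Hence \<open>P\<close> has the exact order \<open>k powr (- \<alpha>)\<close>, although \<open>c\<close> is only known up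
  to a factor \<open>1 + o(1)\<close>.\<close>

lemma convergent_logP: "convergent logP"
proof -
  define h where "h d = c (Suc d) / k (Suc d)" for d
  define \<pi> where "\<pi> d = p (Suc d) / k (Suc d)" for d
  have "(\<lambda>d. inverse (k (Suc d) / c (Suc d) / real (Suc d))) \<longlonglongrightarrow> inverse (1 / (\<gamma> - 1))"
    using \<gamma>_gt_1 by (intro tendsto_inverse LIMSEQ_Suc[OF kappa_lim]) auto
  then have h_lim: "(\<lambda>d. h d * real (Suc d)) \<longlonglongrightarrow> \<gamma> - 1"
    by (simp add: h_def field_simps)
  \<comment> \<open>The power \<open>\<gamma> + 1\<close> is what \<open>1 / k\<close>, of order
    \<open>d powr (\<gamma> - 1)\<close>, and the factor of order \<open>d^2\<close> require
    together; \<open>p\<close> beats every power.\<close>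
  have "(\<lambda>d. p (Suc d) * real d powr (\<gamma> + 1) / (k (Suc d) / real (Suc d) powr (1 - \<gamma>))
      * (real (Suc d) ^ 2 / real (Suc d) powr (1 - \<gamma>) / real d powr (\<gamma> + 1))) \<longlonglongrightarrow> 0 / (K / (\<gamma> - 1)) * 1"
  proof (rule tendsto_mult[OF tendsto_divide[OF p_powr LIMSEQ_Suc[OF k_lim]]])
    show "(\<lambda>d. real (Suc d) ^ 2 / real (Suc d) powr (1 - \<gamma>) / real d powr (\<gamma> + 1)) \<longlonglongrightarrow> 1"
      by real_asymp
  qed (use K_pos \<gamma>_gt_1 in auto)
  then have "(\<lambda>d. p (Suc d) * real d powr (\<gamma> + 1) / (k (Suc d) / real (Suc d) powr (1 - \<gamma>))
      * (real (Suc d) ^ 2 / real (Suc d) powr (1 - \<gamma>) / real d powr (\<gamma> + 1))) \<longlonglongrightarrow> 0"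
    by simp
  then have \<pi>_lim: "(\<lambda>d. \<pi> d * real (Suc d) ^ 2) \<longlonglongrightarrow> 0"
  proof (rule Lim_transform_eventually)
    show "\<forall>\<^sub>F d in sequentially. p (Suc d) * real d powr (\<gamma> + 1) / (k (Suc d) / real (Suc d) powr (1 - \<gamma>))
      * (real (Suc d) ^ 2 / real (Suc d) powr (1 - \<gamma>) / real d powr (\<gamma> + 1)) = \<pi> d * real (Suc d) ^ 2"
      using eventually_gt_at_top[of 0] by eventually_elim (simp add: \<pi>_def)
  qed
  have "(\<lambda>d. h d * real (Suc d) * (1 / real (Suc d))) \<longlonglongrightarrow> (\<gamma> - 1) * 0"
    using h_lim by (rule tendsto_mult) real_asymp
  then have h0: "h \<longlonglongrightarrow> 0"
    by simp
  have "(\<lambda>d. \<pi> d * real (Suc d) ^ 2 * (1 / real (Suc d) ^ 2)) \<longlonglongrightarrow> 0 * 0"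
    using \<pi>_lim by (rule tendsto_mult) real_asymp
  then have \<pi>0: "\<pi> \<longlonglongrightarrow> 0"
    by simp
  define C where "C = 2 * (\<alpha> * \<gamma>)\<^sup>2 + \<alpha> * (2 * (\<gamma> + 1)\<^sup>2 + 1)"
  have "\<forall>\<^sub>F d in sequentially. h d * real (Suc d) < \<gamma>"
    by (rule order_tendstoD(2)[OF h_lim]) simp
  moreover have "\<forall>\<^sub>F d in sequentially. h d < 1 / (4 * (\<alpha> + 1))" "\<forall>\<^sub>F d in sequentially. h d < 1 / 4"
    by (rule order_tendstoD(2)[OF h0]; use \<alpha>_pos in simp)+
  moreover have "\<forall>\<^sub>F d in sequentially. \<pi> d < 1 / 4"
    by (rule order_tendstoD(2)[OF \<pi>0]) simp
  moreover have "\<forall>\<^sub>F d in sequentially. \<pi> d * real (Suc d) ^ 2 < 1"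
    by (rule order_tendstoD(2)[OF \<pi>_lim]) simp
  ultimately have "\<forall>\<^sub>F d in sequentially. norm (logP (Suc d) - logP d) \<le> C * (1 / real (Suc d) ^ 2)"
    using eventually_ge_at_top[of m]
  proof eventually_elim
    case (elim d)
    have pos: "0 \<le> h d" "0 \<le> \<pi> d"
      using elim c_pos[of "Suc d"] p_nonneg[of "Suc d"] k_pos[of "Suc d"] by (auto simp: h_def \<pi>_def)
    have h_le: "h d \<le> \<gamma> / real (Suc d)" and \<pi>_le: "\<pi> d \<le> 1 / real (Suc d) ^ 2"
      using elim by (simp_all add: pos_le_divide_eq del: of_nat_Suc)
    have "1 / real (Suc d) ^ 2 \<le> 1 / real (Suc d)"
      by (intro divide_left_mono) (auto simp: power2_eq_square)
    then have "\<bar>h d - \<pi> d\<bar> \<le> \<gamma> / real (Suc d) + 1 / real (Suc d)"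
      using pos h_le \<pi>_le by linarith
    then have "\<bar>h d - \<pi> d\<bar> \<le> (\<gamma> + 1) / real (Suc d)"
      by (simp add: add_divide_distrib)
    then have "\<bar>h d - \<pi> d\<bar>\<^sup>2 \<le> ((\<gamma> + 1) / real (Suc d))\<^sup>2"
      by (intro power_mono) auto
    then have sq1: "(h d - \<pi> d)\<^sup>2 \<le> (\<gamma> + 1)\<^sup>2 / real (Suc d) ^ 2"
      by (simp add: power_divide)
    have "(\<alpha> * h d)\<^sup>2 \<le> (\<alpha> * (\<gamma> / real (Suc d)))\<^sup>2"
      using pos h_le \<alpha>_pos by (intro power_mono mult_left_mono) auto
    then have sq2: "(\<alpha> * h d)\<^sup>2 \<le> (\<alpha> * \<gamma>)\<^sup>2 / real (Suc d) ^ 2"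
      by (simp add: power_divide power_mult_distrib)
    have "\<alpha> * h d \<le> \<alpha> * (1 / (4 * (\<alpha> + 1)))"
      using elim \<alpha>_pos by (intro mult_left_mono) auto
    also have "\<dots> \<le> 1 / 2"
      using \<alpha>_pos by (simp add: field_simps)
    finally have "\<bar>\<alpha> * h d\<bar> \<le> 1 / 2"
      using pos \<alpha>_pos by simp
    then have b1: "\<bar>ln (1 + \<alpha> * h d) - \<alpha> * h d\<bar> \<le> 2 * (\<alpha> * h d)\<^sup>2"
      by (rule abs_ln_one_plus_x_minus_x_bound)
    have b2: "\<bar>ln (1 + (h d - \<pi> d)) - (h d - \<pi> d)\<bar> \<le> 2 * (h d - \<pi> d)\<^sup>2"
      using pos elim by (intro abs_ln_one_plus_x_minus_x_bound) linarith
    have "logP (Suc d) - logP d = ln (1 + \<alpha> * h d) - \<alpha> * ln (1 + (h d - \<pi> d))"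
      using logP_step[of d] elim by (simp add: h_def \<pi>_def)
    \<comment> \<open>The linear terms \<open>\<alpha> * h d\<close> of the two logarithms cancel
      except for \<open>\<alpha> * \<pi> d\<close>. The remainders are quadratic in quantities of
      order \<open>1 / d\<close>, hence summable.\<close>
    also have "\<dots> = (ln (1 + \<alpha> * h d) - \<alpha> * h d)
        - \<alpha> * (ln (1 + (h d - \<pi> d)) - (h d - \<pi> d)) + \<alpha> * \<pi> d"
      by (simp add: algebra_simps)
    finally have "\<bar>logP (Suc d) - logP d\<bar> \<le> \<bar>ln (1 + \<alpha> * h d) - \<alpha> * h d\<bar>
        + \<bar>\<alpha> * (ln (1 + (h d - \<pi> d)) - (h d - \<pi> d))\<bar> + \<bar>\<alpha> * \<pi> d\<bar>"
      by linarith
    also have "\<dots> \<le> 2 * (\<alpha> * h d)\<^sup>2 + \<alpha> * (2 * (h d - \<pi> d)\<^sup>2) + \<alpha> * \<pi> d"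
      using b1 b2 pos \<alpha>_pos by (intro add_mono) (auto simp: abs_mult)
    also have "\<dots> \<le> 2 * ((\<alpha> * \<gamma>)\<^sup>2 / real (Suc d) ^ 2) + \<alpha> * (2 * ((\<gamma> + 1)\<^sup>2 / real (Suc d) ^ 2))
        + \<alpha> * (1 / real (Suc d) ^ 2)"
      using sq1 sq2 \<pi>_le \<alpha>_pos by (intro add_mono mult_left_mono) auto
    also have "\<dots> = C * (1 / real (Suc d) ^ 2)"
      by (simp add: C_def field_simps)
    finally show ?case
      by simp
  qed
  moreover have "summable (\<lambda>d. C * (1 / real (Suc d) ^ 2))"
    using inverse_power_summable[of 2, where ?'a = real]
    by (intro summable_mult) (subst summable_Suc_iff, simp add: inverse_eq_divide)
  ultimately have "summable (\<lambda>d. logP (Suc d) - logP d)"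
    by (rule summable_comparison_test_ev)
  then obtain s where "(\<lambda>n. \<Sum>d<n. logP (Suc d) - logP d) \<longlonglongrightarrow> s"
    by (auto simp: summable_def sums_def)
  then have "(\<lambda>n. logP n - logP 0 + logP 0) \<longlonglongrightarrow> s + logP 0"
    unfolding sum_lessThan_telescope by (intro tendsto_intros)
  then show ?thesis
    by (auto simp: convergent_def)
qed

lemma P_asymp:
  obtains \<Theta> where "0 < \<Theta>" "(\<lambda>d. P (Suc d) / real d powr (\<alpha> * (\<gamma> - 1))) \<longlonglongrightarrow> \<Theta>"
proof -
  obtain L where L: "logP \<longlonglongrightarrow> L"
    using convergent_logP by (auto simp: convergent_def)
  define A where "A = K / (\<gamma> - 1)"
  have A: "0 < A"
    using K_pos \<gamma>_gt_1 by (simp add: A_def)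
  have "(\<lambda>d. exp (logP d) * (k d / real d powr (1 - \<gamma>)) powr (- \<alpha>)) \<longlonglongrightarrow> exp L * A powr (- \<alpha>)"
    using L k_lim A by (intro tendsto_intros) (auto simp: A_def)
  then have "(\<lambda>d. P (Suc d) / real d powr (\<alpha> * (\<gamma> - 1))) \<longlonglongrightarrow> exp L * A powr (- \<alpha>)"
  proof (rule Lim_transform_eventually)
    show "\<forall>\<^sub>F d in sequentially. exp (logP d) * (k d / real d powr (1 - \<gamma>)) powr (- \<alpha>)
        = P (Suc d) / real d powr (\<alpha> * (\<gamma> - 1))"
      using eventually_gt_at_top[of 0] eventually_ge_at_top[of m]
    proof eventually_elim
      case (elim d)
      have "0 < k d"
        using k_pos elim by auto
      have "exp (logP d) = P (Suc d) * k d powr \<alpha>"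
        using P_pos[of "Suc d"] \<open>0 < k d\<close> by (simp add: logP_def exp_add powr_def)
      moreover have "(k d / real d powr (1 - \<gamma>)) powr (- \<alpha>)
          = k d powr (- \<alpha>) / real d powr (\<alpha> * (\<gamma> - 1))"
        using \<open>0 < k d\<close> by (simp add: powr_divide powr_powr algebra_simps)
      moreover have "k d powr \<alpha> * k d powr (- \<alpha>) = 1"
        using \<open>0 < k d\<close> by (simp add: powr_add[symmetric])
      ultimately show ?case
        by (simp add: mult.assoc)
    qed
  qed
  moreover have "0 < exp L * A powr (- \<alpha>)"
    using A by simp
  ultimately show ?thesis
    using that by blast
qed

text \<open>\<open>P\<close> grows only polynomially and \<open>q\<close> decreases exponentially,
  so the series converges. The limit is positive because \<open>q\<close> has total mass 1 and so
  charges some degree.\<close>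

lemma W_lim:
  obtains w where "0 < w" "W \<longlonglongrightarrow> w"
proof -
  obtain \<Theta> where \<Theta>: "0 < \<Theta>" "(\<lambda>d. P (Suc d) / real d powr (\<alpha> * (\<gamma> - 1))) \<longlonglongrightarrow> \<Theta>"
    by (rule P_asymp)
  define f where "f i = P i * q i" for i
  have "(\<lambda>d. P (Suc d) / real d powr (\<alpha> * (\<gamma> - 1)) * (q (Suc d) * real d powr (\<alpha> * (\<gamma> - 1) + 2))) \<longlonglongrightarrow> 0"
    using tendsto_mult[OF \<Theta>(2) q_powr] by simp
  then have lim: "(\<lambda>d. f (Suc d) * real d powr 2) \<longlonglongrightarrow> 0"
  proof (rule Lim_transform_eventually)
    show "\<forall>\<^sub>F d in sequentially. P (Suc d) / real d powr (\<alpha> * (\<gamma> - 1))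
      * (q (Suc d) * real d powr (\<alpha> * (\<gamma> - 1) + 2)) = f (Suc d) * real d powr 2"
      using eventually_gt_at_top[of 0] by eventually_elim (simp add: f_def powr_add)
  qed
  have "\<forall>\<^sub>F d in sequentially. f (Suc d) * real d powr 2 < 1"
    using lim by (rule order_tendstoD) simp
  then have "\<forall>\<^sub>F d in sequentially. norm (f (Suc d)) \<le> 1 / real d ^ 2"
    using eventually_gt_at_top[of 0] eventually_ge_at_top[of m]
  proof eventually_elim
    case (elim d)
    then show ?case
      using P_pos[of "Suc d"] q_nonneg[of "Suc d"] by (simp add: f_def field_simps)
  qed
  moreover have "summable (\<lambda>d. 1 / real d ^ 2)"
    using inverse_power_summable[of 2, where ?'a = real] by (simp add: inverse_eq_divide)
  ultimately have "summable (\<lambda>d. f (Suc d))"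
    by (rule summable_comparison_test_ev)
  then have "summable f"
    by (simp add: summable_Suc_iff)
  then have "summable (\<lambda>i. f (i + m))"
    by (simp add: summable_iff_shift)
  then obtain w where "(\<lambda>i. f (i + m)) sums w"
    using summable_sums by blast
  then have "(\<lambda>n. W (n + m)) \<longlonglongrightarrow> w"
    using sum.shift_bounds_cl_nat_ivl[of f 0 m]
    by (simp add: sums_def_le atMost_atLeast0 W_def f_def)
  then have W_w: "W \<longlonglongrightarrow> w"
    by (rule LIMSEQ_offset)
  have "\<exists>j\<ge>m. 0 < q j"
  proof (rule ccontr)
    assume "\<not> (\<exists>j\<ge>m. 0 < q j)"
    then have "q j = 0" if "m \<le> j" for j
      using q_nonneg[OF that] that by force
    then have "(\<lambda>d. \<Sum>j=m..d. q j) = (\<lambda>d. 0)"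
      by (intro ext sum.neutral) auto
    then show False
      using q_dist by (simp add: prob_dist_from_iff LIMSEQ_const_iff)
  qed
  then obtain j where j: "m \<le> j" "0 < q j"
    by blast
  have "incseq W"
    unfolding W_def using q_nonneg P_pos
    by (intro monoI sum_mono2) (auto simp: less_imp_le)
  then have "W j \<le> w"
    using W_w by (rule incseq_le)
  moreover have "0 < P j * q j"
    using j P_pos by simp
  moreover have "P j * q j \<le> W j"
    unfolding W_def using j q_nonneg P_pos by (intro member_le_sum) (auto simp: less_imp_le)
  ultimately have "0 < w"
    by linarith
  then show ?thesis
    using W_w by (rule that)
qed

text \<open>By \<open>x_balance\<close>, the mass missing up to degree \<open>d\<close>, compared
  with that of \<open>q\<close>, is the flow divided by \<alpha>. The flow vanishes in the limit
  because \<open>W\<close> stays bounded while \<open>P\<close> tends to infinity.\<close>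

lemma prob_dist_x: "prob_dist_from m x"
proof -
  obtain \<Theta> where \<Theta>: "0 < \<Theta>" "(\<lambda>d. P (Suc d) / real d powr (\<alpha> * (\<gamma> - 1))) \<longlonglongrightarrow> \<Theta>"
    by (rule P_asymp)
  obtain w where w: "W \<longlonglongrightarrow> w"
    by (rule W_lim)
  have "(\<lambda>d. \<alpha> * W d / (P (Suc d) / real d powr (\<alpha> * (\<gamma> - 1)))
      * real d powr (- (\<alpha> * (\<gamma> - 1)))) \<longlonglongrightarrow> \<alpha> * w / \<Theta> * 0"
  proof (intro tendsto_mult tendsto_divide tendsto_const w \<Theta>)
    have "0 < \<alpha> * (\<gamma> - 1)"
      using \<gamma>_gt_1 \<alpha>_pos by simp
    then show "(\<lambda>d. real d powr (- (\<alpha> * (\<gamma> - 1)))) \<longlonglongrightarrow> 0"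
      by (intro tendsto_neg_powr filterlim_real_sequentially) simp
  qed (use \<Theta> in auto)
  then have "(\<lambda>d. \<alpha> * W d / (P (Suc d) / real d powr (\<alpha> * (\<gamma> - 1)))
      * real d powr (- (\<alpha> * (\<gamma> - 1)))) \<longlonglongrightarrow> 0"
    by simp
  then have flow: "(\<lambda>d. x d * (k d / c d)) \<longlonglongrightarrow> 0"
  proof (rule Lim_transform_eventually)
    show "\<forall>\<^sub>F d in sequentially. \<alpha> * W d / (P (Suc d) / real d powr (\<alpha> * (\<gamma> - 1)))
        * real d powr (- (\<alpha> * (\<gamma> - 1))) = x d * (k d / c d)"
      using eventually_gt_at_top[of 0] eventually_ge_at_top[of m]
    proof eventually_elim
      case (elim d)
      have "0 < k d" "0 < c d"
        using elim k_pos c_pos by auto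
      then show ?case
        unfolding x_def powr_minus using elim by (simp add: field_simps)
    qed
  qed
  have "(\<lambda>d. (\<Sum>j=m..d. q j) - x d * (k d / c d) / \<alpha>) \<longlonglongrightarrow> 1 - 0 / \<alpha>"
    using q_dist \<alpha>_pos by (intro tendsto_diff tendsto_divide flow) (auto simp: prob_dist_from_iff)
  then have "(\<lambda>d. (\<Sum>j=m..d. q j) - x d * (k d / c d) / \<alpha>) \<longlonglongrightarrow> 1"
    by simp
  then have "(\<lambda>d. \<Sum>j=m..d. x j) \<longlonglongrightarrow> 1"
  proof (rule Lim_transform_eventually)
    show "\<forall>\<^sub>F d in sequentially. (\<Sum>j=m..d. q j) - x d * (k d / c d) / \<alpha> = (\<Sum>j=m..d. x j)"
      using eventually_ge_at_top[of m]
    proof eventually_elim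
      case (elim d)
      then have "\<alpha> * (\<Sum>j=m..d. x j) = \<alpha> * ((\<Sum>j=m..d. q j) - x d * (k d / c d) / \<alpha>)"
        using x_balance[of d] \<alpha>_pos by (simp add: right_diff_distrib)
      then show ?case
        using \<alpha>_pos by simp
    qed
  qed
  then show ?thesis
    using x_nonneg by (simp add: prob_dist_from_iff)
qed

text \<open>Both parts of the exponent are visible in the closed form: \<open>P\<close> contributes
  \<open>\<alpha> * (\<gamma> - 1)\<close>, the quotient \<open>k d / c d\<close> contributes 1, and
  \<open>W\<close> only a constant.\<close>

lemma x_asymp:
  "\<exists>L>0. asymp_equiv x sequentially (\<lambda>d. L * real d powr (- (\<alpha> * (\<gamma> - 1) + 1)))"
proof -
  obtain \<Theta> where \<Theta>: "0 < \<Theta>" "(\<lambda>d. P (Suc d) / real d powr (\<alpha> * (\<gamma> - 1))) \<longlonglongrightarrow> \<Theta>"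
    by (rule P_asymp)
  obtain w where w: "0 < w" "W \<longlonglongrightarrow> w"
    by (rule W_lim)
  define L where "L = \<alpha> * w / (\<Theta> * (1 / (\<gamma> - 1)))"
  have L: "0 < L"
    using \<Theta> w \<alpha>_pos \<gamma>_gt_1 by (simp add: L_def)
  have "(\<lambda>d. \<alpha> * W d / (P (Suc d) / real d powr (\<alpha> * (\<gamma> - 1)) * (k d / c d / real d)) / L) \<longlonglongrightarrow> L / L"
    unfolding L_def using L \<Theta> w \<gamma>_gt_1 \<alpha>_pos by (intro tendsto_intros kappa_lim) auto
  then have "(\<lambda>d. \<alpha> * W d / (P (Suc d) / real d powr (\<alpha> * (\<gamma> - 1)) * (k d / c d / real d)) / L) \<longlonglongrightarrow> 1"
    using L by simp
  then have "(\<lambda>d. x d / (L * real d powr (- (\<alpha> * (\<gamma> - 1) + 1)))) \<longlonglongrightarrow> 1"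
  proof (rule Lim_transform_eventually)
    show "\<forall>\<^sub>F d in sequentially. \<alpha> * W d / (P (Suc d) / real d powr (\<alpha> * (\<gamma> - 1)) * (k d / c d / real d)) / L
        = x d / (L * real d powr (- (\<alpha> * (\<gamma> - 1) + 1)))"
      using eventually_gt_at_top[of 0]
    proof eventually_elim
      case (elim d)
      have "real d powr (- (\<alpha> * (\<gamma> - 1) + 1)) = 1 / (real d powr (\<alpha> * (\<gamma> - 1)) * real d)"
        using elim by (subst powr_minus) (simp add: powr_add inverse_eq_divide)
      then show ?case
        by (simp add: x_def)
    qed
  qed
  then have "asymp_equiv x sequentially (\<lambda>d. L * real d powr (- (\<alpha> * (\<gamma> - 1) + 1)))"
    by (rule asymp_equivI')
  then show ?thesis
    using L by blast
qed

end

section \<open>From compensated sums to limits\<close>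

text \<open>For a sum of known size, the strong law is solved for its compensator: with
  \<open>\<epsilon>\<close> the quotient in \<open>lim\<close>,
  \<open>H = (U - \<epsilon> * \<beta>) / (1 + \<epsilon>)\<close>.\<close>

lemma compensator_ratio:
  fixes U H \<beta> s :: "nat \<Rightarrow> real"
  assumes lim: "(\<lambda>n. (U n - H n) / (\<beta> n + H n)) \<longlonglongrightarrow> 0"
    and U: "(\<lambda>n. U n / s n) \<longlonglongrightarrow> u" and \<beta>: "(\<lambda>n. \<beta> n / s n) \<longlonglongrightarrow> 0"
    and pos: "\<And>n. 0 < \<beta> n" "\<And>n. 0 \<le> H n"
  shows "(\<lambda>n. H n / s n) \<longlonglongrightarrow> u"
proof -
  define \<epsilon> where "\<epsilon> n = (U n - H n) / (\<beta> n + H n)" for n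
  have \<epsilon>: "\<epsilon> \<longlonglongrightarrow> 0"
    using lim by (simp add: \<epsilon>_def[abs_def])
  have "(\<lambda>n. (U n / s n - \<epsilon> n * (\<beta> n / s n)) / (1 + \<epsilon> n)) \<longlonglongrightarrow> (u - 0 * 0) / (1 + 0)"
    by (intro tendsto_divide tendsto_diff tendsto_mult tendsto_add tendsto_const U \<beta> \<epsilon>) simp
  then have "(\<lambda>n. (U n / s n - \<epsilon> n * (\<beta> n / s n)) / (1 + \<epsilon> n)) \<longlonglongrightarrow> u"
    by simp
  moreover have "\<forall>\<^sub>F n in sequentially. - 1 < \<epsilon> n"
    using \<epsilon> by (rule order_tendstoD) simp
  then have "\<forall>\<^sub>F n in sequentially. (U n / s n - \<epsilon> n * (\<beta> n / s n)) / (1 + \<epsilon> n) = H n / s n"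
  proof eventually_elim
    case (elim n)
    have "0 < \<beta> n + H n"
      using pos[of n] by (simp add: add_pos_nonneg)
    then have "\<epsilon> n * (\<beta> n + H n) = U n - H n"
      by (simp add: \<epsilon>_def)
    then have "U n - \<epsilon> n * \<beta> n = H n * (1 + \<epsilon> n)"
      by (simp add: algebra_simps)
    moreover have "U n / s n - \<epsilon> n * (\<beta> n / s n) = (U n - \<epsilon> n * \<beta> n) / s n"
      by (simp add: diff_divide_distrib)
    ultimately show ?case
      using elim by simp
  qed
  ultimately show ?thesis
    by (rule Lim_transform_eventually)
qed

text \<open>The opposite situation: nothing is known about the sum \<open>U\<close>, but the
  compensator has a majorant \<open>V\<close> of order \<open>s\<close>, which bounds the
  denominator in the strong law.\<close>

lemma compensated_smallo:
  fixes U H \<beta> s V :: "nat \<Rightarrow> real"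
  assumes lim: "(\<lambda>n. (U n - H n) / (\<beta> n + H n)) \<longlonglongrightarrow> 0"
    and V: "(\<lambda>n. V n / s n) \<longlonglongrightarrow> v" and \<beta>: "(\<lambda>n. \<beta> n / s n) \<longlonglongrightarrow> 0"
    and pos: "\<And>n. 0 < \<beta> n" "\<And>n. 0 \<le> H n" "\<And>n. H n \<le> V n" "\<And>n. 0 \<le> s n"
  shows "(\<lambda>n. (U n - H n) / s n) \<longlonglongrightarrow> 0"
proof -
  have "(\<lambda>n. \<bar>(U n - H n) / (\<beta> n + H n)\<bar> * (\<beta> n / s n + V n / s n)) \<longlonglongrightarrow> \<bar>0\<bar> * (0 + v)"
    by (intro tendsto_intros lim V \<beta>)
  then have null: "(\<lambda>n. \<bar>(U n - H n) / (\<beta> n + H n)\<bar> * (\<beta> n / s n + V n / s n)) \<longlonglongrightarrow> 0"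
    by simp
  have "norm ((U n - H n) / s n) \<le> \<bar>(U n - H n) / (\<beta> n + H n)\<bar> * (\<beta> n / s n + V n / s n)" for n
  proof -
    define G where "G = \<beta> n + H n"
    have "0 < G"
      using pos(1,2)[of n] by (simp add: G_def add_pos_nonneg)
    then have "(U n - H n) / s n = (U n - H n) / G * (G / s n)"
      by simp
    then have "norm ((U n - H n) / s n) = \<bar>(U n - H n) / G\<bar> * (G / s n)"
      using pos(4)[of n] \<open>0 < G\<close> by (simp only: real_norm_def abs_mult abs_of_nonneg divide_nonneg_nonneg less_imp_le)
    also have "\<dots> \<le> \<bar>(U n - H n) / G\<bar> * (\<beta> n / s n + V n / s n)"
      unfolding add_divide_distrib[symmetric] using pos(3,4)[of n]
      by (intro mult_left_mono divide_right_mono) (auto simp: G_def)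
    finally show ?thesis
      by (simp add: G_def)
  qed
  then show ?thesis
    by (intro Lim_null_comparison[OF always_eventually null] allI)
qed

text \<open>A detour through the compensators, where alone the proportion \<open>q\<close> is given:
  from the sum \<open>U\<close> to \<open>A\<close>, from \<open>A\<close> to \<open>Hd\<close> by
  the proportion, and from \<open>Hd\<close> back to the sum \<open>Ud\<close>.\<close>

lemma compensated_proportion:
  fixes U A Ud Hd \<beta> s r :: "nat \<Rightarrow> real"
  assumes A: "(\<lambda>n. (U n - A n) / (\<beta> n + A n)) \<longlonglongrightarrow> 0" and U: "(\<lambda>n. U n / s n) \<longlonglongrightarrow> 1"
    and Hd: "(\<lambda>n. (Ud n - Hd n) / (\<beta> n + Hd n)) \<longlonglongrightarrow> 0"
    and prop_eq: "\<forall>\<^sub>F n in sequentially. Hd n = (q + r n) * A n" and r: "r \<longlonglongrightarrow> 0"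
    and \<beta>: "(\<lambda>n. \<beta> n / s n) \<longlonglongrightarrow> 0" "\<And>n. 0 < \<beta> n"
    and nonneg: "\<And>n. 0 \<le> A n" "\<And>n. 0 \<le> Hd n" "\<And>n. 0 \<le> s n"
  shows "(\<lambda>n. Ud n / s n) \<longlonglongrightarrow> q"
proof -
  have "(\<lambda>n. A n / s n) \<longlonglongrightarrow> 1"
    using A U \<beta> nonneg(1) by (rule compensator_ratio)
  then have "(\<lambda>n. (q + r n) * (A n / s n)) \<longlonglongrightarrow> (q + 0) * 1"
    by (intro tendsto_mult tendsto_add tendsto_const r)
  then have "(\<lambda>n. (q + r n) * (A n / s n)) \<longlonglongrightarrow> q"
    by simp
  then have H: "(\<lambda>n. Hd n / s n) \<longlonglongrightarrow> q"
  proof (rule Lim_transform_eventually)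
    show "\<forall>\<^sub>F n in sequentially. (q + r n) * (A n / s n) = Hd n / s n"
      using prop_eq by eventually_elim simp
  qed
  have "(\<lambda>n. (Ud n - Hd n) / s n) \<longlonglongrightarrow> 0"
    by (rule compensated_smallo[OF Hd H \<beta> nonneg(2) order_refl nonneg(3)])
  then have "(\<lambda>n. (Ud n - Hd n) / s n + Hd n / s n) \<longlonglongrightarrow> 0 + q"
    by (intro tendsto_add H)
  then show ?thesis
    by (simp add: diff_divide_distrib)
qed

lemma tendsto_of_bounded_numerator_diff:
  fixes f g s :: "nat \<Rightarrow> real"
  assumes bound: "\<And>n. \<bar>f n - g n\<bar> \<le> B" and g: "(\<lambda>n. g n / s n) \<longlonglongrightarrow> L"
    and s: "filterlim s at_top sequentially"
  shows "(\<lambda>n. f n / s n) \<longlonglongrightarrow> L"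
proof -
  have "(\<lambda>n. B / s n) \<longlonglongrightarrow> 0"
    by (rule real_tendsto_divide_at_top[OF tendsto_const s])
  moreover have "\<forall>\<^sub>F n in sequentially. 0 < s n"
    using s by (auto simp: filterlim_at_top_dense)
  then have "\<forall>\<^sub>F n in sequentially. norm ((f n - g n) / s n) \<le> B / s n"
  proof eventually_elim
    case (elim n)
    then show ?case
      using bound[of n] by (simp add: abs_divide divide_right_mono)
  qed
  ultimately have "(\<lambda>n. (f n - g n) / s n) \<longlonglongrightarrow> 0"
    by (rule Lim_null_comparison[rotated])
  then have "(\<lambda>n. (f n - g n) / s n + g n / s n) \<longlonglongrightarrow> 0 + L"
    by (intro tendsto_add g)
  then show ?thesis
    by (simp add: diff_divide_distrib)
qed

context degree_recursion
begin

text \<open>Here \<open>X\<close> and \<open>Xs\<close> count all and selected vertices of degree \<open>d\<close>, \<open>Y\<close> and \<open>Ys\<close> those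
  among them that receive an edge in the next step, and \<open>y\<close> and \<open>ys\<close> are the compensators. By
  induction on \<open>d\<close>, the error \<open>w n = Xs n d - x d * s n\<close> solves a discrete Volterra equation
  whose right-hand side is \<open>o(s n)\<close> precisely by \<open>x_balance\<close>.\<close>

lemma selected_fraction_limit:
  fixes s \<beta> :: "nat \<Rightarrow> real" and X Y y Xs Ys ys :: "nat \<Rightarrow> nat \<Rightarrow> real"
  assumes s: "incseq s" "\<And>n. 0 \<le> s n" "filterlim s at_top sequentially"
    and ratio: "\<And>\<theta>. 0 < \<theta> \<Longrightarrow> \<theta> < 1 \<Longrightarrow> (\<lambda>n. s (nat \<lfloor>\<theta> * real n\<rfloor>) / s n) \<longlonglongrightarrow> \<theta> powr \<alpha>"
    and \<beta>: "\<And>n. 0 < \<beta> n" "(\<lambda>n. \<beta> n / s n) \<longlonglongrightarrow> 0" "(\<lambda>n. \<beta> n / real n) \<longlonglongrightarrow> 0"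
    and X: "\<And>d. m \<le> d \<Longrightarrow> (\<lambda>n. X n d / real n) \<longlonglongrightarrow> c d"
    and Y: "\<And>d. m \<le> d \<Longrightarrow> (\<lambda>n. (\<Sum>i<n. Y i d) / real n) \<longlonglongrightarrow> k d"
    and y: "\<And>i d. m \<le> d \<Longrightarrow> 0 \<le> y i d \<and> y i d \<le> X i d"
    and comp: "\<And>d. m \<le> d \<Longrightarrow> (\<lambda>n. (\<Sum>i<n. Y i d - y i d) / (\<beta> n + (\<Sum>i<n. y i d))) \<longlonglongrightarrow> 0"
    and Xs: "\<And>i d. m \<le> d \<Longrightarrow> 0 \<le> Xs i d \<and> Xs i d \<le> s i"
    and ys: "\<And>i d. m \<le> d \<Longrightarrow> ys i d = Xs i d * (y i d / X i d)"
    and comps: "\<And>d. m \<le> d \<Longrightarrow> (\<lambda>n. (\<Sum>i<n. Ys i d - ys i d) / (\<beta> n + (\<Sum>i<n. ys i d))) \<longlonglongrightarrow> 0"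
    and balance: "\<And>d. m \<le> d \<Longrightarrow>
      (\<lambda>n. ((\<Sum>i<n. Ys i d) + (\<Sum>j=m..d. Xs n j)) / s n) \<longlonglongrightarrow> (\<Sum>j=m..d. q j)"
    and d: "m \<le> d"
  shows "(\<lambda>n. Xs n d / s n) \<longlonglongrightarrow> x d"
  using d
proof (induction d rule: less_induct)
  case (less d)
  \<comment> \<open>Where \<open>X i d\<close> is 0, so is \<open>y i d\<close>, and division by
    zero yields \<open>e i = 0\<close>; hence \<open>e i\<close> lies in the unit interval for every
    \<open>i\<close>.\<close>
  define e where "e i = y i d / X i d" for i
  define \<kappa> where "\<kappa> = k d / c d"
  have s_pos: "\<forall>\<^sub>F n in sequentially. 0 < s n"
    using s(3) by (auto simp: filterlim_at_top_dense)
  have cd: "0 < c d"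
    using c_pos less.prems .
  have y0: "0 \<le> y i d" and yX: "y i d \<le> X i d" for i
    using y[OF less.prems] by auto
  have e0: "0 \<le> e i" and e1: "e i \<le> 1" for i
    using y0[of i] yX[of i] by (auto simp: e_def divide_le_eq_1)
  have y_mean: "(\<lambda>n. (\<Sum>i<n. y i d) / real n) \<longlonglongrightarrow> k d"
    using comp[OF less.prems] unfolding sum_subtractf
    by (rule compensator_ratio[OF _ Y[OF less.prems] \<beta>(3,1)]) (intro sum_nonneg y0)
  \<comment> \<open>Here \<open>i * e i\<close> is \<open>y i d\<close> times
    \<open>i / X i d\<close>. The second factor converges to \<open>1 / c d\<close>, so the
    averaging lemma may replace it by its limit under the mean.\<close>
  have e_mean: "(\<lambda>n. (\<Sum>i<n. real i * e i) / real n) \<longlonglongrightarrow> \<kappa>"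
  proof -
    have "(\<lambda>i. inverse (X i d / real i) - inverse (c d)) \<longlonglongrightarrow> inverse (c d) - inverse (c d)"
      using cd by (intro tendsto_diff tendsto_inverse X less.prems tendsto_const) simp
    then have t: "(\<lambda>i. real i / X i d - inverse (c d)) \<longlonglongrightarrow> 0"
      by simp
    have "\<forall>\<^sub>F n in sequentially. (\<Sum>i<n. y i d) / real n < k d + 1"
      using y_mean by (rule order_tendstoD) simp
    then have "\<forall>\<^sub>F n in sequentially. (\<Sum>i<n. y i d) \<le> (k d + 1) * real n"
      using eventually_gt_at_top[of 0] by eventually_elim (simp add: field_simps)
    then have "(\<lambda>n. (\<Sum>i<n. (real i / X i d - inverse (c d)) * y i d) / real n) \<longlonglongrightarrow> 0"
      by (intro weighted_cesaro[OF t y0] filterlim_real_sequentially)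
    then have "(\<lambda>n. inverse (c d) * ((\<Sum>i<n. y i d) / real n)
        + (\<Sum>i<n. (real i / X i d - inverse (c d)) * y i d) / real n) \<longlonglongrightarrow> inverse (c d) * k d + 0"
      by (intro tendsto_add tendsto_mult tendsto_const y_mean)
    moreover have "inverse (c d) * ((\<Sum>i<n. y i d) / real n)
        + (\<Sum>i<n. (real i / X i d - inverse (c d)) * y i d) / real n = (\<Sum>i<n. real i * e i) / real n" for n
    proof -
      have sums: "inverse (c d) * (\<Sum>i<n. y i d) + (\<Sum>i<n. (real i / X i d - inverse (c d)) * y i d)
          = (\<Sum>i<n. real i * e i)"
        unfolding sum_distrib_left sum.distrib[symmetric]
        by (intro sum.cong) (auto simp: e_def algebra_simps)
      then show ?thesis
        unfolding sums[symmetric] by (simp add: add_divide_distrib)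
    qed
    ultimately show ?thesis
      by (simp add: \<kappa>_def field_simps)
  qed
  have V: "(\<lambda>n. (\<Sum>i<n. s i * e i) / s n) \<longlonglongrightarrow> \<kappa> / \<alpha>"
    by (rule karamata_weighted_sum[OF s(1,2) s_pos ratio \<alpha>_pos e0 e_mean])
  have ys_e: "ys i d = Xs i d * e i" for i
    using ys[OF less.prems] by (simp add: e_def)
  have Xs0: "0 \<le> Xs i d" and Xs_s: "Xs i d \<le> s i" for i
    using Xs[OF less.prems] by auto
  have H0: "0 \<le> (\<Sum>i<n. ys i d)" for n
    unfolding ys_e by (intro sum_nonneg mult_nonneg_nonneg Xs0 e0)
  have HV: "(\<Sum>i<n. ys i d) \<le> (\<Sum>i<n. s i * e i)" for n
    unfolding ys_e by (intro sum_mono mult_right_mono Xs_s e0)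
  have "(\<lambda>n. ((\<Sum>i<n. Ys i d) - (\<Sum>i<n. ys i d)) / s n) \<longlonglongrightarrow> 0"
    using comps[OF less.prems] unfolding sum_subtractf
    by (rule compensated_smallo[OF _ V \<beta>(2) \<beta>(1) H0 HV s(2)])
  then have lim1: "(\<lambda>n. ((\<Sum>i<n. Ys i d) + (\<Sum>j=m..d. Xs n j)) / s n
      - ((\<Sum>i<n. Ys i d) - (\<Sum>i<n. ys i d)) / s n) \<longlonglongrightarrow> (\<Sum>j=m..d. q j) - 0"
    by (intro tendsto_diff balance less.prems)
  have lim2: "(\<lambda>n. \<Sum>j\<in>{m..<d}. Xs n j / s n) \<longlonglongrightarrow> (\<Sum>j\<in>{m..<d}. x j)"
    by (intro tendsto_sum less.IH) auto
  have "(\<lambda>n. ((\<Sum>i<n. Ys i d) + (\<Sum>j=m..d. Xs n j)) / s n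
      - ((\<Sum>i<n. Ys i d) - (\<Sum>i<n. ys i d)) / s n - (\<Sum>j\<in>{m..<d}. Xs n j / s n)
      - x d * 1 - x d * ((\<Sum>i<n. s i * e i) / s n))
      \<longlonglongrightarrow> (\<Sum>j=m..d. q j) - 0 - (\<Sum>j\<in>{m..<d}. x j) - x d * 1 - x d * (\<kappa> / \<alpha>)"
    by (rule tendsto_diff[OF tendsto_diff[OF tendsto_diff[OF lim1 lim2] tendsto_const]
        tendsto_mult[OF tendsto_const V]])
  moreover have split: "(\<Sum>j=m..d. f j) = (\<Sum>j\<in>{m..<d}. f j) + f d" for f :: "nat \<Rightarrow> real"
    using sum.last_plus[OF less.prems, of f] by simp
  moreover have "(\<Sum>j=m..d. q j) - 0 - (\<Sum>j\<in>{m..<d}. x j) - x d * 1 - x d * (\<kappa> / \<alpha>) = 0"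
    using x_balance[OF less.prems] \<alpha>_pos unfolding split[of x] \<kappa>_def[symmetric]
    by (simp add: field_simps)
  ultimately have rlim: "(\<lambda>n. ((\<Sum>i<n. Ys i d) + (\<Sum>j=m..d. Xs n j)) / s n
      - ((\<Sum>i<n. Ys i d) - (\<Sum>i<n. ys i d)) / s n - (\<Sum>j\<in>{m..<d}. Xs n j / s n)
      - x d * 1 - x d * ((\<Sum>i<n. s i * e i) / s n)) \<longlonglongrightarrow> 0"
    by simp
  define w where "w n = Xs n d - x d * s n" for n
  define r where "r n = w n + (\<Sum>i<n. w i * e i)" for n
  have "(\<lambda>n. r n / s n) \<longlonglongrightarrow> 0"
    using rlim
  proof (rule Lim_transform_eventually)
    show "\<forall>\<^sub>F n in sequentially. ((\<Sum>i<n. Ys i d) + (\<Sum>j=m..d. Xs n j)) / s n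
      - ((\<Sum>i<n. Ys i d) - (\<Sum>i<n. ys i d)) / s n - (\<Sum>j\<in>{m..<d}. Xs n j / s n)
      - x d * 1 - x d * ((\<Sum>i<n. s i * e i) / s n) = r n / s n"
      using s_pos
    proof eventually_elim
      case (elim n)
      have alg: "(U + (R + Z)) / t - (U - H) / t - R / t - z * 1 - z * (V / t) = (H + Z - z * t - z * V) / t"
        if "0 < t" for U R Z H V t z :: real
        using that by (simp add: field_simps)
      have "r n = (\<Sum>i<n. ys i d) + Xs n d - x d * s n - x d * (\<Sum>i<n. s i * e i)"
        unfolding r_def w_def ys_e
        by (simp add: left_diff_distrib sum_subtractf sum_distrib_left mult.assoc)
      then show ?case
        unfolding split[of "Xs n"] sum_divide_distrib[symmetric] alg[OF elim] by simp
    qed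
  qed
  then have "(\<lambda>n. w n / s n) \<longlonglongrightarrow> 0"
    by (intro volterra_smallo[OF s(1,3), where e = e and w = w and r = r]) (auto simp: e0 e1 r_def)
  then have "(\<lambda>n. w n / s n + x d) \<longlonglongrightarrow> 0 + x d"
    by (intro tendsto_add tendsto_const)
  then have "(\<lambda>n. w n / s n + x d) \<longlonglongrightarrow> x d"
    by simp
  then show ?case
  proof (rule Lim_transform_eventually)
    show "\<forall>\<^sub>F n in sequentially. w n / s n + x d = Xs n d / s n"
      using s_pos by eventually_elim (simp add: w_def diff_divide_distrib)
  qed
qed

end

lemma slowly_varying_powr_ratio:
  fixes s \<zeta> :: "nat \<Rightarrow> real"
  assumes sv: "slowly_varying \<zeta>" and \<zeta>: "\<And>n. 0 < \<zeta> n" and \<theta>: "0 < \<theta>"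
    and s: "asymp_equiv s sequentially (\<lambda>n. \<zeta> n * real n powr \<alpha>)"
  shows "(\<lambda>n. s (nat \<lfloor>\<theta> * real n\<rfloor>) / s n) \<longlonglongrightarrow> \<theta> powr \<alpha>"
proof -
  define f where "f n = nat \<lfloor>\<theta> * real n\<rfloor>" for n
  define g where "g n = \<zeta> n * real n powr \<alpha>" for n
  have f_top: "filterlim f at_top sequentially"
    unfolding f_def using \<theta> by (rule nat_floor_mult_at_top)
  have g_pos: "\<forall>\<^sub>F n in sequentially. 0 < g n"
    using eventually_gt_at_top[of 0] by eventually_elim (use \<zeta> in \<open>simp add: g_def\<close>)
  then have "\<forall>\<^sub>F n in sequentially. s n \<noteq> 0 \<or> g n \<noteq> 0"
    by eventually_elim simp
  then have sg: "(\<lambda>n. s n / g n) \<longlonglongrightarrow> 1"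
    unfolding g_def by (rule asymp_equivD_strong[OF s])
  have f_ratio: "(\<lambda>n. real (f n) / real n) \<longlonglongrightarrow> \<theta>"
    unfolding f_def using \<theta> by (rule nat_floor_mult_ratio)
  have "(\<lambda>n. s (f n) / g (f n) * (\<zeta> (f n) / \<zeta> n) * (real (f n) / real n) powr \<alpha> / (s n / g n))
      \<longlonglongrightarrow> 1 * 1 * \<theta> powr \<alpha> / 1"
  proof (intro tendsto_divide tendsto_mult sg)
    show "(\<lambda>n. s (f n) / g (f n)) \<longlonglongrightarrow> 1"
      using sg f_top by (rule filterlim_compose)
    show "(\<lambda>n. \<zeta> (f n) / \<zeta> n) \<longlonglongrightarrow> 1"
      using sv \<theta> by (simp add: slowly_varying_def f_def)
    show "(\<lambda>n. (real (f n) / real n) powr \<alpha>) \<longlonglongrightarrow> \<theta> powr \<alpha>"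
      using \<theta> by (intro tendsto_powr f_ratio tendsto_const) simp
  qed simp
  then have "(\<lambda>n. s (f n) / g (f n) * (\<zeta> (f n) / \<zeta> n) * (real (f n) / real n) powr \<alpha> / (s n / g n))
      \<longlonglongrightarrow> \<theta> powr \<alpha>"
    by simp
  moreover have "\<forall>\<^sub>F n in sequentially. 0 < f n"
    using eventually_gt_at_top f_top by (rule eventually_compose_filterlim)
  then have "\<forall>\<^sub>F n in sequentially. s (f n) / g (f n) * (\<zeta> (f n) / \<zeta> n) * (real (f n) / real n) powr \<alpha> / (s n / g n)
      = s (f n) / s n"
    using eventually_gt_at_top[of 0]
  proof eventually_elim
    case (elim n)
    have cancel: "a / (z * u) * (z / y) * (u / v) / (b / (y * v)) = a / b"
      if "0 < z" "0 < u" "0 < y" "0 < v" for a b z u y v :: real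
      using that by (cases "b = 0") (simp_all add: field_simps)
    have "(real (f n) / real n) powr \<alpha> = real (f n) powr \<alpha> / real n powr \<alpha>"
      by (simp add: powr_divide)
    moreover have "0 < real n powr \<alpha>" "0 < real (f n) powr \<alpha>"
      using elim by auto
    ultimately show ?case
      unfolding g_def using \<zeta>[of n] \<zeta>[of "f n"] by (simp only: cancel)
  qed
  ultimately show ?thesis
    unfolding f_def[symmetric] by (rule Lim_transform_eventually)
qed

section \<open>The graph process\<close>

lemma card_Collect_eq_sum: "finite A \<Longrightarrow> real (card {v \<in> A. P v}) = (\<Sum>v\<in>A. of_bool (P v))"
  by (simp add: of_bool_def sum.If_cases Int_def)

lemma of_bool_le_split:
  fixes d m j :: nat
  assumes "m \<le> d"
  shows "(of_bool (j \<le> d) :: real) = of_bool (j < m) + (\<Sum>i=m..d. of_bool (j = i))"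
  using assms by (auto simp: of_bool_def sum.delta)

lemma finite_verts [simp]: "finite (verts l n)"
  by (simp add: verts_def)

lemma verts_Suc: "verts l (Suc n) = insert (New (Suc n)) (verts l n)"
  by (auto simp: verts_def atLeastAtMostSuc_conv)

lemma New_Suc_notin_verts: "New (Suc n) \<notin> verts l n"
  by (auto simp: verts_def)

lemma geometric_block_le:
  fixes r :: real
  assumes "0 < r" "r < 1"
  shows "(\<Sum>j\<in>{a..<b}. r ^ j) \<le> r ^ a / (1 - r)"
proof (cases "a \<le> b")
  case True
  then have "(\<Sum>j\<in>{a..<b}. r ^ j) = (r ^ a - r ^ b) / (1 - r)"
    using assms by (simp add: sum_gp_strict sum_diff_nat_ivl[of 0 a b "\<lambda>j. r ^ j", symmetric]
      atLeast0LessThan diff_divide_distrib[symmetric])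
  also have "\<dots> \<le> r ^ a / (1 - r)"
    using assms by (intro divide_right_mono) auto
  finally show ?thesis .
qed (use assms in auto)

lemma pmf_tail_le:
  fixes Z :: "nat pmf"
  assumes le: "\<And>j. 1 \<le> j \<Longrightarrow> pmf Z j \<le> C * r ^ j" and r: "0 < r" "r < 1" and j: "1 \<le> j"
  shows "measure_pmf.prob Z {j..} \<le> C / (1 - r) * r ^ j"
proof -
  have "(\<lambda>i. measure_pmf.prob Z {j + i}) sums measure_pmf.prob Z (\<Union>i. {j + i})"
    by (rule measure_pmf.finite_measure_UNION) (auto simp: disjoint_family_on_def)
  moreover have "(\<Union>i. {j + i}) = {j..}"
    by (auto simp: le_iff_add)
  ultimately have "(\<lambda>i. pmf Z (j + i)) sums measure_pmf.prob Z {j..}"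
    by (simp add: measure_pmf_single)
  moreover have "(\<lambda>i. C * r ^ j * r ^ i) sums (C * r ^ j * (1 / (1 - r)))"
    using r by (intro sums_mult geometric_sums) simp
  moreover have "pmf Z (j + i) \<le> C * r ^ j * r ^ i" for i
    using le[of "j + i"] j by (simp add: power_add mult.assoc)
  ultimately have "measure_pmf.prob Z {j..} \<le> C * r ^ j * (1 / (1 - r))"
    by (meson sums_le)
  then show ?thesis
    by simp
qed

lemma summable_powr_stretched:
  fixes r \<delta> :: real
  assumes "0 < r" "r < 1" "0 < \<delta>"
  shows "summable (\<lambda>i. r powr ((real i + 1) powr \<delta>))"
proof -
  have "(\<lambda>i. r powr ((real i + 1) powr \<delta>) * real i ^ 2) \<longlonglongrightarrow> 0"
    using assms by real_asymp
  then have "\<forall>\<^sub>F i in sequentially. r powr ((real i + 1) powr \<delta>) * real i ^ 2 < 1"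
    by (rule order_tendstoD) simp
  then have "\<forall>\<^sub>F i in sequentially. norm (r powr ((real i + 1) powr \<delta>)) \<le> inverse (real i ^ 2)"
    using eventually_gt_at_top[of 0] by eventually_elim (simp add: field_simps)
  moreover have "summable (\<lambda>i. inverse (real i ^ 2))"
    by (rule inverse_power_summable) simp
  ultimately show ?thesis
    by (rule summable_comparison_test_ev)
qed

locale monotone_selection = selected_graph_process M l m E0 S0 E S
  for M :: "'w measure" and l m E0 S0 E S +
  assumes S_mono: "\<And>n w. w \<in> space M \<Longrightarrow> S n w \<subseteq> S (Suc n) w"
begin

abbreviation \<F> :: "nat \<Rightarrow> 'w measure" where "\<F> \<equiv> F_sigma M E S"

abbreviation cexp :: "nat \<Rightarrow> ('w \<Rightarrow> real) \<Rightarrow> 'w \<Rightarrow> real" where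
  "cexp n \<equiv> real_cond_exp M (\<F> n)"

section \<open>Balance of degree counts along one path\<close>

lemma finite_E: "w \<in> space M \<Longrightarrow> finite (E n w)"
proof -
  assume "w \<in> space M"
  then have "E n w \<subseteq> Pow (verts l n)"
    using E_simple[of w n] by (auto simp: simple_graph_def)
  then show ?thesis
    by (rule finite_subset) simp
qed

text \<open>Every edge added in this step contains the newcomer and has only two ends, so an old
  vertex can gain at most the one edge joining it to the newcomer.\<close>

lemma deg_Suc:
  assumes w: "w \<in> space M" and v: "v \<in> verts l n"
  shows "deg (E (Suc n) w) v = deg (E n w) v + of_bool ({v, New (Suc n)} \<in> E (Suc n) w)"
proof -
  let ?e = "{v, New (Suc n)}"
  have notin: "?e \<notin> E n w"
    using E_simple[OF w, of n] New_Suc_notin_verts[of n l] by (auto simp: simple_graph_def doubleton_eq_iff)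
  have new: "f = ?e" if f: "f \<in> E (Suc n) w" "f \<notin> E n w" "v \<in> f" for f
  proof -
    have "New (Suc n) \<in> f"
      using E_new[OF w, of f n] f by simp
    moreover obtain a b where "f = {a, b}"
      using E_simple[OF w, of "Suc n"] f(1) unfolding simple_graph_def by blast
    moreover have "v \<noteq> New (Suc n)"
      using v New_Suc_notin_verts by metis
    ultimately show ?thesis
      using f(3) by auto
  qed
  have "{f \<in> E (Suc n) w. v \<in> f} = {f \<in> E n w. v \<in> f} \<union> (if ?e \<in> E (Suc n) w then {?e} else {})"
    using E_mono[OF w, of n] new by auto
  then have "deg (E (Suc n) w) v = card ({f \<in> E n w. v \<in> f} \<union> (if ?e \<in> E (Suc n) w then {?e} else {}))"
    by (simp add: deg_def)
  also have "\<dots> = card {f \<in> E n w. v \<in> f} + card (if ?e \<in> E (Suc n) w then {?e} else {})"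
    using notin finite_E[OF w] by (intro card_Un_disjoint) auto
  finally show ?thesis
    by (simp add: deg_def)
qed

text \<open>The counting identities and conditional expectations are needed both for the set of all
  vertices and for \<open>S\<close>; the following predicate covers the two.\<close>

definition vertex_process :: "(nat \<Rightarrow> 'w \<Rightarrow> vertex set) \<Rightarrow> bool" where
  "vertex_process A \<longleftrightarrow> (\<forall>n. \<exists>g. \<forall>w\<in>space M. A n w = g (S n w)) \<and>
    (\<forall>n. \<forall>w\<in>space M. A n w \<subseteq> verts l n \<and> A n w \<subseteq> A (Suc n) w \<and> A (Suc n) w \<subseteq> insert (New (Suc n)) (A n w))"

lemma vertex_process_S: "vertex_process S"
proof -
  have "\<exists>g. \<forall>w\<in>space M. S n w = g (S n w)" for n
    by (rule exI[of _ "\<lambda>s. s"]) simp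
  then show ?thesis
    unfolding vertex_process_def using S_verts S_mono S_new by simp
qed

lemma vertex_process_verts: "vertex_process (\<lambda>n _. verts l n)"
  by (auto simp: vertex_process_def verts_Suc)

lemma vertex_processD:
  assumes "vertex_process A" "w \<in> space M"
  shows "A n w \<subseteq> verts l n" "finite (A n w)" "A n w \<subseteq> A (Suc n) w"
    "A (Suc n) w \<subseteq> insert (New (Suc n)) (A n w)" "New (Suc n) \<notin> A n w"
proof -
  show sub: "A n w \<subseteq> verts l n" "A n w \<subseteq> A (Suc n) w" "A (Suc n) w \<subseteq> insert (New (Suc n)) (A n w)"
    using assms by (auto simp: vertex_process_def)
  show "finite (A n w)"
    using sub(1) by (rule finite_subset) simp
  show "New (Suc n) \<notin> A n w"
    using sub(1) New_Suc_notin_verts by blast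
qed

definition degree_count :: "(nat \<Rightarrow> 'w \<Rightarrow> vertex set) \<Rightarrow> nat \<Rightarrow> nat \<Rightarrow> 'w \<Rightarrow> real" where
  "degree_count A n d w = real (card {v \<in> A n w. deg (E n w) v = d})"

definition receiving_count :: "(nat \<Rightarrow> 'w \<Rightarrow> vertex set) \<Rightarrow> nat \<Rightarrow> nat \<Rightarrow> 'w \<Rightarrow> real" where
  "receiving_count A n d w = real (card {v \<in> A n w. deg (E n w) v = d \<and> {v, New (Suc n)} \<in> E (Suc n) w})"

definition newcomer :: "(nat \<Rightarrow> 'w \<Rightarrow> vertex set) \<Rightarrow> nat \<Rightarrow> nat \<Rightarrow> 'w \<Rightarrow> real" where
  "newcomer A n d w = of_bool (New n \<in> A n w \<and> deg (E n w) (New n) = d)"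

text \<open>Counting degrees up to \<open>d\<close> instead of equal to \<open>d\<close> leaves a
  single flow: an old vertex never enters this class, and it leaves exactly when its degree is
  \<open>d\<close> and it receives an edge.\<close>

lemma count_le_step:
  assumes A: "vertex_process A" and w: "w \<in> space M"
  shows "real (card {v \<in> A (Suc n) w. deg (E (Suc n) w) v \<le> d}) + receiving_count A n d w
    = real (card {v \<in> A n w. deg (E n w) v \<le> d})
      + of_bool (New (Suc n) \<in> A (Suc n) w \<and> deg (E (Suc n) w) (New (Suc n)) \<le> d)"
proof -
  note A' = vertex_processD[OF A w, of n]
  let ?N = "New (Suc n)"
  have old: "of_bool (deg (E (Suc n) w) v \<le> d) + of_bool (deg (E n w) v = d \<and> {v, ?N} \<in> E (Suc n) w)
      = (of_bool (deg (E n w) v \<le> d) :: real)" if "v \<in> A n w" for v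
  proof -
    have "v \<in> verts l n"
      using A'(1) that by blast
    then show ?thesis
      using deg_Suc[OF w, of v n] by (auto simp: of_bool_def)
  qed
  have "(\<Sum>v\<in>A (Suc n) w. of_bool (deg (E (Suc n) w) v \<le> d))
      = (\<Sum>v\<in>A n w. of_bool (deg (E (Suc n) w) v \<le> d))
        + (of_bool (?N \<in> A (Suc n) w \<and> deg (E (Suc n) w) ?N \<le> d) :: real)"
  proof (cases "?N \<in> A (Suc n) w")
    case True
    then have "A (Suc n) w = insert ?N (A n w)"
      using A' by blast
    then show ?thesis
      using A' by simp
  next
    case False
    then have "A (Suc n) w = A n w"
      using A' by blast
    then show ?thesis
      using False by simp
  qed
  moreover have "(\<Sum>v\<in>A n w. of_bool (deg (E n w) v \<le> d)) = (\<Sum>v\<in>A n w. of_bool (deg (E (Suc n) w) v \<le> d))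
      + (\<Sum>v\<in>A n w. of_bool (deg (E n w) v = d \<and> {v, ?N} \<in> E (Suc n) w) :: real)"
    unfolding sum.distrib[symmetric] by (rule sum.cong) (simp_all only: old)
  ultimately show ?thesis
    unfolding receiving_count_def card_Collect_eq_sum[OF A'(2)] card_Collect_eq_sum[OF vertex_processD(2)[OF A w, of "Suc n"]]
    by linarith
qed

text \<open>The one-step identities telescope. Degrees below \<open>m\<close> occur only among
  initial vertices, since newcomers start with degree at least \<open>m\<close> and degrees never
  decrease. Thus both the starting count \<open>L 0\<close> and the low-degree part
  \<open>L' n\<close> lie between 0 and the initial size, which bounds the error for all
  \<open>n\<close>.\<close>

lemma count_balance:
  assumes A: "vertex_process A" and w: "w \<in> space M" and d: "m \<le> d"
  shows "\<bar>(\<Sum>i<n. receiving_count A i d w) + (\<Sum>j=m..d. degree_count A n j w) - (\<Sum>j=m..d. \<Sum>i=1..n. newcomer A i j w)\<bar>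
    \<le> real (card (A 0 w))"
proof -
  define L where "L n = real (card {v \<in> A n w. deg (E n w) v \<le> d})" for n
  define L' where "L' n = real (card {v \<in> A n w. deg (E n w) v < m})" for n
  have fin: "finite (A n w)" for n
    using vertex_processD(2)[OF A w] .
  have "(\<Sum>i<n. receiving_count A i d w) + L n
      = L 0 + (\<Sum>i<n. of_bool (New (Suc i) \<in> A (Suc i) w \<and> deg (E (Suc i) w) (New (Suc i)) \<le> d))"
  proof (induction n)
    case (Suc n)
    then show ?case
      using count_le_step[OF A w, of n d] unfolding L_def sum.lessThan_Suc by linarith
  qed simp
  also have "(\<Sum>i<n. of_bool (New (Suc i) \<in> A (Suc i) w \<and> deg (E (Suc i) w) (New (Suc i)) \<le> d))
      = (\<Sum>i<n. \<Sum>j=m..d. newcomer A (Suc i) j w)"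
  proof (rule sum.cong)
    fix i
    have "\<not> deg (E (Suc i) w) (New (Suc i)) < m"
      using min_deg[OF w, of i] by simp
    then show "of_bool (New (Suc i) \<in> A (Suc i) w \<and> deg (E (Suc i) w) (New (Suc i)) \<le> d)
        = (\<Sum>j=m..d. newcomer A (Suc i) j w)"
      using of_bool_le_split[OF d, of "deg (E (Suc i) w) (New (Suc i))"]
      by (simp add: newcomer_def of_bool_conj sum_distrib_left[symmetric])
  qed simp
  also have "\<dots> = (\<Sum>j=m..d. \<Sum>i=1..n. newcomer A i j w)"
    by (subst sum.swap) (simp add: sum.atLeast1_atMost_eq)
  finally have 1: "(\<Sum>i<n. receiving_count A i d w) + L n = L 0 + (\<Sum>j=m..d. \<Sum>i=1..n. newcomer A i j w)" .
  have 2: "L n = L' n + (\<Sum>j=m..d. degree_count A n j w)"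
    unfolding L_def L'_def degree_count_def card_Collect_eq_sum[OF fin] of_bool_le_split[OF d] sum.distrib
    by (subst sum.swap) simp
  have "L' n \<le> L' 0"
  proof (induction n)
    case (Suc n)
    have "{v \<in> A (Suc n) w. deg (E (Suc n) w) v < m} \<subseteq> {v \<in> A n w. deg (E n w) v < m}"
      using vertex_processD[OF A w, of n] deg_Suc[OF w, of _ n] min_deg[OF w, of n]
      by (fastforce simp: not_less[symmetric])
    then have "L' (Suc n) \<le> L' n"
      unfolding L'_def using fin by (simp add: card_mono)
    with Suc show ?case
      by simp
  qed simp
  moreover have "L' 0 \<le> real (card (A 0 w))" "L 0 \<le> real (card (A 0 w))"
    unfolding L_def L'_def using fin by (auto intro!: card_mono)
  moreover have "0 \<le> L' n" "0 \<le> L 0"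
    by (auto simp: L_def L'_def)
  ultimately show ?thesis
    using 1 2 by linarith
qed

section \<open>Measurability and conditional expectations of the counts\<close>

lemma ES_vimage_sets: "(\<lambda>w. (E k w, S k w)) -` B \<inter> space M \<in> sets M"
proof -
  \<comment> \<open>The type of graphs is uncountable, so joint measurability of a pair of discrete
    maps is not automatic. At a fixed time, however, only the finitely many values in
    \<open>?R\<close> occur.\<close>
  let ?R = "Pow (Pow (verts l k)) \<times> Pow (verts l k)"
  have [measurable]: "E k \<in> measurable M (count_space UNIV)" "S k \<in> measurable M (count_space UNIV)"
    by (rule E_measurable S_measurable)+
  have "(\<lambda>w. (E k w, S k w)) -` B \<inter> space M
      = (\<Union>(e, s)\<in>B \<inter> ?R. (E k -` {e} \<inter> space M) \<inter> (S k -` {s} \<inter> space M))"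
  proof (intro equalityI subsetI)
    fix w assume w: "w \<in> (\<lambda>w. (E k w, S k w)) -` B \<inter> space M"
    then have "(E k w, S k w) \<in> B \<inter> ?R"
      using E_simple[of w k] S_verts[of w k] by (auto simp: simple_graph_def)
    with w show "w \<in> (\<Union>(e, s)\<in>B \<inter> ?R. (E k -` {e} \<inter> space M) \<inter> (S k -` {s} \<inter> space M))"
      by blast
  qed auto
  moreover have "finite (B \<inter> ?R)"
    by simp
  moreover have "E k -` {e} \<inter> space M \<in> sets M" "S k -` {s} \<inter> space M \<in> sets M" for e s
    by (auto intro!: measurable_sets[OF E_measurable] measurable_sets[OF S_measurable])
  ultimately show ?thesis
    by auto
qed

lemma space_F_sigma: "space (\<F> n) = space M"
  by (simp add: F_sigma_def space_measure_of_conv)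

lemma sets_F_sigma:
  "sets (\<F> n) = sigma_sets (space M) {(\<lambda>w. (E k w, S k w)) -` B \<inter> space M | k B. k \<le> n}"
  unfolding F_sigma_def by (rule sets_measure_of) auto

sublocale discrete_filtration M \<F>
proof
  fix n
  have "sets (\<F> n) \<subseteq> sets M"
    unfolding sets_F_sigma using ES_vimage_sets by (intro sets.sigma_sets_subset) auto
  then show "subalgebra M (\<F> n)"
    by (simp add: subalgebra_def space_F_sigma)
  show "sets (\<F> n) \<subseteq> sets (\<F> (Suc n))"
    unfolding sets_F_sigma by (rule sigma_sets_mono') (use le_SucI in blast)
qed

lemma F_sigma_measurable:
  fixes g :: "graph \<Rightarrow> vertex set \<Rightarrow> real"
  assumes "k \<le> n"
  shows "(\<lambda>w. g (E k w) (S k w)) \<in> borel_measurable (\<F> n)"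
proof (rule measurableI)
  fix B :: "real set" assume "B \<in> sets borel"
  have eq: "(\<lambda>w. g (E k w) (S k w)) -` B \<inter> space (\<F> n)
      = (\<lambda>w. (E k w, S k w)) -` {(e, s). g e s \<in> B} \<inter> space M"
    by (auto simp: space_F_sigma)
  show "(\<lambda>w. g (E k w) (S k w)) -` B \<inter> space (\<F> n) \<in> sets (\<F> n)"
    unfolding sets_F_sigma eq using assms by (intro sigma_sets.Basic) blast
qed simp

lemma degree_event_adapted:
  assumes A: "vertex_process A"
  shows "bounded_adapted n (\<lambda>w. of_bool (v \<in> A n w \<and> deg (E n w) v = d))"
proof -
  have "\<exists>g. \<forall>w\<in>space M. A n w = g (S n w)"
    using A unfolding vertex_process_def by (elim conjE allE)
  then obtain g where g: "\<And>w. w \<in> space M \<Longrightarrow> A n w = g (S n w)"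
    by metis
  have "(\<lambda>w. of_bool (v \<in> g (S n w) \<and> deg (E n w) v = d) :: real) \<in> borel_measurable (\<F> n)"
    using F_sigma_measurable[of n n "\<lambda>e s. of_bool (v \<in> g s \<and> deg e v = d)"] by simp
  then have "(\<lambda>w. of_bool (v \<in> A n w \<and> deg (E n w) v = d) :: real) \<in> borel_measurable (\<F> n)"
    by (rule measurable_cong[THEN iffD1, rotated]) (simp add: g space_F_sigma)
  then show ?thesis
    by (rule bounded_adaptedI[of _ _ 1]) simp
qed

lemma edge_event_adapted: "bounded_adapted (Suc n) (indicator {w \<in> space M. f \<in> E (Suc n) w})"
proof -
  have "(\<lambda>w. of_bool (f \<in> E (Suc n) w) :: real) \<in> borel_measurable (\<F> (Suc n))"
    using F_sigma_measurable[of "Suc n" "Suc n" "\<lambda>e s. of_bool (f \<in> e)"] by simp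
  then have "(indicator {w \<in> space M. f \<in> E (Suc n) w} :: 'w \<Rightarrow> real) \<in> borel_measurable (\<F> (Suc n))"
    by (rule measurable_cong[THEN iffD1, rotated]) (simp add: indicator_def space_F_sigma)
  then show ?thesis
    by (rule bounded_adaptedI[of _ _ 1]) (simp add: indicator_def)
qed

lemma degree_count_eq_sum:
  assumes A: "vertex_process A" and w: "w \<in> space M"
  shows "degree_count A n d w = (\<Sum>v\<in>verts l n. of_bool (v \<in> A n w \<and> deg (E n w) v = d))"
proof -
  have "{v \<in> A n w. deg (E n w) v = d} = {v \<in> verts l n. v \<in> A n w \<and> deg (E n w) v = d}"
    using vertex_processD(1)[OF A w] by blast
  then show ?thesis
    unfolding degree_count_def by (simp only: card_Collect_eq_sum finite_verts)
qed

lemma receiving_eq_sum: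
  assumes A: "vertex_process A" and w: "w \<in> space M"
  shows "receiving_count A n d w = (\<Sum>v\<in>verts l n. of_bool (v \<in> A n w \<and> deg (E n w) v = d)
      * indicator {w \<in> space M. {v, New (Suc n)} \<in> E (Suc n) w} w)"
proof -
  have "{v \<in> A n w. deg (E n w) v = d \<and> {v, New (Suc n)} \<in> E (Suc n) w}
      = {v \<in> verts l n. (v \<in> A n w \<and> deg (E n w) v = d) \<and> {v, New (Suc n)} \<in> E (Suc n) w}"
    using vertex_processD(1)[OF A w] by blast
  then have "receiving_count A n d w = (\<Sum>v\<in>verts l n.
      of_bool ((v \<in> A n w \<and> deg (E n w) v = d) \<and> {v, New (Suc n)} \<in> E (Suc n) w))"
    unfolding receiving_count_def by (simp only: card_Collect_eq_sum finite_verts)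
  also have "\<dots> = (\<Sum>v\<in>verts l n. of_bool (v \<in> A n w \<and> deg (E n w) v = d)
      * indicator {w \<in> space M. {v, New (Suc n)} \<in> E (Suc n) w} w)"
    using w by (intro sum.cong) (auto simp: indicator_def)
  finally show ?thesis .
qed

lemma receiving_adapted:
  assumes A: "vertex_process A"
  shows "bounded_adapted (Suc n) (receiving_count A n d)"
proof -
  have "bounded_adapted (Suc n) (\<lambda>w. \<Sum>v\<in>verts l n. of_bool (v \<in> A n w \<and> deg (E n w) v = d)
      * indicator {w \<in> space M. {v, New (Suc n)} \<in> E (Suc n) w} w)" (is "bounded_adapted _ ?f")
    by (intro bounded_adapted_sum bounded_adapted_mult edge_event_adapted
        bounded_adapted_mono[OF degree_event_adapted[OF A]]) simp
  then show ?thesis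
    by (rule bounded_adapted_cong) (simp only: receiving_eq_sum[OF A])
qed

text \<open>Writing the count as a sum over the deterministic set \<open>verts l n\<close> makes
  linearity available; membership and degree of \<open>v\<close> are known at time \<open>n\<close>
  and come out of the conditional expectation.\<close>

lemma cond_exp_receiving:
  assumes A: "vertex_process A"
  shows "AE w in M. cexp n (receiving_count A n d) w
    = (\<Sum>v\<in>verts l n. of_bool (v \<in> A n w \<and> deg (E n w) v = d)
        * cond_P M (\<F> n) (\<lambda>w. {v, New (Suc n)} \<in> E (Suc n) w) w)"
proof -
  interpret C: sigma_finite_subalgebra M "\<F> n"
    by (rule sigma_finite_subalgebra_F)
  let ?u = "\<lambda>v w. of_bool (v \<in> A n w \<and> deg (E n w) v = d) :: real"
  let ?e = "\<lambda>v. indicator {w \<in> space M. {v, New (Suc n)} \<in> E (Suc n) w} :: 'w \<Rightarrow> real"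
  have ue: "bounded_adapted (Suc n) (\<lambda>w. ?u v w * ?e v w)" for v
    by (intro bounded_adapted_mult edge_event_adapted
        bounded_adapted_mono[OF degree_event_adapted[OF A]]) simp
  have int: "integrable M (\<lambda>w. ?u v w * ?e v w)" for v
    using ue by (rule bounded_adapted_integrable)
  have [measurable]: "?e v \<in> borel_measurable M" for v
    by (rule measurable_F_imp_M[OF bounded_adapted_measurable[OF edge_event_adapted]])
  have "AE w in M. cexp n (\<lambda>w. ?u v w * ?e v w) w = ?u v w * cexp n (?e v) w" for v
    by (intro C.real_cond_exp_mult bounded_adapted_measurable[OF degree_event_adapted[OF A]] int) measurable
  then have "AE w in M. \<forall>v\<in>verts l n.
      cexp n (\<lambda>w. ?u v w * ?e v w) w = ?u v w * cexp n (?e v) w"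
    by (simp add: AE_finite_all)
  moreover have "AE w in M. cexp n (\<lambda>w. \<Sum>v\<in>verts l n. ?u v w * ?e v w) w
      = (\<Sum>v\<in>verts l n. cexp n (\<lambda>w. ?u v w * ?e v w) w)"
    by (rule C.real_cond_exp_sum[OF int])
  moreover have "AE w in M. cexp n (receiving_count A n d) w
      = cexp n (\<lambda>w. \<Sum>v\<in>verts l n. ?u v w * ?e v w) w"
  proof (rule C.real_cond_exp_cong)
    show "receiving_count A n d \<in> borel_measurable M"
      by (rule measurable_F_imp_M[OF bounded_adapted_measurable[OF receiving_adapted[OF A]]])
    show "(\<lambda>w. \<Sum>v\<in>verts l n. ?u v w * ?e v w) \<in> borel_measurable M"
      using int by (intro borel_measurable_sum borel_measurable_integrable)
    show "AE w in M. receiving_count A n d w = (\<Sum>v\<in>verts l n. ?u v w * ?e v w)"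
      by (intro AE_I2 receiving_eq_sum A)
  qed
  ultimately show ?thesis
    by eventually_elim (simp add: cond_P_def)
qed

lemma cond_P_bounds:
  assumes "{w \<in> space M. Q w} \<in> sets M"
  shows "AE w in M. 0 \<le> cond_P M (\<F> n) Q w \<and> cond_P M (\<F> n) Q w \<le> 1"
proof -
  interpret C: sigma_finite_subalgebra M "\<F> n"
    by (rule sigma_finite_subalgebra_F)
  have int: "integrable M (indicator {w \<in> space M. Q w} :: 'w \<Rightarrow> real)"
    using assms by (simp add: integrable_indicator_iff less_top[symmetric])
  have "AE w in M. 0 \<le> cond_P M (\<F> n) Q w" "AE w in M. cond_P M (\<F> n) Q w \<le> 1"
    unfolding cond_P_def using int
    by (intro C.real_cond_exp_ge_c C.real_cond_exp_le_c; simp add: indicator_def)+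
  then show ?thesis
    by eventually_elim simp
qed

text \<open>At almost every point all vertices of degree \<open>d\<close> share one conditional edge
  probability \<open>\<pi>\<close>, so each conditional expectation is \<open>\<pi>\<close> times
  the size of the class, and \<open>\<pi>\<close> can be recovered as a quotient. If no vertex has
  degree \<open>d\<close>, any \<open>\<pi>\<close> will do, both class sizes are 0, and division by
  zero gives the right value.\<close>

lemma cond_exp_receiving_proportional:
  assumes A: "vertex_process A"
    and exch: "\<And>w1 w2. w1 \<in> verts l n \<Longrightarrow> w2 \<in> verts l n \<Longrightarrow>
          AE w in M. deg (E n w) w1 = deg (E n w) w2 \<longrightarrow>
            cond_P M (\<F> n) (\<lambda>w. {w1, New (Suc n)} \<in> E (Suc n) w) w =
            cond_P M (\<F> n) (\<lambda>w. {w2, New (Suc n)} \<in> E (Suc n) w) w"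
  defines "XV \<equiv> degree_count (\<lambda>n _. verts l n)" and "YV \<equiv> receiving_count (\<lambda>n _. verts l n)"
  shows "AE w in M. 0 \<le> cexp n (YV n d) w \<and> cexp n (YV n d) w \<le> XV n d w \<and>
    cexp n (receiving_count A n d) w = degree_count A n d w * (cexp n (YV n d) w / XV n d w)"
proof -
  let ?P = "\<lambda>v. cond_P M (\<F> n) (\<lambda>w. {v, New (Suc n)} \<in> E (Suc n) w)"
  have sets: "{w \<in> space M. {v, New (Suc n)} \<in> E (Suc n) w} \<in> sets M" for v
  proof -
    have "{w \<in> space M. {v, New (Suc n)} \<in> E (Suc n) w} = E (Suc n) -` {e. {v, New (Suc n)} \<in> e} \<inter> space M"
      by auto
    then show ?thesis
      using measurable_sets[OF E_measurable, of "{e. {v, New (Suc n)} \<in> e}" "Suc n"] by simp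
  qed
  have "AE w in M. \<forall>v\<in>verts l n. 0 \<le> ?P v w \<and> ?P v w \<le> 1"
    using cond_P_bounds[OF sets] by (simp add: AE_finite_all)
  moreover have "AE w in M. \<forall>v\<in>verts l n. \<forall>u\<in>verts l n. deg (E n w) v = deg (E n w) u \<longrightarrow> ?P v w = ?P u w"
    using exch by (simp add: AE_finite_all)
  ultimately show ?thesis
    using cond_exp_receiving[OF A, of n d] cond_exp_receiving[OF vertex_process_verts, of n d] AE_space
  proof eventually_elim
    case (elim w)
    have "\<exists>\<pi>. 0 \<le> \<pi> \<and> \<pi> \<le> 1 \<and> (\<forall>v\<in>verts l n. deg (E n w) v = d \<longrightarrow> ?P v w = \<pi>)"
    proof (cases "\<exists>v\<in>verts l n. deg (E n w) v = d")
      case True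
      then obtain v where v: "v \<in> verts l n" "deg (E n w) v = d"
        by blast
      show ?thesis
      proof (intro exI[of _ "?P v w"] conjI ballI impI)
        show "0 \<le> ?P v w" "?P v w \<le> 1"
          using elim(1) v(1) by simp_all
        fix u assume u: "u \<in> verts l n" "deg (E n w) u = d"
        show "?P u w = ?P v w"
          by (rule elim(2)[THEN bspec, OF u(1), THEN bspec, OF v(1), THEN mp]) (simp add: v u)
      qed
    next
      case False
      then show ?thesis
        by (intro exI[of _ 0]) auto
    qed
    then obtain \<pi> where \<pi>: "0 \<le> \<pi>" "\<pi> \<le> 1"
      and P: "\<forall>v\<in>verts l n. deg (E n w) v = d \<longrightarrow> ?P v w = \<pi>"
      by (elim exE conjE)
    have eq: "(\<Sum>v\<in>verts l n. of_bool (v \<in> B n w \<and> deg (E n w) v = d) * ?P v w) = degree_count B n d w * \<pi>"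
      if "vertex_process B" for B
      unfolding degree_count_eq_sum[OF that elim(5)] sum_distrib_right
      by (rule sum.cong) (auto simp: P)
    have Y: "cexp n (YV n d) w = XV n d w * \<pi>"
      unfolding YV_def XV_def elim(4) by (rule eq[OF vertex_process_verts])
    have receiving_count: "cexp n (receiving_count A n d) w = degree_count A n d w * \<pi>"
      unfolding elim(3) by (rule eq[OF A])
    have X0: "0 \<le> XV n d w"
      by (simp add: XV_def degree_count_def)
    have "degree_count A n d w \<le> XV n d w"
      unfolding degree_count_def XV_def using vertex_processD(1)[OF A elim(5)] by (auto intro!: card_mono)
    moreover have "0 \<le> degree_count A n d w"
      by (simp add: degree_count_def)
    ultimately have "degree_count A n d w * \<pi> = degree_count A n d w * (XV n d w * \<pi> / XV n d w)"
      by (cases "XV n d w = 0") auto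
    then show ?case
      unfolding Y receiving_count using \<pi> X0 by (simp add: mult_left_le)
  qed
qed

end

section \<open>Strong laws for the counts\<close>

context monotone_selection
begin

lemma cond_exp_nonneg:
  assumes "integrable M V" "\<And>w. w \<in> space M \<Longrightarrow> 0 \<le> V w"
  shows "AE w in M. 0 \<le> cexp n V w"
  using sigma_finite_subalgebra.real_cond_exp_ge_c[OF sigma_finite_subalgebra_F assms(1), of 0] assms(2)
  by auto

text \<open>Since \<open>Y\<close> is integer valued, \<open>max 0 (Y - b)\<close> is at most the number of integers
  in \<open>{b..Y}\<close>.\<close>

lemma receiving_tail:
  assumes A: "vertex_process A" and Z: "exp_decreasing_from 0 (pmf Z)"
    and dom: "\<And>i j. 1 \<le> i \<Longrightarrow> 1 \<le> j \<Longrightarrow> AE w in M.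
      cond_P M (\<F> i) (\<lambda>w. j \<le> Y_count l E i d w) w \<le> measure_pmf.prob Z {j..}"
  shows "\<exists>C r. 0 < r \<and> r < 1 \<and>
    (\<forall>i\<ge>1. \<forall>b\<ge>1. expectation (\<lambda>w. max 0 (receiving_count A i d w - b)) \<le> C * r powr b)"
proof -
  obtain C r where C: "0 < C" and r: "0 < r" "r < 1"
    and le: "\<And>j. 1 \<le> j \<Longrightarrow> pmf Z j \<le> C * r ^ j"
    using Z unfolding exp_decreasing_from_def by auto
  define C' where "C' = C / (1 - r)"
  have C': "0 \<le> C'"
    using C r by (simp add: C'_def)
  have "expectation (\<lambda>w. max 0 (receiving_count A i d w - b)) \<le> C' / (1 - r) * r powr b" if i: "1 \<le> i" and b: "1 \<le> b" for i b
  proof -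
    interpret C: sigma_finite_subalgebra M "\<F> i"
      by (rule sigma_finite_subalgebra_F)
    define N where "N = card (verts l i)"
    define a where "a = nat \<lceil>b\<rceil>"
    have a: "b \<le> real a" "real a < b + 1" "1 \<le> a"
      using b by (auto simp: a_def) linarith+
    define Q where "Q j = {w \<in> space M. j \<le> Y_count l E i d w}" for j
    have Y_real: "receiving_count (\<lambda>n _. verts l n) i d w = real (Y_count l E i d w)" for w
      by (simp add: receiving_count_def Y_count_def)
    have [measurable]: "receiving_count A i d \<in> borel_measurable M" "receiving_count (\<lambda>n _. verts l n) i d \<in> borel_measurable M"
      by (rule measurable_F_imp_M[OF bounded_adapted_measurable[OF receiving_adapted[OF A]]]
        measurable_F_imp_M[OF bounded_adapted_measurable[OF receiving_adapted[OF vertex_process_verts]]])+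
    have "Q j = {w \<in> space M. real j \<le> receiving_count (\<lambda>n _. verts l n) i d w}" for j
      by (simp add: Q_def Y_real)
    then have Q_sets [measurable]: "Q j \<in> sets M" for j
      by simp
    have Q_prob: "prob (Q j) \<le> C' * r ^ j" if j: "1 \<le> j" for j
    proof -
      have int: "integrable M (indicator (Q j) :: 'w \<Rightarrow> real)"
        by (simp add: integrable_indicator_iff less_top[symmetric])
      have "prob (Q j) = expectation (indicator (Q j))"
        by simp
      also have "\<dots> = expectation (cond_P M (\<F> i) (\<lambda>w. j \<le> Y_count l E i d w))"
        unfolding cond_P_def Q_def[symmetric] using int by (rule C.real_cond_exp_int(2)[symmetric])
      also have "\<dots> \<le> expectation (\<lambda>_. measure_pmf.prob Z {j..})"
      proof (rule integral_mono_AE)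
        show "integrable M (cond_P M (\<F> i) (\<lambda>w. j \<le> Y_count l E i d w))"
          unfolding cond_P_def Q_def[symmetric] using int by (rule C.real_cond_exp_int(1))
      qed (use dom[OF i j] in auto)
      also have "\<dots> \<le> C' * r ^ j"
        using pmf_tail_le[OF le r j] by (simp add: prob_space C'_def)
      finally show ?thesis .
    qed
    have "expectation (\<lambda>w. max 0 (receiving_count A i d w - b)) \<le> expectation (\<lambda>w. \<Sum>j\<in>{a..<Suc N}. indicator (Q j) w)"
    proof (rule integral_mono)
      have "integrable M (receiving_count A i d)"
        by (rule bounded_adapted_integrable[OF receiving_adapted[OF A]])
      then show "integrable M (\<lambda>w. max 0 (receiving_count A i d w - b))"
        by (intro integrable_max) auto
      show "integrable M (\<lambda>w. \<Sum>j\<in>{a..<Suc N}. indicator (Q j) w :: real)"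
        by (intro Bochner_Integration.integrable_sum) (simp add: integrable_indicator_iff less_top[symmetric])
      fix w assume w: "w \<in> space M"
      define y where "y = Y_count l E i d w"
      have "y \<le> N"
        unfolding y_def N_def Y_count_def by (rule card_mono) auto
      \<comment> \<open>The tail hypothesis speaks of all vertices; a smaller vertex set receives no
        more edges and so inherits it.\<close>
      have "receiving_count A i d w \<le> real y"
        unfolding y_def receiving_count_def Y_count_def using vertex_processD(1)[OF A w]
        by (auto intro!: card_mono)
      have "(\<Sum>j\<in>{a..<Suc N}. indicator (Q j) w) = (\<Sum>j\<in>{a..<Suc N}. if j \<le> y then 1 else (0 :: real))"
        using w by (intro sum.cong) (auto simp: Q_def y_def indicator_def)
      also have "\<dots> = (\<Sum>j\<in>{a..<Suc y}. 1)"
        using \<open>y \<le> N\<close> by (intro sum.mono_neutral_cong_right) auto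
      also have "\<dots> = real (Suc y - a)"
        by simp
      finally show "max 0 (receiving_count A i d w - b) \<le> (\<Sum>j\<in>{a..<Suc N}. indicator (Q j) w)"
        using \<open>receiving_count A i d w \<le> real y\<close> a by linarith
    qed
    also have "\<dots> = (\<Sum>j\<in>{a..<Suc N}. prob (Q j))"
      by (subst Bochner_Integration.integral_sum) (auto simp: integrable_indicator_iff less_top[symmetric])
    also have "\<dots> \<le> (\<Sum>j\<in>{a..<Suc N}. C' * r ^ j)"
      using a by (intro sum_mono Q_prob) auto
    also have "\<dots> \<le> C' * (r ^ a / (1 - r))"
      unfolding sum_distrib_left[symmetric] using C' r by (intro mult_left_mono geometric_block_le) auto
    also have "\<dots> \<le> C' * (r powr b / (1 - r))"
    proof -
      have "r ^ a = r powr real a"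
        using r by (simp add: powr_realpow)
      also have "\<dots> \<le> r powr b"
        using r a by (intro powr_mono') auto
      finally show ?thesis
        using C' r by (intro mult_left_mono divide_right_mono) auto
    qed
    finally show ?thesis
      by simp
  qed
  with r show ?thesis
    by (intro exI[of _ "C' / (1 - r)"] exI[of _ r] conjI allI impI)
qed

text \<open>With exponential tails, truncation at a power of \<open>i\<close> leaves stretched
  exponential excesses, which are summable for every positive \<delta>. The base
  \<open>real i + 1\<close> keeps the truncation level at least 1 at time 0. The domination begins
  at time 1, so the comparison is only eventual.\<close>

lemma slln_receiving:
  assumes A: "vertex_process A" and Z: "exp_decreasing_from 0 (pmf Z)"
    and dom: "\<And>i j. 1 \<le> i \<Longrightarrow> 1 \<le> j \<Longrightarrow> AE w in M.
      cond_P M (\<F> i) (\<lambda>w. j \<le> Y_count l E i d w) w \<le> measure_pmf.prob Z {j..}"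
    and \<delta>: "0 < \<delta>"
  shows "AE w in M. (\<lambda>n. (\<Sum>i<n. receiving_count A i d w - cexp i (receiving_count A i d) w)
    / (((real n + 1) powr \<delta>)\<^sup>2 + (\<Sum>i<n. cexp i (receiving_count A i d) w))) \<longlonglongrightarrow> 0"
proof (rule slln_conditional)
  have "\<exists>C r. 0 < r \<and> r < 1 \<and>
      (\<forall>i\<ge>1. \<forall>b\<ge>1. expectation (\<lambda>w. max 0 (receiving_count A i d w - b)) \<le> C * r powr b)"
    by (rule receiving_tail[OF A Z dom])
  then obtain C r where r: "0 < r" "r < 1"
    and tail: "\<forall>i\<ge>1. \<forall>b\<ge>1. expectation (\<lambda>w. max 0 (receiving_count A i d w - b)) \<le> C * r powr b"
    by (elim exE conjE)
  have b1: "1 \<le> (real i + 1) powr \<delta>" for i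
    using \<delta> by (simp add: ge_one_powr_ge_zero)
  show "summable (\<lambda>i. expectation (\<lambda>w. max 0 (receiving_count A i d w - (real i + 1) powr \<delta>)))"
  proof (rule summable_comparison_test_ev)
    show "summable (\<lambda>i. C * r powr ((real i + 1) powr \<delta>))"
      using r \<delta> by (intro summable_mult summable_powr_stretched)
    show "\<forall>\<^sub>F i in sequentially. norm (expectation (\<lambda>w. max 0 (receiving_count A i d w - (real i + 1) powr \<delta>)))
        \<le> C * r powr ((real i + 1) powr \<delta>)"
      using eventually_ge_at_top[of 1]
    proof eventually_elim
      case (elim i)
      have "0 \<le> expectation (\<lambda>w. max 0 (receiving_count A i d w - (real i + 1) powr \<delta>))"
        by (intro integral_nonneg_AE) auto
      then show ?case
        using tail[rule_format, OF elim b1, of i] by simp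
    qed
  qed
  show "incseq (\<lambda>i. (real i + 1) powr \<delta>)"
    using \<delta> by (intro incseq_SucI powr_mono2) auto
  show "1 \<le> (real i + 1) powr \<delta>" for i
    by (rule b1)
  show "filterlim (\<lambda>i. (real i + 1) powr \<delta>) at_top sequentially"
    using \<delta> by real_asymp
  show "bounded_adapted (Suc i) (receiving_count A i d)" for i
    by (rule receiving_adapted[OF A])
  show "0 \<le> receiving_count A i d w" for i w
    by (simp add: receiving_count_def)
qed

lemma slln_unit_interval:
  fixes V :: "nat \<Rightarrow> 'w \<Rightarrow> real"
  assumes V: "\<And>i. V i \<in> borel_measurable (\<F> (Suc i))" "\<And>i w. 0 \<le> V i w \<and> V i w \<le> 1"
    and \<delta>: "0 < \<delta>"
  shows "AE w in M. (\<forall>i. 0 \<le> cexp i (V i) w) \<and>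
    (\<lambda>n. (\<Sum>i<n. V i w - cexp i (V i) w)
      / (((real n + 1) powr \<delta>)\<^sup>2 + (\<Sum>i<n. cexp i (V i) w))) \<longlonglongrightarrow> 0"
proof -
  have b1: "1 \<le> (real i + 1) powr \<delta>" for i
    using \<delta> by (simp add: ge_one_powr_ge_zero)
  have ad: "bounded_adapted (Suc i) (V i)" for i
    using V by (intro bounded_adaptedI[of _ _ 1]) (auto simp: abs_le_iff intro: order_trans[of _ 0])
  have "max 0 (V i w - (real i + 1) powr \<delta>) = 0" for i w
    using V(2)[of i w] b1[of i] by linarith
  then have tails: "summable (\<lambda>i. expectation (\<lambda>w. max 0 (V i w - (real i + 1) powr \<delta>)))"
    by simp
  have "AE w in M. (\<lambda>n. (\<Sum>i<n. V i w - cexp i (V i) w)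
      / (((real n + 1) powr \<delta>)\<^sup>2 + (\<Sum>i<n. cexp i (V i) w))) \<longlonglongrightarrow> 0"
  proof (rule slln_conditional[OF ad _ tails])
    show "incseq (\<lambda>i. (real i + 1) powr \<delta>)"
      using \<delta> by (intro incseq_SucI powr_mono2) auto
    show "filterlim (\<lambda>i. (real i + 1) powr \<delta>) at_top sequentially"
      using \<delta> by real_asymp
  qed (use V(2) b1 in auto)
  moreover have "AE w in M. \<forall>i. 0 \<le> cexp i (V i) w"
    unfolding AE_all_countable using V(2) by (intro allI cond_exp_nonneg bounded_adapted_integrable[OF ad]) auto
  ultimately show ?thesis
    by eventually_elim simp
qed

lemma card_S_telescope:
  assumes w: "w \<in> space M"
  shows "(\<Sum>i<n. I_sel S (Suc i) w) = real (card (S n w)) - real (card (S 0 w))"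
proof (induction n)
  case (Suc n)
  note S = vertex_processD[OF vertex_process_S w, of n]
  have "real (card (S (Suc n) w)) = real (card (S n w)) + I_sel S (Suc n) w"
  proof (cases "New (Suc n) \<in> S (Suc n) w")
    case True
    then have "S (Suc n) w = insert (New (Suc n)) (S n w)"
      using S by blast
    then show ?thesis
      using S by (simp add: I_sel_def)
  next
    case False
    then have "S (Suc n) w = S n w"
      using S by blast
    then show ?thesis
      using False by (simp add: I_sel_def)
  qed
  then show ?case
    using Suc by simp
qed simp

text \<open>In \<open>count_balance\<close> for all vertices the newcomers contribute
  \<open>p j\<close> and the degree classes \<open>c j\<close> per step; the difference has to be
  the edges received in degree \<open>d\<close>.\<close>

lemma receiving_mean:
  assumes w: "w \<in> space M" and d: "m \<le> d"
    and X: "\<And>j. m \<le> j \<Longrightarrow> (\<lambda>n. degree_count (\<lambda>n _. verts l n) n j w / real n) \<longlonglongrightarrow> c j"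
    and new: "\<And>j. m \<le> j \<Longrightarrow> (\<lambda>n. (\<Sum>i=1..Suc n. I_new E i j w) - p j * real n) \<in> o(\<lambda>n. real n)"
  shows "(\<lambda>n. (\<Sum>i<n. receiving_count (\<lambda>n _. verts l n) i d w) / real n) \<longlonglongrightarrow> (\<Sum>j=m..d. p j - c j)"
proof -
  let ?V = "\<lambda>n _. verts l n"
  have newcomer: "(\<Sum>i=1..n. newcomer ?V i j w) = (\<Sum>i=1..n. I_new E i j w)" for n j
    by (rule sum.cong) (auto simp: newcomer_def I_new_def verts_def)
  have new_lim: "(\<lambda>n. (\<Sum>i=1..n. newcomer ?V i j w) / real n) \<longlonglongrightarrow> p j" if "m \<le> j" for j
  proof -
    have "(\<lambda>n. ((\<Sum>i=1..Suc n. I_new E i j w) - p j * real n) / real n) \<longlonglongrightarrow> 0"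
      using new[OF that] by (rule smalloD_tendsto)
    \<comment> \<open>The hypothesis compares a sum of \<open>n + 1\<close> terms with
      \<open>n\<close>; this factor changes the normalisation to \<open>Suc n\<close> before the
      index is shifted back.\<close>
    moreover have "(\<lambda>n. real n / real (Suc n)) \<longlonglongrightarrow> 1"
      by real_asymp
    ultimately have "(\<lambda>n. (((\<Sum>i=1..Suc n. I_new E i j w) - p j * real n) / real n + p j) * (real n / real (Suc n)))
        \<longlonglongrightarrow> (0 + p j) * 1"
      by (intro tendsto_mult tendsto_add tendsto_const)
    then have "(\<lambda>n. (((\<Sum>i=1..Suc n. I_new E i j w) - p j * real n) / real n + p j) * (real n / real (Suc n)))
        \<longlonglongrightarrow> p j"
      by simp
    then have "(\<lambda>n. (\<Sum>i=1..Suc n. I_new E i j w) / real (Suc n)) \<longlonglongrightarrow> p j"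
    proof (rule Lim_transform_eventually)
      show "\<forall>\<^sub>F n in sequentially. (((\<Sum>i=1..Suc n. I_new E i j w) - p j * real n) / real n + p j) * (real n / real (Suc n))
          = (\<Sum>i=1..Suc n. I_new E i j w) / real (Suc n)"
        using eventually_gt_at_top[of 0]
      proof eventually_elim
        case (elim n)
        have "(z - p j * t) / t + p j = z / t" if "0 < t" for z t :: real
          using that by (simp add: diff_divide_distrib)
        then show ?case
          using elim by simp
      qed
    qed
    then show ?thesis
      unfolding newcomer by (rule LIMSEQ_imp_Suc)
  qed
  have "(\<lambda>n. (\<Sum>j=m..d. (\<Sum>i=1..n. newcomer ?V i j w) / real n) - (\<Sum>j=m..d. degree_count ?V n j w / real n))
      \<longlonglongrightarrow> (\<Sum>j=m..d. p j) - (\<Sum>j=m..d. c j)"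
    by (intro tendsto_diff tendsto_sum new_lim X) auto
  then have "(\<lambda>n. ((\<Sum>j=m..d. \<Sum>i=1..n. newcomer ?V i j w) - (\<Sum>j=m..d. degree_count ?V n j w)) / real n)
      \<longlonglongrightarrow> (\<Sum>j=m..d. p j - c j)"
    by (simp only: sum_divide_distrib[symmetric] diff_divide_distrib[symmetric] sum_subtractf)
  moreover have "\<bar>(\<Sum>i<n. receiving_count ?V i d w) - ((\<Sum>j=m..d. \<Sum>i=1..n. newcomer ?V i j w) - (\<Sum>j=m..d. degree_count ?V n j w))\<bar>
      \<le> real (card (verts l 0))" for n
    using count_balance[OF vertex_process_verts w d, of n] by linarith
  ultimately show ?thesis
    by (rule tendsto_of_bounded_numerator_diff[OF _ _ filterlim_real_sequentially, rotated])
qed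

end

section \<open>Assembly: probabilistic input first, then one path at a time\<close>

theorem theorem1:
  fixes M :: "'w measure"
    and l m :: nat
    and E0 :: graph and S0 :: "vertex set"
    and E :: "nat \<Rightarrow> 'w \<Rightarrow> graph" and S :: "nat \<Rightarrow> 'w \<Rightarrow> vertex set"
    and c p q k :: "nat \<Rightarrow> real"
    and K \<gamma> \<alpha> :: real
    and \<zeta> :: "nat \<Rightarrow> 'w \<Rightarrow> real"
  assumes model: "selected_graph_process M l m E0 S0 E S"
    and c_pos: "\<And>d. m \<le> d \<Longrightarrow> 0 < c d"
    and c_dist: "prob_dist_from m c"
    and h1: "AE \<omega> in M. \<forall>d\<ge>m.
          asymp_equiv (\<lambda>n. real (X_count l E n d \<omega>)) sequentially (\<lambda>n. c d * real n)"
    and K_pos: "0 < K" and \<gamma>_pos: "0 < \<gamma>"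
    and h2: "asymp_equiv c sequentially (\<lambda>d. K * real d powr (- \<gamma>))"
    and h3: "\<And>n w1 w2. w1 \<in> verts l n \<Longrightarrow> w2 \<in> verts l n \<Longrightarrow>
          AE \<omega> in M. deg (E n \<omega>) w1 = deg (E n \<omega>) w2 \<longrightarrow>
            cond_P M (F_sigma M E S n) (\<lambda>\<omega>. {w1, New (Suc n)} \<in> E (Suc n) \<omega>) \<omega> =
            cond_P M (F_sigma M E S n) (\<lambda>\<omega>. {w2, New (Suc n)} \<in> E (Suc n) \<omega>) \<omega>"
    and p_dist: "prob_dist_from m p" and p_exp: "exp_decreasing_from m p"
    and h4: "AE \<omega> in M. \<forall>d\<ge>m.
          (\<lambda>n. (\<Sum>i=1..Suc n. I_new E i d \<omega>) - p d * real n) \<in> o(\<lambda>n. real n)"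
    and h5: "\<And>d. m \<le> d \<Longrightarrow> \<exists>Z :: nat pmf. exp_decreasing_from 0 (pmf Z) \<and>
          (\<forall>i\<ge>1. \<forall>j\<ge>1. AE \<omega> in M.
             cond_P M (F_sigma M E S i) (\<lambda>\<omega>. j \<le> Y_count l E i d \<omega>) \<omega>
               \<le> measure_pmf.prob Z {j..})"
    and k_def: "\<And>d. m \<le> d \<Longrightarrow> k d = (\<Sum>j=m..d. p j - c j)"
    and h6: "\<And>d. m \<le> d \<Longrightarrow> 0 < k d"
    and h7: "\<And>n \<omega>. \<omega> \<in> space M \<Longrightarrow> S n \<omega> \<subseteq> S (Suc n) \<omega>"
    and h8: "\<And>n. I_sel S (Suc n) \<in> borel_measurable (Fplus_sigma M E S n)"
    and \<zeta>_measurable: "\<And>n. \<zeta> n \<in> borel_measurable M"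
    and \<zeta>_pos: "\<And>n. AE \<omega> in M. 0 < \<zeta> n \<omega>"
    and \<alpha>_pos: "0 < \<alpha>"
    and h9: "AE \<omega> in M. slowly_varying (\<lambda>n. \<zeta> n \<omega>) \<and>
          asymp_equiv (\<lambda>n. real (card (S n \<omega>))) sequentially (\<lambda>n. \<zeta> n \<omega> * real n powr \<alpha>)"
    and q_dist: "prob_dist_from m q" and q_exp: "exp_decreasing_from m q"
    and h10: "\<And>d. m \<le> d \<Longrightarrow> AE \<omega> in M. \<exists>r :: nat \<Rightarrow> real. r \<in> o(\<lambda>_. 1) \<and>
          (\<forall>\<^sub>F n in sequentially.
             (\<Sum>i=1..n. real_cond_exp M (F_sigma M E S (i - 1)) (I_sel_deg E S i d) \<omega>) =
             (q d + r n) * (\<Sum>i=1..n. real_cond_exp M (F_sigma M E S (i - 1)) (I_sel S i) \<omega>))"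
  shows "\<exists>x :: nat \<Rightarrow> real.
      (AE \<omega> in M. \<forall>d\<ge>m.
         (\<lambda>n. real (X_sel E S n d \<omega>) / real (card (S n \<omega>))) \<longlonglongrightarrow> x d) \<and>
      x m = \<alpha> * q m / (\<alpha> + (p m - c m) / c m) \<and>
      (\<forall>d\<ge>Suc m. x d = (x (d - 1) * (k (d - 1) / c (d - 1)) + \<alpha> * q d) / (\<alpha> + k d / c d)) \<and>
      prob_dist_from m x \<and>
      (\<exists>L>0. asymp_equiv x sequentially (\<lambda>d. L * real d powr (- (\<alpha> * (\<gamma> - 1) + 1))))"
proof -
  interpret monotone_selection M l m E0 S0 E S
    using model h7 by (intro monotone_selection.intro monotone_selection_axioms.intro)
  interpret R: degree_recursion m c p q k K \<gamma> \<alpha>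
    using c_pos c_dist K_pos h2 p_dist p_exp k_def h6 \<alpha>_pos q_dist q_exp
    by (intro degree_recursion.intro)
  let ?V = "\<lambda>n (_ :: 'w). verts l n"
  \<comment> \<open>The exponent of \<open>\<beta>\<close> is \<open>2 * \<delta>\<close>, half the
    minimum of \<alpha> and 1; this makes \<open>\<beta> n\<close> negligible against both
    \<open>s n\<close> and \<open>n\<close>.\<close>
  define \<delta> where "\<delta> = min \<alpha> 1 / 4"
  have \<delta>: "0 < \<delta>" "\<delta> * 2 < \<alpha>" "\<delta> * 2 < 1"
    using \<alpha>_pos by (auto simp: \<delta>_def min_def)
  define \<beta> where "\<beta> n = ((real n + 1) powr \<delta>)\<^sup>2" for n
  have \<beta>_eq: "\<beta> n = (real n + 1) powr (\<delta> * 2)" for n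
    by (simp add: \<beta>_def power2_eq_square powr_add[symmetric] mult.commute)
  have \<beta>_pos: "0 < \<beta> n" for n
    by (simp add: \<beta>_eq)
  have \<beta>_n: "(\<lambda>n. \<beta> n / real n) \<longlonglongrightarrow> 0"
    unfolding \<beta>_eq
  proof (rule tendsto_powr_shift_divide)
    have "(\<lambda>n. real n powr (\<delta> * 2 - 1)) \<longlonglongrightarrow> 0"
      using \<delta> by (intro tendsto_neg_powr filterlim_real_sequentially) simp
    then show "(\<lambda>n. real n powr (\<delta> * 2) / real n) \<longlonglongrightarrow> 0"
    proof (rule Lim_transform_eventually)
      show "\<forall>\<^sub>F n in sequentially. real n powr (\<delta> * 2 - 1) = real n powr (\<delta> * 2) / real n"
        using eventually_gt_at_top[of 0] by eventually_elim (simp add: powr_diff)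
    qed
  qed
  have slln_Y: "AE w in M. \<forall>d. m \<le> d \<longrightarrow> (\<lambda>n. (\<Sum>i<n. receiving_count A i d w - cexp i (receiving_count A i d) w)
      / (\<beta> n + (\<Sum>i<n. cexp i (receiving_count A i d) w))) \<longlonglongrightarrow> 0"
    (is "AE w in M. \<forall>d. _ \<longrightarrow> ?P d w") if A: "vertex_process A" for A
  proof (subst AE_all_countable, intro allI)
    fix d
    show "AE w in M. m \<le> d \<longrightarrow> ?P d w"
    proof (cases "m \<le> d")
      case True
      from h5[OF True] obtain Z :: "nat pmf" where Z: "exp_decreasing_from 0 (pmf Z)"
        and dom: "\<forall>i\<ge>1. \<forall>j\<ge>1. AE w in M.
             cond_P M (F_sigma M E S i) (\<lambda>w. j \<le> Y_count l E i d w) w \<le> measure_pmf.prob Z {j..}"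
        by (elim exE conjE)
      have "AE w in M. ?P d w"
        unfolding \<beta>_def by (rule slln_receiving[OF A Z dom[rule_format] \<delta>(1)])
      then show ?thesis
        by simp
    qed simp
  qed
  have prop_Y: "AE w in M. \<forall>i d. 0 \<le> cexp i (receiving_count ?V i d) w
      \<and> cexp i (receiving_count ?V i d) w \<le> degree_count ?V i d w
      \<and> cexp i (receiving_count S i d) w = degree_count S i d w * (cexp i (receiving_count ?V i d) w / degree_count ?V i d w)"
    unfolding AE_all_countable by (intro allI cond_exp_receiving_proportional vertex_process_S h3)
  have slln_new: "AE w in M. \<forall>d. (\<forall>i. 0 \<le> cexp i (I_sel_deg E S (Suc i) d) w) \<and>
      (\<lambda>n. (\<Sum>i<n. I_sel_deg E S (Suc i) d w - cexp i (I_sel_deg E S (Suc i) d) w)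
        / (\<beta> n + (\<Sum>i<n. cexp i (I_sel_deg E S (Suc i) d) w))) \<longlonglongrightarrow> 0"
    unfolding AE_all_countable \<beta>_def
  proof (intro allI slln_unit_interval \<delta>(1))
    show "I_sel_deg E S (Suc i) d \<in> borel_measurable (\<F> (Suc i))" for i d
      using F_sigma_measurable[of "Suc i" "Suc i" "\<lambda>e s. of_bool (New (Suc i) \<in> s \<and> deg e (New (Suc i)) = d)"]
      by (simp add: I_sel_deg_def[abs_def])
  qed (simp add: I_sel_deg_def)
  have slln_sel: "AE w in M. (\<forall>i. 0 \<le> cexp i (I_sel S (Suc i)) w) \<and>
      (\<lambda>n. (\<Sum>i<n. I_sel S (Suc i) w - cexp i (I_sel S (Suc i)) w)
        / (\<beta> n + (\<Sum>i<n. cexp i (I_sel S (Suc i)) w))) \<longlonglongrightarrow> 0"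
    unfolding \<beta>_def
  proof (intro slln_unit_interval \<delta>(1))
    show "I_sel S (Suc i) \<in> borel_measurable (\<F> (Suc i))" for i
      using F_sigma_measurable[of "Suc i" "Suc i" "\<lambda>e s. of_bool (New (Suc i) \<in> s)"]
      by (simp add: I_sel_def[abs_def])
  qed (simp add: I_sel_def)
  have prop_new: "AE w in M. \<forall>d. m \<le> d \<longrightarrow> (\<exists>r :: nat \<Rightarrow> real. r \<in> o(\<lambda>_. 1) \<and>
      (\<forall>\<^sub>F n in sequentially. (\<Sum>i<n. cexp i (I_sel_deg E S (Suc i) d) w)
        = (q d + r n) * (\<Sum>i<n. cexp i (I_sel S (Suc i)) w)))"
    (is "AE w in M. \<forall>d. _ \<longrightarrow> ?Q d w") unfolding AE_all_countable
  proof (intro allI)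
    fix d
    show "AE w in M. m \<le> d \<longrightarrow> ?Q d w"
    proof (cases "m \<le> d")
      case True
      have shift: "(\<Sum>i=1..n. f i) = (\<Sum>i<n. f (Suc i))" for f :: "nat \<Rightarrow> real" and n
        using sum.atLeast1_atMost_eq[of f n] by simp
      show ?thesis
        using h10[OF True] unfolding shift diff_Suc_1 by eventually_elim (rule impI)
    qed simp
  qed
  have "AE w in M. \<forall>n. 0 < \<zeta> n w"
    using \<zeta>_pos by (simp add: AE_all_countable)
  with h1 h4 slln_Y[OF vertex_process_verts] slln_Y[OF vertex_process_S] prop_Y slln_new slln_sel prop_new h9 AE_space
  have limits: "AE w in M. \<forall>d\<ge>m. (\<lambda>n. real (X_sel E S n d w) / real (card (S n w))) \<longlonglongrightarrow> R.x d"
  proof eventually_elim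
    \<comment> \<open>A path on which all strong laws and all almost sure hypotheses hold at once,
      for all degrees; the rest of the argument on it is deterministic.\<close>
    case (elim w)
    note w = elim(10) and \<zeta>0 = elim(11)
    define s where "s n = real (card (S n w))" for n
    have finS: "finite (S n w)" for n
      by (rule vertex_processD(2)[OF vertex_process_S w])
    have s_inc: "incseq s"
      unfolding s_def using h7[OF w] finS by (intro incseq_SucI) (simp add: card_mono)
    have s0: "0 \<le> s n" for n
      by (simp add: s_def)
    have s_asymp: "asymp_equiv s sequentially (\<lambda>n. \<zeta> n w * real n powr \<alpha>)"
      using elim(9) by (simp add: s_def[abs_def])
    have ratio: "(\<lambda>n. s (nat \<lfloor>\<theta> * real n\<rfloor>) / s n) \<longlonglongrightarrow> \<theta> powr \<alpha>" if "0 < \<theta>" for \<theta>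
      using elim(9) \<zeta>0 that s_asymp by (intro slowly_varying_powr_ratio[where \<zeta> = "\<lambda>n. \<zeta> n w"]) auto
    have s_pos: "\<forall>\<^sub>F n in sequentially. 0 < s n"
    proof -
      have g_pos: "\<forall>\<^sub>F n in sequentially. 0 < \<zeta> n w * real n powr \<alpha>"
        using eventually_gt_at_top[of 0] by eventually_elim (use \<zeta>0 in simp)
      then have "\<forall>\<^sub>F n in sequentially. s n \<noteq> 0 \<or> \<zeta> n w * real n powr \<alpha> \<noteq> 0"
        by eventually_elim (rule disjI2, rule less_imp_neq[THEN not_sym])
      then have "(\<lambda>n. s n / (\<zeta> n w * real n powr \<alpha>)) \<longlonglongrightarrow> 1"
        by (rule asymp_equivD_strong[OF s_asymp])
      then have "\<forall>\<^sub>F n in sequentially. 0 < s n / (\<zeta> n w * real n powr \<alpha>)"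
        by (rule order_tendstoD) simp
      with g_pos show ?thesis
        by eventually_elim (simp add: zero_less_divide_iff)
    qed
    have dominates: "(\<lambda>n. real n powr a / s n) \<longlonglongrightarrow> 0" if "a < \<alpha>" for a
      using ratio[of "1 / 2"] by (intro regularly_varying_dominates_powr[OF s0 s_pos _ that]) simp
    have s_top: "filterlim s at_top sequentially"
      by (rule regularly_varying_at_top[OF s_pos dominates[OF \<delta>(2)]]) (use \<delta> in simp)
    have \<beta>_s: "(\<lambda>n. \<beta> n / s n) \<longlonglongrightarrow> 0"
      unfolding \<beta>_eq by (intro tendsto_powr_shift_divide dominates \<delta>)
    have X: "(\<lambda>n. degree_count ?V n d w / real n) \<longlonglongrightarrow> c d" if d: "m \<le> d" for d
    proof -
      have XV: "degree_count ?V n d w = real (X_count l E n d w)" for n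
        by (simp add: degree_count_def X_count_def)
      have eq: "asymp_equiv (\<lambda>n. real (X_count l E n d w)) sequentially (\<lambda>n. c d * real n)"
        using elim(1) d by simp
      have "\<forall>\<^sub>F n in sequentially. real (X_count l E n d w) \<noteq> 0 \<or> c d * real n \<noteq> 0"
        using eventually_gt_at_top[of 0] by eventually_elim (use c_pos[OF d] in simp)
      then have "(\<lambda>n. real (X_count l E n d w) / (c d * real n)) \<longlonglongrightarrow> 1"
        by (rule asymp_equivD_strong[OF eq])
      then have "(\<lambda>n. c d * (real (X_count l E n d w) / (c d * real n))) \<longlonglongrightarrow> c d * 1"
        by (intro tendsto_mult tendsto_const)
      then show ?thesis
        using c_pos[OF d] by (simp add: XV)
    qed
    have Y: "(\<lambda>n. (\<Sum>i<n. receiving_count ?V i d w) / real n) \<longlonglongrightarrow> k d" if d: "m \<le> d" for d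
      unfolding k_def[OF d]
    proof (rule receiving_mean[OF w d X])
      show "(\<lambda>n. (\<Sum>i=1..Suc n. I_new E i j w) - p j * real n) \<in> o(\<lambda>n. real n)" if "m \<le> j" for j
        using elim(2) that by simp
    qed
    have XS: "degree_count S n d w = real (X_sel E S n d w)" for n d
      by (simp add: degree_count_def X_sel_def)
    have XS_le: "0 \<le> degree_count S n d w \<and> degree_count S n d w \<le> s n" for n d
      unfolding degree_count_def s_def using finS by (auto intro!: card_mono)
    have sel_lim: "(\<lambda>n. (\<Sum>i<n. I_sel S (Suc i) w) / s n) \<longlonglongrightarrow> 1"
    proof (rule tendsto_of_bounded_numerator_diff[OF _ _ s_top])
      show "\<bar>(\<Sum>i<n. I_sel S (Suc i) w) - s n\<bar> \<le> s 0" for n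
        unfolding card_S_telescope[OF w] s_def by simp
      show "(\<lambda>n. s n / s n) \<longlonglongrightarrow> 1"
        by (rule Lim_transform_eventually[OF tendsto_const])
          (use s_pos in \<open>eventually_elim, simp\<close>)
    qed
    have new_lim: "(\<lambda>n. (\<Sum>i<n. I_sel_deg E S (Suc i) d w) / s n) \<longlonglongrightarrow> q d" if d: "m \<le> d" for d
    proof -
      from elim(8) d have "?Q d w"
        by simp
      then obtain r :: "nat \<Rightarrow> real" where r: "r \<in> o(\<lambda>_. 1)"
        and eq: "\<forall>\<^sub>F n in sequentially. (\<Sum>i<n. cexp i (I_sel_deg E S (Suc i) d) w)
          = (q d + r n) * (\<Sum>i<n. cexp i (I_sel S (Suc i)) w)"
        by (elim exE conjE)
      have r0: "r \<longlonglongrightarrow> 0"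
        using smalloD_tendsto[OF r] by simp
      have A: "(\<lambda>n. ((\<Sum>i<n. I_sel S (Suc i) w) - (\<Sum>i<n. cexp i (I_sel S (Suc i)) w))
          / (\<beta> n + (\<Sum>i<n. cexp i (I_sel S (Suc i)) w))) \<longlonglongrightarrow> 0"
        using elim(7) by (simp only: sum_subtractf)
      have H: "(\<lambda>n. ((\<Sum>i<n. I_sel_deg E S (Suc i) d w) - (\<Sum>i<n. cexp i (I_sel_deg E S (Suc i) d) w))
          / (\<beta> n + (\<Sum>i<n. cexp i (I_sel_deg E S (Suc i) d) w))) \<longlonglongrightarrow> 0"
        using elim(6) by (simp only: sum_subtractf)
      show ?thesis
        by (rule compensated_proportion[OF A sel_lim H eq r0 \<beta>_s \<beta>_pos])
          (use elim(6,7) s0 in \<open>auto intro: sum_nonneg\<close>)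
    qed
    have balance: "(\<lambda>n. ((\<Sum>i<n. receiving_count S i d w) + (\<Sum>j=m..d. degree_count S n j w)) / s n) \<longlonglongrightarrow> (\<Sum>j=m..d. q j)"
      if d: "m \<le> d" for d
    proof (rule tendsto_of_bounded_numerator_diff[OF count_balance[OF vertex_process_S w d] _ s_top])
      have newcomer: "(\<Sum>i=1..n. newcomer S i j w) = (\<Sum>i<n. I_sel_deg E S (Suc i) j w)" for n j
        using sum.atLeast1_atMost_eq[of "\<lambda>i. newcomer S i j w" n] by (simp add: newcomer_def I_sel_deg_def)
      show "(\<lambda>n. (\<Sum>j=m..d. \<Sum>i=1..n. newcomer S i j w) / s n) \<longlonglongrightarrow> (\<Sum>j=m..d. q j)"
        unfolding newcomer sum_divide_distrib[of _ "{m..d}"] by (intro tendsto_sum new_lim) simp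
    qed
    have "(\<lambda>n. degree_count S n d w / s n) \<longlonglongrightarrow> R.x d" if d: "m \<le> d" for d
    proof (rule R.selected_fraction_limit[where X = "\<lambda>n d. degree_count ?V n d w" and Y = "\<lambda>i d. receiving_count ?V i d w"
          and y = "\<lambda>i d. cexp i (receiving_count ?V i d) w" and Xs = "\<lambda>n d. degree_count S n d w"
          and Ys = "\<lambda>i d. receiving_count S i d w" and ys = "\<lambda>i d. cexp i (receiving_count S i d) w",
          OF s_inc s0 s_top ratio \<beta>_pos \<beta>_s \<beta>_n X Y _ _ XS_le _ _ balance d])
      show "0 \<le> cexp i (receiving_count ?V i d) w \<and> cexp i (receiving_count ?V i d) w \<le> degree_count ?V i d w" for i d
        using elim(5) by simp
      show "cexp i (receiving_count S i d) w
          = degree_count S i d w * (cexp i (receiving_count ?V i d) w / degree_count ?V i d w)" for i d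
        using elim(5) by simp
      show "(\<lambda>n. (\<Sum>i<n. receiving_count ?V i d w - cexp i (receiving_count ?V i d) w)
          / (\<beta> n + (\<Sum>i<n. cexp i (receiving_count ?V i d) w))) \<longlonglongrightarrow> 0" if "m \<le> d" for d
        using elim(3) that by simp
      show "(\<lambda>n. (\<Sum>i<n. receiving_count S i d w - cexp i (receiving_count S i d) w)
          / (\<beta> n + (\<Sum>i<n. cexp i (receiving_count S i d) w))) \<longlonglongrightarrow> 0" if "m \<le> d" for d
        using elim(4) that by simp
    qed
    then show ?case
      unfolding XS s_def by blast
  qed
  have "\<forall>d\<ge>Suc m. R.x d = (R.x (d - 1) * (k (d - 1) / c (d - 1)) + \<alpha> * q d) / (\<alpha> + k d / c d)"
    by (intro allI impI R.x_step)
  with limits R.x_start R.prob_dist_x R.x_asymp show ?thesis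
    by (intro exI[of _ R.x] conjI)
qed

end
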